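(* Let $H$ be a finite dimensional Hopf algebra over a field $k$ with antipode $S$, and let $G=\mathrm{Aut}_{Hopf}(H)\times \mathrm{Aut}_{Hopf}(H)$ with multiplication $(\alpha,\beta)*(\gamma,\delta)=(\delta\alpha\delta^{-1}\gamma,\delta\beta)$. Let $CT(H)=\{CT(H)_{(\alpha,\beta)}\}_{(\alpha,\beta)\in G}$ with $CT(H)_{(\alpha,\beta)}=H^{*op}\bowtie H(\alpha,\beta)$ the diagonal crossed coproduct coalgebra. Then $CT(H)$ is a Turaev $G$-algebra with multiplication $$m_{(\alpha,\beta),(\gamma,\delta)}:\ H^{*op}\bowtie H(\alpha,\beta)\otimes H^{*op}\bowtie H(\gamma,\delta)\to H^{*op}\bowtie H((\alpha,\beta)*(\gamma,\delta)),$$ $$(p\bowtie h)\otimes(q\bowtie h')\mapsto qp\bowtie\delta(h)\,\delta\alpha\delta^{-1}(h'),$$ unit $\varepsilon\bowtie1\in CT(H)_{(id,id)}$, and antipode $$S_{(\alpha,\beta)}:H^{*op}\bowtie H(\alpha,\beta)\to H^{*op}\bowtie H((\alpha,\beta)^{-1}),$$ $$p\bowtie h\mapsto\sum_{i,j}h^i\,S^{-1*}(p)\,S^{-1*}(h^j)\bowtie\beta^{-1}(h_j)\,\beta^{-1}\alpha^{-1}S(h)\,\beta^{-1}\alpha^{-1}\beta(h_i),$$ where $\{h_i\}$, $\{h^i\}$ are dual bases of $H$ and $H^*$.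
   Context: $\mathrm{Aut}_{Hopf}(H)$ is the group of Hopf algebra automorphisms of $H$ under composition. In $G$ the unit is $(id,id)$ and $(\alpha,\beta)^{-1}=(\beta^{-1}\alpha^{-1}\beta,\beta^{-1})$. Since $H$ is finite dimensional, $S$ is bijective. On $H^*$ juxtaposition denotes the convolution product $(pq)(h)=p(h_1)q(h_2)$ (with unit $\varepsilon$), $p\mapsto p_1\otimes p_2$ is determined by $p(hh')=p_1(h)p_2(h')$, and $S^{-1*}(p)=p\circ S^{-1}$. $H^{*op}$ is $H^*$ with opposite multiplication; all products of elements of $H^*$ written in formulas are convolution products. $H(\alpha,\beta)$ is the coalgebra $H$ with $H$-bimodule structure $h\cdot h'=\beta(h)h'$, $h'\cdot h=h'\alpha(h)$. The coalgebra $H^{*op}\bowtie H(\alpha,\beta)$ is the vector space $H^*\otimes H$ (elements $p\bowtie h$) with $$\bar\Delta(p\bowtie h)=\sum_{i,j}\bigl(p_1\bowtie\beta(h_j)h_1S^{-1}\alpha(h_i)\bigr)\otimes\bigl(h^ip_2h^j\bowtie h_2\bigr),\qquad\bar\varepsilon(p\bowtie h)=p(1)\varepsilon(h),$$ where $h_1\otimes h_2=\Delta(h)$ and $\{h_i\},\{h^i\}$ (summed over $i,j$) are dual bases. For a group $G$ with unit $1$, a Turaev $G$-algebra is a family $A=\{A_a\}_{a\in G}$ of coalgebras $(A_a,\Delta_a,\varepsilon_a)$ with coalgebra maps $m_{a,b}:A_a\otimes A_b\to A_{ab}$ and a coalgebra map $\eta:k\to A_1$ such that $m_{ab,c}(m_{a,b}\otimes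 id)=m_{a,bc}(id\otimes m_{b,c})$ and $m_{a,1}(id\otimes\eta)=id=m_{1,a}(\eta\otimes id)$, together with linear maps $S_a:A_a\to A_{a^{-1}}$ (antipode) satisfying $m_{a,a^{-1}}(id\otimes S_a)\Delta_a=\varepsilon_a1=m_{a^{-1},a}(S_a\otimes id)\Delta_a$. *)

theory Defs
  imports Complex_Main "HOL-Algebra.Group" "HOL-Library.Function_Algebras"
begin

text \<open>
  A vector space is given by a scalar multiplication on an ambient abelian group together with
  a subspace as carrier; addition is that of the ambient type. Carriers are needed because the
  dual space and tensor products depend on the scalar multiplication and hence are not types.
\<close>

record ('k, 'v) vsp =
  vscale :: "'k \<Rightarrow> 'v \<Rightarrow> 'v"
  vset :: "'v set"

definition vspace :: "('k::field, 'v::ab_group_add, 'z) vsp_scheme \<Rightarrow> bool" where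
  "vspace V \<longleftrightarrow> vector_space (vscale V) \<and> module.subspace (vscale V) (vset V)"

definition lin ::
  "('k::field, 'v::ab_group_add, 'y) vsp_scheme \<Rightarrow> ('k, 'w::ab_group_add, 'z) vsp_scheme
    \<Rightarrow> ('v \<Rightarrow> 'w) \<Rightarrow> bool" where
  "lin V W f \<longleftrightarrow>
     (\<forall>x\<in>vset V. f x \<in> vset W) \<and>
     (\<forall>x\<in>vset V. \<forall>y\<in>vset V. f (x + y) = f x + f y) \<and>
     (\<forall>c. \<forall>x\<in>vset V. f (vscale V c x) = vscale W c (f x))"

definition bilin ::
  "('k::field, 'v::ab_group_add, 'x) vsp_scheme \<Rightarrow> ('k, 'w::ab_group_add, 'y) vsp_scheme
    \<Rightarrow> ('k, 'u::ab_group_add, 'z) vsp_scheme \<Rightarrow> ('v \<Rightarrow> 'w \<Rightarrow> 'u) \<Rightarrow> bool" where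
  "bilin V W U F \<longleftrightarrow>
     (\<forall>v\<in>vset V. lin W U (F v)) \<and> (\<forall>w\<in>vset W. lin V U (\<lambda>v. F v w))"

definition base_field :: "('k::field, 'k) vsp" where
  "base_field = \<lparr>vscale = (*), vset = UNIV\<rparr>"

definition fscale :: "'k::field \<Rightarrow> ('x \<Rightarrow> 'k) \<Rightarrow> 'x \<Rightarrow> 'k" where
  "fscale c f = (\<lambda>x. c * f x)"

definition dual :: "('k::field, 'v::ab_group_add, 'z) vsp_scheme \<Rightarrow> ('k, 'v \<Rightarrow> 'k) vsp" where
  "dual V = \<lparr>vscale = fscale, vset = {p. lin V base_field p}\<rparr>"


section \<open>Tensor products\<close>

text \<open>
  Over a field, \<open>V \<otimes> W\<close> embeds into the dual of the space of bilinear forms on \<open>V \<times> W\<close>, with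
  \<open>v \<otimes> w\<close> acting by evaluation; it is modelled as the span of these evaluations. The choice of
  model is immaterial: the universal property is proved below, and all maps out of a tensor
  product are introduced through it by \<open>tlift\<close>.
\<close>

type_synonym ('k, 'v, 'w) tensor = "('v \<Rightarrow> 'w \<Rightarrow> 'k) \<Rightarrow> 'k"

definition tpure ::
  "('k::field, 'v::ab_group_add, 'y) vsp_scheme \<Rightarrow> ('k, 'w::ab_group_add, 'z) vsp_scheme
    \<Rightarrow> 'v \<Rightarrow> 'w \<Rightarrow> ('k, 'v, 'w) tensor" where
  "tpure V W v w = (\<lambda>\<phi>. if bilin V W base_field \<phi> then \<phi> v w else 0)"

definition tensor ::
  "('k::field, 'v::ab_group_add, 'y) vsp_scheme \<Rightarrow> ('k, 'w::ab_group_add, 'z) vsp_scheme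
    \<Rightarrow> ('k, ('k, 'v, 'w) tensor) vsp" where
  "tensor V W =
     \<lparr>vscale = fscale,
      vset = module.span fscale {tpure V W v w |v w. v \<in> vset V \<and> w \<in> vset W}\<rparr>"

text \<open>The linear map \<open>V \<otimes> W \<rightarrow> U\<close> with \<open>v \<otimes> w \<mapsto> F v w\<close>; only its values on the carrier of
  \<open>V \<otimes> W\<close> are determined.\<close>

definition tlift ::
  "('k::field, 'v::ab_group_add, 'x) vsp_scheme \<Rightarrow> ('k, 'w::ab_group_add, 'y) vsp_scheme
    \<Rightarrow> ('k, 'u::ab_group_add, 'z) vsp_scheme \<Rightarrow> ('v \<Rightarrow> 'w \<Rightarrow> 'u) \<Rightarrow> ('k, 'v, 'w) tensor \<Rightarrow> 'u" where
  "tlift V W U F =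
     (SOME L. lin (tensor V W) U L \<and> (\<forall>v\<in>vset V. \<forall>w\<in>vset W. L (tpure V W v w) = F v w))"

lemma vector_space_mult: "vector_space ((*) :: 'k::field \<Rightarrow> 'k \<Rightarrow> 'k)"
  by unfold_locales (simp_all add: algebra_simps)

lemma vector_space_fscale: "vector_space (fscale :: 'k::field \<Rightarrow> ('x \<Rightarrow> 'k) \<Rightarrow> 'x \<Rightarrow> 'k)"
  by unfold_locales (simp_all add: fscale_def fun_eq_iff algebra_simps)

lemma module_fscale: "module (fscale :: 'k::field \<Rightarrow> ('x \<Rightarrow> 'k) \<Rightarrow> 'x \<Rightarrow> 'k)"
  using vector_space_fscale by (simp add: module_iff_vector_space)

lemma vspace_tensor: "vspace (tensor V W)"
  by (simp add: vspace_def tensor_def vector_space_fscale module.subspace_span[OF module_fscale])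

lemma tpure_in_tensor:
  "v \<in> vset V \<Longrightarrow> w \<in> vset W \<Longrightarrow> tpure V W v w \<in> vset (tensor V W)"
  by (auto simp: tensor_def intro!: module.span_base[OF module_fscale])

lemma bilin_tpure: "bilin V W (tensor V W) (tpure V W)"
  by (auto simp: bilin_def lin_def tpure_in_tensor)
     (auto simp: tensor_def tpure_def fscale_def fun_eq_iff bilin_def lin_def base_field_def)

lemma functionals_separate:
  assumes "vector_space (s :: 'k::field \<Rightarrow> 'u::ab_group_add \<Rightarrow> 'u)" "u \<noteq> 0"
  obtains l where "Vector_Spaces.linear s (*) l" "l u \<noteq> 0"
proof -
  interpret vector_space_pair s "(*) :: 'k \<Rightarrow> 'k \<Rightarrow> 'k"
    using assms(1) vector_space_mult by (simp add: vector_space_pair_def)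
  have "vs1.independent {u}"
    using assms(2) by (simp add: vs1.dependent_single)
  from linear_independent_extend[OF this, of "\<lambda>_. 1"]
  show thesis using that by force
qed

theorem tlift_universal:
  fixes V :: "('k::field, 'v::ab_group_add, 'x) vsp_scheme"
    and W :: "('k, 'w::ab_group_add, 'y) vsp_scheme"
    and U :: "('k, 'u::ab_group_add, 'z) vsp_scheme"
  assumes U: "vspace U" and F: "bilin V W U F"
  shows "lin (tensor V W) U (tlift V W U F)"
    and "\<And>v w. v \<in> vset V \<Longrightarrow> w \<in> vset W \<Longrightarrow> tlift V W U F (tpure V W v w) = F v w"
proof -
  let ?s = "vscale U"
  let ?T = "vset (tensor V W)"
  let ?G = "{tpure V W v w |v w. v \<in> vset V \<and> w \<in> vset W}"
  have vsU: "vector_space ?s" and subU: "module.subspace ?s (vset U)"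
    using U by (auto simp: vspace_def)
  have modU: "module ?s"
    using vsU by (simp add: module_iff_vector_space)
  interpret U: module ?s by (rule modU)
  interpret T: module "fscale :: 'k \<Rightarrow> ('k, 'v, 'w) tensor \<Rightarrow> ('k, 'v, 'w) tensor"
    by (rule module_fscale)
  define P where "P t u \<longleftrightarrow> u \<in> vset U \<and>
      (\<forall>l. Vector_Spaces.linear ?s (*) l \<longrightarrow> t (\<lambda>v w. l (F v w)) = l u)" for t u
  have lrule: "l (x + y) = l x + l y" "l (?s c x) = c * l x" "l 0 = 0" "l (x - y) = l x - l y"
    if "Vector_Spaces.linear ?s (*) l" for l x y c
  proof -
    interpret l: module_hom ?s "(*)" l
      using that by (simp add: Vector_Spaces.linear_def)
    show "l (x + y) = l x + l y" "l (?s c x) = c * l x" "l 0 = 0" "l (x - y) = l x - l y"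
      by (rule l.add l.scale l.zero l.diff)+
  qed
  have uniq: "u = u'" if "P t u" "P t u'" for t u u'
  proof (rule ccontr)
    assume "u \<noteq> u'"
    then have "u - u' \<noteq> 0" by simp
    then obtain l where l: "Vector_Spaces.linear ?s (*) l" "l (u - u') \<noteq> 0"
      using functionals_separate[OF vsU] by blast
    have "l u = l u'" using that l(1) by (auto simp: P_def)
    moreover have "l (u - u') = l u - l u'"
      using l(1) by (rule lrule)
    ultimately show False using l(2) by simp
  qed
  have P0: "P 0 0"
    using U.subspace_0[OF subU] by (auto simp: P_def lrule)
  have Padd: "P (t + t') (u + u')" if "P t u" "P t' u'" for t t' u u'
    using that U.subspace_add[OF subU] by (auto simp: P_def lrule)
  have Pscale: "P (fscale c t) (?s c u)" if "P t u" for c t u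
    using that U.subspace_scale[OF subU] by (auto simp: P_def lrule fscale_def)
  have Ppure: "P (tpure V W v w) (F v w)" if "v \<in> vset V" "w \<in> vset W" for v w
  proof -
    have "bilin V W base_field (\<lambda>v w. l (F v w))" if "Vector_Spaces.linear ?s (*) l" for l
      using F that by (auto simp: bilin_def lin_def base_field_def lrule)
    moreover have "F v w \<in> vset U"
      using F that by (auto simp: bilin_def lin_def)
    ultimately show ?thesis by (auto simp: P_def tpure_def)
  qed
  have Pex: "\<exists>u. P t u" if "t \<in> ?T" for t
  proof -
    have "t \<in> T.span ?G" using that by (simp add: tensor_def)
    then show ?thesis
    proof (induction rule: T.span_induct_alt)
      case base
      then show ?case using P0 by blast
    next
      case (step c x y)
      then show ?case using Ppure Padd Pscale by blast
    qed
  qed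
  define L where "L t = (THE u. P t u)" for t
  have L: "L t = u" if "P t u" for t u
    unfolding L_def using that uniq by blast
  have PL: "P t (L t)" if "t \<in> ?T" for t
    using Pex[OF that] L by blast
  have "lin (tensor V W) U L"
    unfolding lin_def
  proof (intro conjI ballI allI)
    fix t assume t: "t \<in> ?T"
    show "L t \<in> vset U" using PL[OF t] by (simp add: P_def)
    show "L (vscale (tensor V W) c t) = ?s c (L t)" for c
      using L[OF Pscale[OF PL[OF t]]] by (simp add: tensor_def)
    show "L (t + t') = L t + L t'" if "t' \<in> ?T" for t'
      using L[OF Padd[OF PL[OF t] PL[OF that]]] .
  qed
  moreover have "\<forall>v\<in>vset V. \<forall>w\<in>vset W. L (tpure V W v w) = F v w"
    using L Ppure by blast
  ultimately have ex: "\<exists>L. lin (tensor V W) U L \<and>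
      (\<forall>v\<in>vset V. \<forall>w\<in>vset W. L (tpure V W v w) = F v w)" by blast
  show "lin (tensor V W) U (tlift V W U F)"
    and "\<And>v w. v \<in> vset V \<Longrightarrow> w \<in> vset W \<Longrightarrow> tlift V W U F (tpure V W v w) = F v w"
    using someI_ex[OF ex] unfolding tlift_def by auto
qed

theorem tensor_lin_unique:
  assumes "lin (tensor V W) U L" "lin (tensor V W) U L'"
    and "\<And>v w. v \<in> vset V \<Longrightarrow> w \<in> vset W \<Longrightarrow> L (tpure V W v w) = L' (tpure V W v w)"
    and "t \<in> vset (tensor V W)"
  shows "L t = L' t"
proof -
  interpret T: module fscale by (rule module_fscale)
  let ?G = "{tpure V W v w |v w. v \<in> vset V \<and> w \<in> vset W}"
  have t: "t \<in> T.span ?G" using assms(4) by (simp add: tensor_def)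
  have lin0: "M 0 = 0" if "lin (tensor V W) U M" for M
  proof -
    have "0 \<in> vset (tensor V W)" by (simp add: tensor_def T.span_zero)
    then have "M (0 + 0) = M 0 + M 0"
      using that unfolding lin_def by blast
    then show ?thesis by simp
  qed
  from t have "t \<in> T.span ?G \<and> L t = L' t"
  proof (induction rule: T.span_induct_alt)
    case base
    then show ?case
      using lin0[OF assms(1)] lin0[OF assms(2)] T.span_zero[of ?G] by metis
  next
    case (step c x y)
    then have x: "x \<in> vset (tensor V W)" and cx: "fscale c x \<in> vset (tensor V W)"
      and y: "y \<in> vset (tensor V W)"
      by (auto simp: tensor_def intro: T.span_base T.span_scale)
    have lin_comb: "M (fscale c x + y) = vscale U c (M x) + M y"
      if "lin (tensor V W) U M" for M
      using that x cx y unfolding lin_def by (auto simp: tensor_def)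
    have "L x = L' x" using step(1) assms(3) by auto
    then have "L (fscale c x + y) = L' (fscale c x + y)"
      using step(2) by (simp only: lin_comb[OF assms(1)] lin_comb[OF assms(2)])
    moreover have "fscale c x + y \<in> T.span ?G"
      by (rule T.span_add[OF T.span_scale[OF T.span_base[OF step(1)]] conjunct1[OF step(2)]])
    ultimately show ?case by blast
  qed
  then show ?thesis by blast
qed

text \<open>\<open>f \<otimes> g : V \<otimes> W \<rightarrow> V' \<otimes> W'\<close>\<close>

definition tmap ::
  "('k::field, 'v::ab_group_add, 'p) vsp_scheme \<Rightarrow> ('k, 'w::ab_group_add, 'q) vsp_scheme
    \<Rightarrow> ('k, 'x::ab_group_add, 'r) vsp_scheme \<Rightarrow> ('k, 'y::ab_group_add, 's) vsp_scheme
    \<Rightarrow> ('v \<Rightarrow> 'x) \<Rightarrow> ('w \<Rightarrow> 'y) \<Rightarrow> ('k, 'v, 'w) tensor \<Rightarrow> ('k, 'x, 'y) tensor" where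
  "tmap V W V' W' f g = tlift V W (tensor V' W') (\<lambda>v w. tpure V' W' (f v) (g w))"

text \<open>\<open>(U \<otimes> V) \<otimes> W \<rightarrow> U \<otimes> (V \<otimes> W)\<close>, \<open>(u \<otimes> v) \<otimes> w \<mapsto> u \<otimes> (v \<otimes> w)\<close>\<close>

definition tassoc ::
  "('k::field, 'u::ab_group_add, 'p) vsp_scheme \<Rightarrow> ('k, 'v::ab_group_add, 'q) vsp_scheme
    \<Rightarrow> ('k, 'w::ab_group_add, 'r) vsp_scheme
    \<Rightarrow> ('k, ('k, 'u, 'v) tensor, 'w) tensor \<Rightarrow> ('k, 'u, ('k, 'v, 'w) tensor) tensor" where
  "tassoc U V W =
     tlift (tensor U V) W (tensor U (tensor V W))
       (\<lambda>t w. tlift U V (tensor U (tensor V W))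
          (\<lambda>u v. tpure U (tensor V W) u (tpure V W v w)) t)"

text \<open>\<open>(A \<otimes> B) \<otimes> (C \<otimes> D) \<rightarrow> (A \<otimes> C) \<otimes> (B \<otimes> D)\<close>,
  \<open>(a \<otimes> b) \<otimes> (c \<otimes> d) \<mapsto> (a \<otimes> c) \<otimes> (b \<otimes> d)\<close>\<close>

definition tmiddle ::
  "('k::field, 'a::ab_group_add, 'p) vsp_scheme \<Rightarrow> ('k, 'b::ab_group_add, 'q) vsp_scheme
    \<Rightarrow> ('k, 'c::ab_group_add, 'r) vsp_scheme \<Rightarrow> ('k, 'd::ab_group_add, 's) vsp_scheme
    \<Rightarrow> ('k, ('k, 'a, 'b) tensor, ('k, 'c, 'd) tensor) tensor
    \<Rightarrow> ('k, ('k, 'a, 'c) tensor, ('k, 'b, 'd) tensor) tensor" where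
  "tmiddle A B C D =
     (let X = tensor (tensor A C) (tensor B D) in
      tlift (tensor A B) (tensor C D) X
        (\<lambda>s t. tlift A B X
           (\<lambda>a b. tlift C D X
              (\<lambda>c d. tpure (tensor A C) (tensor B D) (tpure A C a c) (tpure B D b d)) t) s))"


section \<open>Coalgebras and Hopf algebras\<close>

record ('k, 'v) coalg = "('k, 'v) vsp" +
  comul :: "'v \<Rightarrow> ('k, 'v, 'v) tensor"
  counit :: "'v \<Rightarrow> 'k"

definition coalgebra :: "('k::field, 'v::ab_group_add, 'z) coalg_scheme \<Rightarrow> bool" where
  "coalgebra C \<longleftrightarrow>
     vspace C \<and> lin C (tensor C C) (comul C) \<and> lin C base_field (counit C) \<and>
     (\<forall>x\<in>vset C. tassoc C C C (tmap C C (tensor C C) C (comul C) id (comul C x)) =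
                 tmap C C C (tensor C C) id (comul C) (comul C x)) \<and>
     (\<forall>x\<in>vset C. tlift C C C (\<lambda>a b. vscale C (counit C a) b) (comul C x) = x) \<and>
     (\<forall>x\<in>vset C. tlift C C C (\<lambda>a b. vscale C (counit C b) a) (comul C x) = x)"

definition coalgebra_map ::
  "('k::field, 'v::ab_group_add, 'y) coalg_scheme \<Rightarrow> ('k, 'w::ab_group_add, 'z) coalg_scheme
    \<Rightarrow> ('v \<Rightarrow> 'w) \<Rightarrow> bool" where
  "coalgebra_map C D f \<longleftrightarrow>
     lin C D f \<and>
     (\<forall>x\<in>vset C. comul D (f x) = tmap C C D D f f (comul C x)) \<and>
     (\<forall>x\<in>vset C. counit D (f x) = counit C x)"

definition base_coalgebra :: "('k::field, 'k) coalg" where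
  "base_coalgebra =
     \<lparr>vscale = (*), vset = UNIV,
      comul = (\<lambda>c. fscale c (tpure base_field base_field 1 1)), counit = id\<rparr>"

definition tensor_coalgebra ::
  "('k::field, 'v::ab_group_add, 'y) coalg_scheme \<Rightarrow> ('k, 'w::ab_group_add, 'z) coalg_scheme
    \<Rightarrow> ('k, ('k, 'v, 'w) tensor) coalg" where
  "tensor_coalgebra C D =
     \<lparr>vscale = vscale (tensor C D), vset = vset (tensor C D),
      comul = (\<lambda>t. tmiddle C C D D
                 (tmap C D (tensor C C) (tensor D D) (comul C) (comul D) t)),
      counit = tlift C D base_field (\<lambda>c d. counit C c * counit D d)\<rparr>"

text \<open>The algebra structure of a Hopf algebra is the ring structure of its type; the requirement
  \<open>0 \<noteq> 1\<close> of \<open>ring_1\<close> is no restriction, as \<open>\<epsilon>(1) = 1\<close>.\<close>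

locale hopf_algebra =
  fixes H :: "('k::field, 'h::ring_1) coalg"
    and S :: "'h \<Rightarrow> 'h"
  assumes vset_UNIV: "vset H = UNIV"
    and coalgebra: "coalgebra H"
    and scale_mult_left: "vscale H c (x * y) = vscale H c x * y"
    and scale_mult_right: "vscale H c (x * y) = x * vscale H c y"
    and comul_one: "comul H 1 = tpure H H 1 1"
    and comul_mult: "comul H (x * y) =
      tlift H H (tensor H H) (\<lambda>a b. tlift H H (tensor H H) (\<lambda>c d. tpure H H (a * c) (b * d))
        (comul H y)) (comul H x)"
    and counit_one: "counit H 1 = 1"
    and counit_mult: "counit H (x * y) = counit H x * counit H y"
    and lin_antipode: "lin H H S"
    and antipode_left: "tlift H H H (\<lambda>a b. S a * b) (comul H x) = vscale H (counit H x) 1"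
    and antipode_right: "tlift H H H (\<lambda>a b. a * S b) (comul H x) = vscale H (counit H x) 1"

text \<open>Compatibility with the antipode is automatic for bialgebra maps and not required.\<close>

definition hopf_automorphism :: "('k::field, 'h::ring_1) coalg \<Rightarrow> ('h \<Rightarrow> 'h) \<Rightarrow> bool" where
  "hopf_automorphism H f \<longleftrightarrow>
     bij f \<and> coalgebra_map H H f \<and> f 1 = 1 \<and> (\<forall>x y. f (x * y) = f x * f y)"

text \<open>Function inverses are written \<open>inv_into UNIV\<close>: in the presence of \<open>HOL-Algebra\<close>, \<open>inv\<close>
  denotes the inverse in a group.\<close>

definition Aut_pairs :: "('k::field, 'h::ring_1) coalg \<Rightarrow> (('h \<Rightarrow> 'h) \<times> ('h \<Rightarrow> 'h)) monoid" where
  "Aut_pairs H =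
     \<lparr>carrier = {f. hopf_automorphism H f} \<times> {f. hopf_automorphism H f},
      mult = (\<lambda>(\<alpha>, \<beta>) (\<gamma>, \<delta>). (\<delta> \<circ> \<alpha> \<circ> inv_into UNIV \<delta> \<circ> \<gamma>, \<delta> \<circ> \<beta>)),
      one = (id, id)\<rparr>"


section \<open>Turaev group algebras\<close>

text \<open>The coalgebras of the family share an ambient type, but may have different carriers and
  scalar multiplications. The unit is the map \<open>\<eta>\<close>, and \<open>A\<^sub>a \<cong> A\<^sub>a \<otimes> k\<close> is \<open>x \<mapsto> x \<otimes> 1\<close>.\<close>

definition turaev_algebra ::
  "('g, 'm) monoid_scheme \<Rightarrow> ('g \<Rightarrow> ('k::field, 'v::ab_group_add) coalg)
    \<Rightarrow> ('g \<Rightarrow> 'g \<Rightarrow> ('k, 'v, 'v) tensor \<Rightarrow> 'v) \<Rightarrow> ('k \<Rightarrow> 'v) \<Rightarrow> ('g \<Rightarrow> 'v \<Rightarrow> 'v) \<Rightarrow> bool" where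
  "turaev_algebra G A m \<eta> S \<longleftrightarrow>
     group G \<and>
     (\<forall>a\<in>carrier G. coalgebra (A a)) \<and>
     (\<forall>a\<in>carrier G. \<forall>b\<in>carrier G.
        coalgebra_map (tensor_coalgebra (A a) (A b)) (A (a \<otimes>\<^bsub>G\<^esub> b)) (m a b)) \<and>
     coalgebra_map base_coalgebra (A \<one>\<^bsub>G\<^esub>) \<eta> \<and>
     (\<forall>a\<in>carrier G. \<forall>b\<in>carrier G. \<forall>c\<in>carrier G.
        \<forall>t\<in>vset (tensor (tensor (A a) (A b)) (A c)).
          m (a \<otimes>\<^bsub>G\<^esub> b) c
            (tmap (tensor (A a) (A b)) (A c) (A (a \<otimes>\<^bsub>G\<^esub> b)) (A c) (m a b) id t) =
          m a (b \<otimes>\<^bsub>G\<^esub> c)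
            (tmap (A a) (tensor (A b) (A c)) (A a) (A (b \<otimes>\<^bsub>G\<^esub> c)) id (m b c)
              (tassoc (A a) (A b) (A c) t))) \<and>
     (\<forall>a\<in>carrier G. \<forall>x\<in>vset (A a).
        m a \<one>\<^bsub>G\<^esub> (tmap (A a) base_field (A a) (A \<one>\<^bsub>G\<^esub>) id \<eta> (tpure (A a) base_field x 1)) = x \<and>
        m \<one>\<^bsub>G\<^esub> a (tmap base_field (A a) (A \<one>\<^bsub>G\<^esub>) (A a) \<eta> id (tpure base_field (A a) 1 x)) = x) \<and>
     (\<forall>a\<in>carrier G. lin (A a) (A (inv\<^bsub>G\<^esub> a)) (S a)) \<and>
     (\<forall>a\<in>carrier G. \<forall>x\<in>vset (A a).
        m a (inv\<^bsub>G\<^esub> a)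
          (tmap (A a) (A a) (A a) (A (inv\<^bsub>G\<^esub> a)) id (S a) (comul (A a) x)) = \<eta> (counit (A a) x) \<and>
        m (inv\<^bsub>G\<^esub> a) a
          (tmap (A a) (A a) (A (inv\<^bsub>G\<^esub> a)) (A a) (S a) id (comul (A a) x)) = \<eta> (counit (A a) x))"


section \<open>The diagonal crossed coproducts\<close>

definition conv :: "('k::field, 'h::ring_1) coalg \<Rightarrow> ('h \<Rightarrow> 'k) \<Rightarrow> ('h \<Rightarrow> 'k) \<Rightarrow> 'h \<Rightarrow> 'k" where
  "conv H p q = (\<lambda>h. tlift H H base_field (\<lambda>a b. p a * q b) (comul H h))"

text \<open>\<open>p \<mapsto> p\<^sub>1 \<otimes> p\<^sub>2 \<in> H\<^sup>* \<otimes> H\<^sup>*\<close>, determined by \<open>p (h h') = p\<^sub>1(h) p\<^sub>2(h')\<close>\<close>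

definition dual_comul ::
  "('k::field, 'h::ring_1) coalg \<Rightarrow> ('h \<Rightarrow> 'k) \<Rightarrow> ('k, 'h \<Rightarrow> 'k, 'h \<Rightarrow> 'k) tensor" where
  "dual_comul H p =
     (THE t. t \<in> vset (tensor (dual H) (dual H)) \<and>
        (\<forall>h h'. p (h * h') = tlift (dual H) (dual H) base_field (\<lambda>q r. q h * r h') t))"

text \<open>The dual basis \<open>h\<^sup>i\<close> of a basis \<open>B\<close>, indexed by the elements \<open>h\<^sub>i\<close> of \<open>B\<close> themselves\<close>

definition dual_basis :: "('k::field, 'h::ring_1) coalg \<Rightarrow> 'h set \<Rightarrow> 'h \<Rightarrow> 'h \<Rightarrow> 'k" where
  "dual_basis H B b = (\<lambda>x. module.representation (vscale H) B x b)"

abbreviation bowtie ::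
  "('k::field, 'h::ring_1) coalg \<Rightarrow> ('h \<Rightarrow> 'k) \<Rightarrow> 'h \<Rightarrow> ('k, 'h \<Rightarrow> 'k, 'h) tensor" where
  "bowtie H p h \<equiv> tpure (dual H) H p h"

definition CT ::
  "('k::field, 'h::ring_1) coalg \<Rightarrow> ('h \<Rightarrow> 'h) \<Rightarrow> 'h set \<Rightarrow> ('h \<Rightarrow> 'h) \<times> ('h \<Rightarrow> 'h)
    \<Rightarrow> ('k, ('k, 'h \<Rightarrow> 'k, 'h) tensor) coalg" where
  "CT H S B = (\<lambda>(\<alpha>, \<beta>).
     let X = tensor (dual H) H in
     \<lparr>vscale = vscale X, vset = vset X,
      comul = tlift (dual H) H (tensor X X)
        (\<lambda>p h. tlift (dual H) (dual H) (tensor X X)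
          (\<lambda>p1 p2. tlift H H (tensor X X)
            (\<lambda>h1 h2. \<Sum>i\<in>B. \<Sum>j\<in>B.
               tpure X X
                 (bowtie H p1 (\<beta> j * h1 * inv_into UNIV S (\<alpha> i)))
                 (bowtie H (conv H (conv H (dual_basis H B i) p2) (dual_basis H B j)) h2))
            (comul H h))
          (dual_comul H p)),
      counit = tlift (dual H) H base_field (\<lambda>p h. p 1 * counit H h)\<rparr>)"

definition CT_mult ::
  "('k::field, 'h::ring_1) coalg \<Rightarrow> ('h \<Rightarrow> 'h) \<times> ('h \<Rightarrow> 'h) \<Rightarrow> ('h \<Rightarrow> 'h) \<times> ('h \<Rightarrow> 'h)
    \<Rightarrow> ('k, ('k, 'h \<Rightarrow> 'k, 'h) tensor, ('k, 'h \<Rightarrow> 'k, 'h) tensor) tensor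
    \<Rightarrow> ('k, 'h \<Rightarrow> 'k, 'h) tensor" where
  "CT_mult H = (\<lambda>(\<alpha>, \<beta>) (\<gamma>, \<delta>).
     let X = tensor (dual H) H in
     tlift X X X
       (\<lambda>s t. tlift (dual H) H X
          (\<lambda>p h. tlift (dual H) H X
             (\<lambda>q h'. bowtie H (conv H q p) (\<delta> h * \<delta> (\<alpha> (inv_into UNIV \<delta> h')))) t) s))"

definition CT_unit :: "('k::field, 'h::ring_1) coalg \<Rightarrow> 'k \<Rightarrow> ('k, 'h \<Rightarrow> 'k, 'h) tensor" where
  "CT_unit H c = fscale c (bowtie H (counit H) 1)"

definition CT_antipode ::
  "('k::field, 'h::ring_1) coalg \<Rightarrow> ('h \<Rightarrow> 'h) \<Rightarrow> 'h set \<Rightarrow> ('h \<Rightarrow> 'h) \<times> ('h \<Rightarrow> 'h)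
    \<Rightarrow> ('k, 'h \<Rightarrow> 'k, 'h) tensor \<Rightarrow> ('k, 'h \<Rightarrow> 'k, 'h) tensor" where
  "CT_antipode H S B = (\<lambda>(\<alpha>, \<beta>).
     let \<alpha>' = inv_into UNIV \<alpha>; \<beta>' = inv_into UNIV \<beta>; S' = inv_into UNIV S in
     tlift (dual H) H (tensor (dual H) H)
       (\<lambda>p h. \<Sum>i\<in>B. \<Sum>j\<in>B.
          bowtie H
            (conv H (conv H (dual_basis H B i) (p \<circ> S')) (dual_basis H B j \<circ> S'))
            (\<beta>' j * \<beta>' (\<alpha>' (S h)) * \<beta>' (\<alpha>' (\<beta> i)))))"

end

theory Submission
  imports Defs
begin

text \<open>
  Tensors are functionals on bilinear forms, and over finite dimensional spaces an identity between
  tensors may be tested on products of linear forms. Read \<open>p \<bowtie> h\<close> as the map \<open>x \<mapsto> p(x) h\<close>. Then an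
  element of \<open>H\<^sup>* \<otimes> H\<close> is a linear map \<open>u : H \<rightarrow> H\<close>, the dual bases disappear, and the structure maps become
  \<open>\<Delta>(u)(x, y) = (\<beta>(y\<^sub>3) \<otimes> 1) \<Delta>(u(x y\<^sub>2)) (S\<^sup>-\<^sup>1\<alpha>(y\<^sub>1) \<otimes> 1)\<close> and
  \<open>(u v)(x) = \<delta>(u(x\<^sub>2)) \<delta>\<alpha>\<delta>\<^sup>-\<^sup>1(v(x\<^sub>1))\<close>. With these, every axiom is a Sweedler computation in \<open>H\<close> in which
  neighbouring components cancel through \<open>S\<close> or \<open>S\<^sup>-\<^sup>1\<close>.

  For the bijectivity of \<open>S\<close>, take \<open>m\<close> so large that \<open>H\<close> is the direct sum of the range and the kernel of
  \<open>S\<^sup>2\<^sup>m\<close>. The projection \<open>\<pi>\<close> onto the range is a coalgebra map with \<open>S\<^sup>2\<^sup>m\<pi> = S\<^sup>2\<^sup>m\<close>. As \<open>S\<^sup>j\<^sup>+\<^sup>1\<close> is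
  convolution inverse to \<open>S\<^sup>j\<close>, the exponent can be lowered step by step to \<open>\<pi> = id\<close>.
\<close>

section \<open>Tensors as functionals on bilinear forms\<close>

text \<open>Bijectivity of \<open>S\<close> comes before anything about \<open>CT\<close>: the
  coproduct and the antipode are written with \<open>inv_into UNIV S\<close>, which carries no
  information otherwise. The obstacle afterwards is bookkeeping. A Sweedler leg is not an element,
  so legs are bound variables of nested \<open>sw\<close>; \<open>sw_assoc\<close> and
  \<open>sw_swap\<close> regroup them until the two that should cancel are neighbours. A dual basis
  sum vanishes because testing at a point \<open>y\<close> puts the coordinate \<open>db d y\<close>
  in front of a function linear in \<open>d\<close>, and the sum over \<open>d\<close> is then the
  value of that function at \<open>y\<close>. The twist in the group law has its origin in one
  cancellation. In a product of two elements, a leg at the right end of the first factor appears as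
  \<open>\<delta> (\<alpha> (Si d))\<close>, and the neighbouring leg at the left end of the second
  as \<open>\<theta> (\<delta> e)\<close>, where \<theta> is the map applied to the second factor.
  They cancel once \<open>\<theta> \<circ> \<delta> = \<delta> \<circ> \<alpha>\<close>, that is,
  for \<theta> the conjugate of \<alpha> by \<delta>.\<close>

lemma vspaceD:
  assumes "vspace V"
  shows vspace_zero: "0 \<in> vset V"
    and vspace_add: "x \<in> vset V \<Longrightarrow> y \<in> vset V \<Longrightarrow> x + y \<in> vset V"
    and vspace_scale: "x \<in> vset V \<Longrightarrow> vscale V c x \<in> vset V"
    and vspace_module: "module (vscale V)"
proof -
  have m: "module (vscale V)" and s: "module.subspace (vscale V) (vset V)"
    using assms by (auto simp: vspace_def module_iff_vector_space)
  interpret module "vscale V" by (rule m)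
  show "0 \<in> vset V" "x \<in> vset V \<Longrightarrow> y \<in> vset V \<Longrightarrow> x + y \<in> vset V"
    "x \<in> vset V \<Longrightarrow> vscale V c x \<in> vset V"
    using s by (auto simp: subspace_def)
  show "module (vscale V)" by (rule m)
qed

lemma vspace_sum: "vspace V \<Longrightarrow> (\<And>i. i \<in> I \<Longrightarrow> x i \<in> vset V) \<Longrightarrow> (\<Sum>i\<in>I. x i) \<in> vset V"
  by (induction I rule: infinite_finite_induct) (auto simp: vspace_zero vspace_add)

lemma vspace_base_field: "vspace base_field"
  by (simp add: vspace_def base_field_def vector_space_mult module.subspace_UNIV
      vector_space_mult[folded module_iff_vector_space])

lemma base_field_simps [simp]: "vscale base_field = (*)" "vset base_field = UNIV"
  by (simp_all add: base_field_def)

lemma vscale_tensor [simp]: "vscale (tensor V W) = fscale"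
  by (simp add: tensor_def)

lemma fscale_apply [simp]: "fscale c f x = c * f x"
  by (simp add: fscale_def)

lemma sum_apply: "(\<Sum>i\<in>I. f i) x = (\<Sum>i\<in>I. f i x)"
  by (induction I rule: infinite_finite_induct) auto

lemma linI:
  assumes "\<And>x. x \<in> vset V \<Longrightarrow> f x \<in> vset W"
    and "\<And>x y. x \<in> vset V \<Longrightarrow> y \<in> vset V \<Longrightarrow> f (x + y) = f x + f y"
    and "\<And>c x. x \<in> vset V \<Longrightarrow> f (vscale V c x) = vscale W c (f x)"
  shows "lin V W f"
  using assms by (auto simp: lin_def)

lemma linD:
  assumes "lin V W f"
  shows lin_in: "x \<in> vset V \<Longrightarrow> f x \<in> vset W"
    and lin_add: "x \<in> vset V \<Longrightarrow> y \<in> vset V \<Longrightarrow> f (x + y) = f x + f y"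
    and lin_scale: "x \<in> vset V \<Longrightarrow> f (vscale V c x) = vscale W c (f x)"
  using assms by (auto simp: lin_def)

lemma lin_zero:
  assumes "vspace V" "lin V W f"
  shows "f 0 = 0"
  using lin_add[OF assms(2), of 0 0] vspace_zero[OF assms(1)] by simp

lemma lin_sum:
  assumes V: "vspace V" and f: "lin V W f" and x: "\<And>i. i \<in> I \<Longrightarrow> x i \<in> vset V"
  shows "f (\<Sum>i\<in>I. x i) = (\<Sum>i\<in>I. f (x i))"
  using x
proof (induction I rule: infinite_finite_induct)
  case (insert i I)
  then show ?case
    using lin_add[OF f, of "x i" "\<Sum>i\<in>I. x i"] vspace_sum[OF V, of I x] by simp
qed (simp_all add: lin_zero[OF V f])

lemma lin_cong:
  "vspace V \<Longrightarrow> lin V W f \<Longrightarrow> (\<And>x. x \<in> vset V \<Longrightarrow> g x = f x) \<Longrightarrow> lin V W g"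
  by (simp add: lin_def vspace_add vspace_scale)

lemma lin_comp: "lin U V f \<Longrightarrow> lin V W g \<Longrightarrow> lin U W (\<lambda>x. g (f x))"
  by (auto simp: lin_def)

lemma lin_id: "lin V V id" "lin V V (\<lambda>x. x)"
  by (auto simp: lin_def)

lemma bilinI:
  assumes "\<And>v. v \<in> vset V \<Longrightarrow> lin W U (F v)" "\<And>w. w \<in> vset W \<Longrightarrow> lin V U (\<lambda>v. F v w)"
  shows "bilin V W U F"
  using assms by (auto simp: bilin_def)

lemma bilinD:
  assumes "bilin V W U F"
  shows bilin_right: "v \<in> vset V \<Longrightarrow> lin W U (F v)"
    and bilin_left: "w \<in> vset W \<Longrightarrow> lin V U (\<lambda>v. F v w)"
  using assms by (auto simp: bilin_def)

lemma bilin_comp: "bilin V W U F \<Longrightarrow> lin U U' g \<Longrightarrow> bilin V W U' (\<lambda>v w. g (F v w))"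
  by (auto simp: bilin_def intro: lin_comp)

lemma bilin_comp2:
  "bilin V' W' U F \<Longrightarrow> lin V V' f \<Longrightarrow> lin W W' g \<Longrightarrow> bilin V W U (\<lambda>v w. F (f v) (g w))"
  by (auto simp: bilin_def lin_def)

lemma bilin_product:
  "lin V base_field f \<Longrightarrow> lin W base_field g \<Longrightarrow> bilin V W base_field (\<lambda>v w. f v * g w)"
  by (auto simp: bilin_def lin_def algebra_simps)

lemma lin_sum_maps:
  assumes U: "vspace U" and f: "\<And>i. i \<in> I \<Longrightarrow> lin V U (f i)"
  shows "lin V U (\<lambda>v. \<Sum>i\<in>I. f i v)"
proof (rule linI)
  interpret module "vscale U" by (rule vspace_module[OF U])
  show "(\<Sum>i\<in>I. f i x) \<in> vset U" if "x \<in> vset V" for x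
    using f that by (intro vspace_sum[OF U]) (auto intro: lin_in)
  show "(\<Sum>i\<in>I. f i (x + y)) = (\<Sum>i\<in>I. f i x) + (\<Sum>i\<in>I. f i y)"
    if "x \<in> vset V" "y \<in> vset V" for x y
    using that by (simp add: sum.distrib lin_add[OF f] cong: sum.cong)
  show "(\<Sum>i\<in>I. f i (vscale V c x)) = vscale U c (\<Sum>i\<in>I. f i x)" if "x \<in> vset V" for c x
    using that by (simp add: scale_sum_right lin_scale[OF f] cong: sum.cong)
qed

lemma bilin_sum_maps:
  assumes "vspace U" and "\<And>i. i \<in> I \<Longrightarrow> bilin V W U (F i)"
  shows "bilin V W U (\<lambda>v w. \<Sum>i\<in>I. F i v w)"
  using assms by (auto simp: bilin_def intro!: lin_sum_maps)

lemma bilin_scale: "bilin V W base_field F \<Longrightarrow> bilin V W base_field (\<lambda>v w. c * F v w)"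
  by (auto simp: bilin_def lin_def algebra_simps)

lemma tpure_apply: "bilin V W base_field \<phi> \<Longrightarrow> tpure V W v w \<phi> = \<phi> v w"
  by (simp add: tpure_def)

lemma tensor_induct [consumes 1, case_names zero step]:
  assumes t: "t \<in> vset (tensor V W)" and z: "P 0"
    and s: "\<And>c v w y. v \<in> vset V \<Longrightarrow> w \<in> vset W \<Longrightarrow> y \<in> vset (tensor V W) \<Longrightarrow> P y \<Longrightarrow>
      P (fscale c (tpure V W v w) + y)"
  shows "P t"
proof -
  interpret T: module fscale by (rule module_fscale)
  let ?G = "{tpure V W v w |v w. v \<in> vset V \<and> w \<in> vset W}"
  have "t \<in> T.span ?G" using t by (simp add: tensor_def)
  then have "t \<in> T.span ?G \<and> P t"
  proof (induction rule: T.span_induct_alt)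
    case base
    show ?case by (intro conjI T.span_zero z)
  next
    case (step c x y)
    then obtain v w where x: "x = tpure V W v w" "v \<in> vset V" "w \<in> vset W" by blast
    have "y \<in> vset (tensor V W)" using step(2) by (simp add: tensor_def del: fscale_apply)
    then have "P (fscale c x + y)" using s x step(2) by blast
    then show ?case using T.span_add[OF T.span_scale[OF T.span_base[OF step(1)]]] step(2) by blast
  qed
  then show ?thesis by simp
qed

text \<open>A pure tensor returns 0 on a form that is not bilinear, so agreement on the carriers
  must also settle whether both forms are bilinear. It does, because \<open>bilin\<close> inspects
  carriers only and these are closed under the operations.\<close>

lemma tensor_app_cong:
  assumes "t \<in> vset (tensor V W)"
    and e: "\<And>v w. v \<in> vset V \<Longrightarrow> w \<in> vset W \<Longrightarrow> \<phi> v w = \<psi> v w"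
    and V: "vspace V" and W: "vspace W"
  shows "t \<phi> = t \<psi>"
proof -
  have "bilin V W base_field \<phi> = bilin V W base_field \<psi>"
    using e by (simp add: bilin_def lin_def vspaceD[OF V] vspaceD[OF W] cong: ball_cong)
  with assms(1) show ?thesis
    by (induction rule: tensor_induct) (auto simp: tpure_def e)
qed

lemma tensor_app_scale:
  assumes "t \<in> vset (tensor V W)" and b: "bilin V W base_field \<phi>"
  shows "t (\<lambda>v w. c * \<phi> v w) = c * t \<phi>"
  using assms(1)
  by (induction rule: tensor_induct) (auto simp: tpure_apply b bilin_scale algebra_simps)

lemma lin_eval: "lin (tensor V W) base_field (\<lambda>t. t \<psi>)"
  by (auto simp: lin_def)

lemma lin_scale_const: "lin V base_field f \<Longrightarrow> lin V base_field (\<lambda>v. f v * c)"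
  "lin V base_field f \<Longrightarrow> lin V base_field (\<lambda>v. c * f v)"
  by (auto simp: lin_def algebra_simps)

text \<open>Both sides are linear in \<open>t\<close> and agree on pure tensors. This is what turns
  maps built with \<open>tlift\<close> into scalars; with an evaluation for \<open>L\<close> it
  gives \<open>tlift_tensor\<close>.\<close>

lemma lin_tlift:
  assumes "vspace U" "bilin V W U F" "t \<in> vset (tensor V W)" "lin U base_field L"
  shows "L (tlift V W U F t) = t (\<lambda>v w. L (F v w))"
  using assms(3)
proof (rule tensor_lin_unique[rotated 3])
  show "lin (tensor V W) base_field (\<lambda>t. L (tlift V W U F t))"
    by (rule lin_comp[OF tlift_universal(1)[OF assms(1,2)] assms(4)])
  show "lin (tensor V W) base_field (\<lambda>t. t (\<lambda>v w. L (F v w)))"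
    by (rule lin_eval)
  show "L (tlift V W U F (tpure V W v w)) = tpure V W v w (\<lambda>v w. L (F v w))"
    if "v \<in> vset V" "w \<in> vset W" for v w
    using that tlift_universal(2)[OF assms(1,2)]
    by (simp add: tpure_apply bilin_comp[OF assms(2,4)])
qed

lemma tlift_base_field:
  "bilin V W base_field F \<Longrightarrow> t \<in> vset (tensor V W) \<Longrightarrow> tlift V W base_field F t = t F"
  using lin_tlift[OF vspace_base_field, where L = "\<lambda>x. x"] lin_id by blast

lemma tlift_tensor:
  "bilin V W (tensor P Q) F \<Longrightarrow> t \<in> vset (tensor V W) \<Longrightarrow>
    tlift V W (tensor P Q) F t \<psi> = t (\<lambda>v w. F v w \<psi>)"
  by (rule lin_tlift[OF vspace_tensor _ _ lin_eval])

text \<open>\<open>tlift\<close> picks its map by choice, so linearity in a parameter cannot be read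
  off the definition. It follows from uniqueness: the two candidate maps are linear in
  \<open>t\<close> and agree on pure tensors.\<close>

lemma lin_tlift_param:
  assumes U: "vspace U" and A: "vspace A" and F: "\<And>a. a \<in> vset A \<Longrightarrow> bilin V W U (F a)"
    and l: "\<And>v w. v \<in> vset V \<Longrightarrow> w \<in> vset W \<Longrightarrow> lin A U (\<lambda>a. F a v w)"
    and t: "t \<in> vset (tensor V W)"
  shows "lin A U (\<lambda>a. tlift V W U (F a) t)"
proof (rule linI)
  interpret U: module "vscale U" by (rule vspace_module[OF U])
  note univ = tlift_universal[OF U F]
  show "tlift V W U (F a) t \<in> vset U" if "a \<in> vset A" for a
    by (rule lin_in[OF univ(1)[OF that] t])
  show "tlift V W U (F (a + b)) t = tlift V W U (F a) t + tlift V W U (F b) t"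
    if a: "a \<in> vset A" and b: "b \<in> vset A" for a b
  proof (rule tensor_lin_unique[OF _ _ _ t])
    have ab: "a + b \<in> vset A" using a b by (rule vspace_add[OF A])
    show "lin (tensor V W) U (tlift V W U (F (a + b)))" by (rule univ(1)[OF ab])
    show "lin (tensor V W) U (\<lambda>t. tlift V W U (F a) t + tlift V W U (F b) t)"
      using univ(1)[OF a] univ(1)[OF b]
      by (auto simp: lin_def vspace_add[OF U] U.scale_right_distrib)
    show "tlift V W U (F (a + b)) (tpure V W v w)
        = tlift V W U (F a) (tpure V W v w) + tlift V W U (F b) (tpure V W v w)"
      if "v \<in> vset V" "w \<in> vset W" for v w
      using that univ(2) a b ab by (simp add: lin_add[OF l])
  qed
  show "tlift V W U (F (vscale A c a)) t = vscale U c (tlift V W U (F a) t)"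
    if a: "a \<in> vset A" for c a
  proof (rule tensor_lin_unique[OF _ _ _ t])
    have ca: "vscale A c a \<in> vset A" using a by (rule vspace_scale[OF A])
    show "lin (tensor V W) U (tlift V W U (F (vscale A c a)))" by (rule univ(1)[OF ca])
    show "lin (tensor V W) U (\<lambda>t. vscale U c (tlift V W U (F a) t))"
      using univ(1)[OF a]
      by (auto simp: lin_def vspace_scale[OF U] U.scale_right_distrib mult.commute)
    show "tlift V W U (F (vscale A c a)) (tpure V W v w)
        = vscale U c (tlift V W U (F a) (tpure V W v w))"
      if "v \<in> vset V" "w \<in> vset W" for v w
      using that univ(2) a ca by (simp add: lin_scale[OF l])
  qed
qed

lemma bilin_tlift_outer:
  assumes U: "vspace U" and V: "vspace V" and W: "vspace W" and A: "vspace A"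
    and F: "\<And>a. a \<in> vset A \<Longrightarrow> bilin V W U (F a)"
    and l: "\<And>v w. v \<in> vset V \<Longrightarrow> w \<in> vset W \<Longrightarrow> lin A U (\<lambda>a. F a v w)"
  shows "bilin A (tensor V W) U (\<lambda>a. tlift V W U (F a))"
    and "bilin (tensor V W) A U (\<lambda>t a. tlift V W U (F a) t)"
  using tlift_universal(1)[OF U F] lin_tlift_param[OF U A F l] by (auto simp: bilin_def)

lemma bilin_tpure_right:
  "lin V V' f \<Longrightarrow> lin W W' g \<Longrightarrow> bilin V W (tensor V' W') (\<lambda>v w. tpure V' W' (f v) (g w))"
  by (rule bilin_comp2[OF bilin_tpure])

lemma lin_tmap:
  "lin V V' f \<Longrightarrow> lin W W' g \<Longrightarrow> lin (tensor V W) (tensor V' W') (tmap V W V' W' f g)"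
  unfolding tmap_def by (rule tlift_universal(1)[OF vspace_tensor bilin_tpure_right])

lemma tmap_tpure:
  "lin V V' f \<Longrightarrow> lin W W' g \<Longrightarrow> v \<in> vset V \<Longrightarrow> w \<in> vset W \<Longrightarrow>
    tmap V W V' W' f g (tpure V W v w) = tpure V' W' (f v) (g w)"
  unfolding tmap_def by (rule tlift_universal(2)[OF vspace_tensor bilin_tpure_right])

lemma tmap_apply:
  "lin V V' f \<Longrightarrow> lin W W' g \<Longrightarrow> t \<in> vset (tensor V W) \<Longrightarrow> bilin V' W' base_field \<psi> \<Longrightarrow>
    tmap V W V' W' f g t \<psi> = t (\<lambda>v w. \<psi> (f v) (g w))"
  unfolding tmap_def by (subst tlift_tensor) (auto simp: bilin_tpure_right tpure_apply)

lemma bilin_tassoc_inner: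
  "w \<in> vset W \<Longrightarrow>
    bilin U V (tensor U (tensor V W)) (\<lambda>u v. tpure U (tensor V W) u (tpure V W v w))"
  by (rule bilin_tpure_right[OF lin_id(2) bilin_left[OF bilin_tpure]])

lemma bilin_tassoc_outer:
  assumes "vspace U" "vspace V" "vspace W"
  shows "bilin (tensor U V) W (tensor U (tensor V W)) (\<lambda>t w. tlift U V (tensor U (tensor V W))
          (\<lambda>u v. tpure U (tensor V W) u (tpure V W v w)) t)"
  by (rule bilin_tlift_outer(2)[OF vspace_tensor assms bilin_tassoc_inner])
     (simp_all add: lin_comp[OF bilin_right[OF bilin_tpure] bilin_right[OF bilin_tpure]])

lemma lin_tassoc:
  assumes "vspace U" "vspace V" "vspace W"
  shows "lin (tensor (tensor U V) W) (tensor U (tensor V W)) (tassoc U V W)"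
  unfolding tassoc_def
  by (rule tlift_universal(1)[OF vspace_tensor bilin_tassoc_outer[OF assms]])

lemma tassoc_tpure:
  assumes "vspace U" "vspace V" "vspace W" "u \<in> vset U" "v \<in> vset V" "w \<in> vset W"
  shows "tassoc U V W (tpure (tensor U V) W (tpure U V u v) w)
    = tpure U (tensor V W) u (tpure V W v w)"
  unfolding tassoc_def using assms
  by (simp add: tlift_universal(2)[OF vspace_tensor bilin_tassoc_outer]
      tlift_universal(2)[OF vspace_tensor bilin_tassoc_inner] tpure_in_tensor)

lemma tassoc_apply:
  assumes "vspace U" "vspace V" "vspace W" and t: "t \<in> vset (tensor (tensor U V) W)"
    and \<psi>: "bilin U (tensor V W) base_field \<psi>"
  shows "tassoc U V W t \<psi> = t (\<lambda>s w. s (\<lambda>u v. \<psi> u (tpure V W v w)))"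
proof -
  have "tassoc U V W t \<psi> = t (\<lambda>s w. tlift U V (tensor U (tensor V W))
          (\<lambda>u v. tpure U (tensor V W) u (tpure V W v w)) s \<psi>)"
    unfolding tassoc_def using assms by (intro tlift_tensor bilin_tassoc_outer)
  also have "\<dots> = t (\<lambda>s w. s (\<lambda>u v. \<psi> u (tpure V W v w)))"
    using t by (rule tensor_app_cong)
      (simp_all add: tlift_tensor[OF bilin_tassoc_inner] tpure_apply[OF \<psi>] assms vspace_tensor)
  finally show ?thesis .
qed

text \<open>Testing on a product of three forms decouples the legs, so each bracketing becomes one
  outer evaluation with an inner coproduct. The two formulas carry coassociativity of
  \<open>H\<close> from tensors to scalars, and that of \<open>CT\<close> from scalars back to
  tensors.\<close>

lemma
  assumes C: "vspace C" and \<Delta>: "lin C (tensor C C) \<Delta>" and t: "t \<in> vset (tensor C C)"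
    and l: "lin C base_field a" "lin C base_field b" "lin C base_field c"
  shows coassoc_left_apply: "tassoc C C C (tmap C C (tensor C C) C \<Delta> id t)
      (\<lambda>u w. a u * w (\<lambda>v v'. b v * c v')) = t (\<lambda>u v. \<Delta> u (\<lambda>x y. a x * b y) * c v)"
    and coassoc_right_apply: "tmap C C C (tensor C C) id \<Delta> t
      (\<lambda>u w. a u * w (\<lambda>v v'. b v * c v')) = t (\<lambda>u v. a u * \<Delta> v (\<lambda>x y. b x * c y))"
proof -
  let ?F = "\<lambda>u w. a u * w (\<lambda>v v'. b v * c v')"
  let ?s = "tmap C C (tensor C C) C \<Delta> id t"
  have s: "?s \<in> vset (tensor (tensor C C) C)"
    by (rule lin_in[OF lin_tmap[OF \<Delta> lin_id(1)] t])
  have F: "bilin C (tensor C C) base_field ?F"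
    using l(1) by (rule bilin_product[OF _ lin_eval])
  have "tassoc C C C ?s ?F = ?s (\<lambda>s w. s (\<lambda>u v. ?F u (tpure C C v w)))"
    by (rule tassoc_apply[OF C C C s F])
  also have "\<dots> = ?s (\<lambda>s w. s (\<lambda>u v. a u * b v) * c w)"
  proof (rule tensor_app_cong[OF s _ vspace_tensor C])
    fix r w assume r: "r \<in> vset (tensor C C)"
    show "r (\<lambda>u v. ?F u (tpure C C v w)) = r (\<lambda>u v. a u * b v) * c w"
      using tensor_app_scale[OF r bilin_product[OF l(1,2)], of "c w"]
      by (simp add: tpure_apply[OF bilin_product[OF l(2,3)]] mult_ac)
  qed
  also have "\<dots> = t (\<lambda>u v. \<Delta> u (\<lambda>x y. a x * b y) * c v)"
    by (simp add: tmap_apply[OF \<Delta> lin_id(1) t bilin_product[OF lin_eval l(3)]])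
  finally show "tassoc C C C ?s ?F = t (\<lambda>u v. \<Delta> u (\<lambda>x y. a x * b y) * c v)" .
  show "tmap C C C (tensor C C) id \<Delta> t ?F = t (\<lambda>u v. a u * \<Delta> v (\<lambda>x y. b x * c y))"
    by (simp add: tmap_apply[OF lin_id(1) \<Delta> t F])
qed

lemma lin_app_param:
  assumes "vspace A" "\<And>a. a \<in> vset A \<Longrightarrow> bilin V W base_field (F a)"
    "\<And>v w. v \<in> vset V \<Longrightarrow> w \<in> vset W \<Longrightarrow> lin A base_field (\<lambda>a. F a v w)"
    "t \<in> vset (tensor V W)"
  shows "lin A base_field (\<lambda>a. t (F a))"
proof (rule lin_cong[OF assms(1)])
  show "lin A base_field (\<lambda>a. tlift V W base_field (F a) t)"
    using assms by (rule lin_tlift_param[OF vspace_base_field])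
qed (rule tlift_base_field[symmetric, OF assms(2) assms(4)])

context
  fixes A :: "('k::field, 'a::ab_group_add, 'p) vsp_scheme"
    and B :: "('k, 'b::ab_group_add, 'q) vsp_scheme"
    and C :: "('k, 'c::ab_group_add, 'r) vsp_scheme"
    and D :: "('k, 'd::ab_group_add, 's) vsp_scheme"
  assumes vs: "vspace A" "vspace B" "vspace C" "vspace D"
begin

private abbreviation (input) "X \<equiv> tensor (tensor A C) (tensor B D)"

private lemma inner: "a \<in> vset A \<Longrightarrow> b \<in> vset B \<Longrightarrow>
    bilin C D X (\<lambda>c d. tpure (tensor A C) (tensor B D) (tpure A C a c) (tpure B D b d))"
  by (rule bilin_tpure_right[OF bilin_right[OF bilin_tpure] bilin_right[OF bilin_tpure]])

private lemma mid: "t \<in> vset (tensor C D) \<Longrightarrow>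
    bilin A B X (\<lambda>a b. tlift C D X
      (\<lambda>c d. tpure (tensor A C) (tensor B D) (tpure A C a c) (tpure B D b d)) t)"
  by (rule bilinI; rule lin_tlift_param[OF vspace_tensor _ inner])
     (simp_all add: vs tpure_in_tensor lin_comp[OF bilin_left[OF bilin_tpure] bilin_left[OF bilin_tpure]]
       lin_comp[OF bilin_left[OF bilin_tpure] bilin_right[OF bilin_tpure]])

private lemma outer: "bilin (tensor A B) (tensor C D) X
    (\<lambda>s t. tlift A B X (\<lambda>a b. tlift C D X
      (\<lambda>c d. tpure (tensor A C) (tensor B D) (tpure A C a c) (tpure B D b d)) t) s)"
  by (rule bilin_tlift_outer(2)[OF vspace_tensor vs(1,2) vspace_tensor mid])
     (simp_all add: vs vspace_tensor tlift_universal(1)[OF vspace_tensor inner])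

lemma lin_tmiddle: "lin (tensor (tensor A B) (tensor C D)) X (tmiddle A B C D)"
  unfolding tmiddle_def Let_def by (rule tlift_universal(1)[OF vspace_tensor outer])

lemma tmiddle_tpure_apply:
  assumes s: "s \<in> vset (tensor A B)" and t: "t \<in> vset (tensor C D)"
    and \<psi>: "bilin (tensor A C) (tensor B D) base_field \<psi>"
  shows "tmiddle A B C D (tpure (tensor A B) (tensor C D) s t) \<psi>
    = s (\<lambda>a b. t (\<lambda>c d. \<psi> (tpure A C a c) (tpure B D b d)))"
proof -
  have "tmiddle A B C D (tpure (tensor A B) (tensor C D) s t) \<psi>
      = tlift A B X (\<lambda>a b. tlift C D X
         (\<lambda>c d. tpure (tensor A C) (tensor B D) (tpure A C a c) (tpure B D b d)) t) s \<psi>"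
    unfolding tmiddle_def Let_def by (simp add: tlift_universal(2)[OF vspace_tensor outer] s t)
  also have "\<dots> = s (\<lambda>a b. tlift C D X
         (\<lambda>c d. tpure (tensor A C) (tensor B D) (tpure A C a c) (tpure B D b d)) t \<psi>)"
    by (rule tlift_tensor[OF mid[OF t] s])
  also have "\<dots> = s (\<lambda>a b. t (\<lambda>c d. \<psi> (tpure A C a c) (tpure B D b d)))"
    using s by (rule tensor_app_cong) (simp_all add: tlift_tensor[OF inner] t tpure_apply[OF \<psi>] vs)
  finally show ?thesis .
qed

end


subsection \<open>Finite dual systems\<close>

text \<open>A finite dual basis described by its reconstruction identity. In this form it passes to
  tensor products and to the dual of \<open>H\<close>, and it makes the forms \<open>e'\<close>
  separate the points of the carrier.\<close>

definition frame ::
  "('k::field, 'v::ab_group_add, 'z) vsp_scheme \<Rightarrow> 'i set \<Rightarrow> ('i \<Rightarrow> 'v) \<Rightarrow> ('i \<Rightarrow> 'v \<Rightarrow> 'k) \<Rightarrow> bool"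
  where "frame V I e e' \<longleftrightarrow> (\<forall>i\<in>I. e i \<in> vset V \<and> lin V base_field (e' i)) \<and>
    (\<forall>v\<in>vset V. (\<Sum>i\<in>I. vscale V (e' i v) (e i)) = v)"

lemma frameD:
  assumes "frame V I e e'"
  shows "i \<in> I \<Longrightarrow> e i \<in> vset V" "i \<in> I \<Longrightarrow> lin V base_field (e' i)"
    and frame_sum: "v \<in> vset V \<Longrightarrow> (\<Sum>i\<in>I. vscale V (e' i v) (e i)) = v"
  using assms by (auto simp: frame_def)

lemma frame_eqI:
  assumes "frame V I e e'" "x \<in> vset V" "y \<in> vset V" "\<And>i. i \<in> I \<Longrightarrow> e' i x = e' i y"
  shows "x = y"
proof -
  have "(\<Sum>i\<in>I. vscale V (e' i x) (e i)) = (\<Sum>i\<in>I. vscale V (e' i y) (e i))"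
    by (rule sum.cong[OF refl]) (simp only: assms(4))
  then show ?thesis by (simp only: frame_sum[OF assms(1)] assms(2,3))
qed

lemma frame_apply:
  assumes V: "vspace V" and f: "frame V I e e'" and L: "lin V base_field L" and v: "v \<in> vset V"
  shows "(\<Sum>i\<in>I. e' i v * L (e i)) = L v"
proof -
  have "L v = L (\<Sum>i\<in>I. vscale V (e' i v) (e i))"
    by (simp add: frame_sum[OF f v])
  also have "\<dots> = (\<Sum>i\<in>I. L (vscale V (e' i v) (e i)))"
    using frameD(1)[OF f] by (intro lin_sum[OF V L]) (auto intro: vspace_scale[OF V])
  also have "\<dots> = (\<Sum>i\<in>I. e' i v * L (e i))"
    using frameD(1)[OF f] by (simp add: lin_scale[OF L])
  finally show ?thesis by simp
qed

text \<open>Reconstruction is linear, hence only has to be checked on pure tensors, where it is done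
  in one slot after the other. Iterating the lemma provides the test forms on twofold and threefold
  tensor products of \<open>X\<close>.\<close>

lemma frame_tensor:
  assumes V: "vspace V" and W: "vspace W" and f: "frame V I e e'" and g: "frame W J d d'"
  shows "frame (tensor V W) (I \<times> J) (\<lambda>(i, j). tpure V W (e i) (d j))
    (\<lambda>(i, j) t. t (\<lambda>v w. e' i v * d' j w))"
proof -
  let ?L = "\<lambda>t. \<Sum>(i, j)\<in>I \<times> J. fscale (t (\<lambda>v w. e' i v * d' j w)) (tpure V W (e i) (d j))"
  have in_T: "tpure V W (e i) (d j) \<in> vset (tensor V W)" if "i \<in> I" "j \<in> J" for i j
    using that frameD(1)[OF f] frameD(1)[OF g] by (intro tpure_in_tensor)
  interpret T: module "fscale :: 'a \<Rightarrow> ('a, 'b, 'd) tensor \<Rightarrow> ('a, 'b, 'd) tensor"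
    by (rule module_fscale)
  have L: "lin (tensor V W) (tensor V W) ?L"
    unfolding case_prod_beta
    using in_T
    by (intro lin_sum_maps[OF vspace_tensor] linI)
       (auto simp: T.scale_left_distrib intro!: vspace_scale[OF vspace_tensor, simplified])
  have "?L t = id t" if t: "t \<in> vset (tensor V W)" for t
    using t
  proof (rule tensor_lin_unique[rotated 3])
    show "lin (tensor V W) (tensor V W) ?L" by (rule L)
    show "lin (tensor V W) (tensor V W) id" by (rule lin_id)
    fix v w assume v: "v \<in> vset V" and w: "w \<in> vset W"
    have "?L (tpure V W v w) \<phi> = tpure V W v w \<phi>" for \<phi>
    proof (cases "bilin V W base_field \<phi>")
      \<comment> \<open>Here every pure tensor takes its default value 0.\<close>
      case False
      then show ?thesis by (simp add: sum_apply case_prod_beta tpure_def)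
    next
      case b: True
      have "?L (tpure V W v w) \<phi> = (\<Sum>i\<in>I. \<Sum>j\<in>J. e' i v * d' j w * \<phi> (e i) (d j))"
        using frameD(2)[OF f] frameD(2)[OF g]
        by (auto simp: sum_apply case_prod_beta tpure_apply[OF b] sum.cartesian_product
            tpure_apply[OF bilin_product] intro!: sum.cong)
      also have "\<dots> = (\<Sum>i\<in>I. e' i v * (\<Sum>j\<in>J. d' j w * \<phi> (e i) (d j)))"
        by (simp add: sum_distrib_left mult.assoc)
      also have "\<dots> = (\<Sum>i\<in>I. e' i v * \<phi> (e i) w)"
        using frameD(1)[OF f] by (simp add: frame_apply[OF W g bilin_right[OF b] w])
      also have "\<dots> = \<phi> v w"
        by (rule frame_apply[OF V f bilin_left[OF b w] v])
      finally show ?thesis by (simp add: tpure_apply b)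
    qed
    then show "?L (tpure V W v w) = id (tpure V W v w)" by auto
  qed
  then show ?thesis
    using in_T by (auto simp: frame_def case_prod_beta lin_eval)
qed

section \<open>Scalar-valued Sweedler calculus\<close>

locale fd_hopf_algebra = hopf_algebra H S + fin: finite_dimensional_vector_space "vscale H" B
  for H :: "('k::field, 'h::ring_1) coalg" and S :: "'h \<Rightarrow> 'h" and B :: "'h set"
begin

abbreviation lf :: "('h \<Rightarrow> 'k) \<Rightarrow> bool" where "lf \<equiv> lin H base_field"
abbreviation le :: "('h \<Rightarrow> 'h) \<Rightarrow> bool" where "le \<equiv> lin H H"
abbreviation bl :: "('h \<Rightarrow> 'h \<Rightarrow> 'k) \<Rightarrow> bool" where "bl \<equiv> bilin H H base_field"
abbreviation eps :: "'h \<Rightarrow> 'k" where "eps \<equiv> counit H"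
abbreviation db :: "'h \<Rightarrow> 'h \<Rightarrow> 'k" where "db \<equiv> dual_basis H B"

lemma vspace_H: "vspace H"
  using coalgebra by (simp add: coalgebra_def)

declare vset_UNIV [simp]

lemma comul_in: "comul H x \<in> vset (tensor H H)"
  using coalgebra by (simp add: coalgebra_def lin_def)

lemma lin_comul: "lin H (tensor H H) (comul H)"
  using coalgebra by (simp add: coalgebra_def)

lemma lf_iff: "lf f \<longleftrightarrow> (\<forall>x y. f (x + y) = f x + f y) \<and> (\<forall>c x. f (vscale H c x) = c * f x)"
  by (simp add: lin_def)

lemma le_iff: "le f \<longleftrightarrow>
    (\<forall>x y. f (x + y) = f x + f y) \<and> (\<forall>c x. f (vscale H c x) = vscale H c (f x))"
  by (simp add: lin_def)

lemma bl_iff: "bl F \<longleftrightarrow> (\<forall>a. lf (F a)) \<and> (\<forall>b. lf (\<lambda>a. F a b))"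
  by (simp add: bilin_def)

lemma lf_db: "lf (db b)"
  unfolding lf_iff dual_basis_def
  by (simp add: fin.representation_add fin.representation_scale fin.independent_Basis
      fin.span_Basis)

lemma db_basis: "b \<in> B \<Longrightarrow> c \<in> B \<Longrightarrow> db b c = (if b = c then 1 else 0)"
  by (simp add: dual_basis_def fin.representation_basis fin.independent_Basis)

lemma frame_H: "frame H B (\<lambda>b. b) db"
  using fin.sum_representation_eq[OF fin.independent_Basis _ fin.finite_Basis order_refl]
  by (auto simp: frame_def lf_db) (simp add: fin.span_Basis dual_basis_def)

lemma lf_expand: "lf f \<Longrightarrow> (\<Sum>b\<in>B. db b x * f b) = f x"
  by (rule frame_apply[OF vspace_H frame_H]) simp_all

lemma eq_by_forms: "(\<And>f. lf f \<Longrightarrow> f x = f y) \<Longrightarrow> x = y"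
  by (rule frame_eqI[OF frame_H]) (simp_all add: lf_db)

lemma lf_eps: "lf eps"
  using coalgebra by (simp add: coalgebra_def)

lemma le_S: "le S" by (rule lin_antipode)

lemma lf_comp: "lf f \<Longrightarrow> le g \<Longrightarrow> lf (\<lambda>x. f (g x))"
  by (rule lin_comp)

lemma le_comp: "le f \<Longrightarrow> le g \<Longrightarrow> le (\<lambda>x. f (g x))"
  by (rule lin_comp)

text \<open>\<open>sw F x\<close> is \<open>F x\<^sub>1 x\<^sub>2\<close> for bilinear \<open>F\<close>. The definition through coordinates makes it
  linear in \<open>F\<close> without any assumption on \<open>F\<close>.\<close>

definition sw :: "('h \<Rightarrow> 'h \<Rightarrow> 'k) \<Rightarrow> 'h \<Rightarrow> 'k" where
  "sw F x = (\<Sum>b\<in>B. \<Sum>c\<in>B. comul H x (\<lambda>u v. db b u * db c v) * F b c)"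

lemma sw_add_arg: "sw F (x + y) = sw F x + sw F y"
  by (simp add: sw_def lin_add[OF lin_comul] algebra_simps sum.distrib)

lemma sw_scale_arg: "sw F (vscale H c x) = c * sw F x"
  by (simp add: sw_def lin_scale[OF lin_comul] algebra_simps sum_distrib_left)

lemma sw_add: "sw (\<lambda>a b. F a b + G a b) x = sw F x + sw G x"
  by (simp add: sw_def algebra_simps sum.distrib)

lemma sw_mult_left: "sw (\<lambda>a b. c * F a b) x = c * sw F x"
  by (simp add: sw_def algebra_simps sum_distrib_left)

lemma sw_mult_right: "sw (\<lambda>a b. F a b * c) x = sw F x * c"
  by (simp add: sw_def algebra_simps sum_distrib_left)

lemma sw_zero: "sw (\<lambda>a b. 0) x = 0"
  by (simp add: sw_def)

lemma sw_sum: "sw (\<lambda>a b. \<Sum>i\<in>I. F i a b) x = (\<Sum>i\<in>I. sw (F i) x)"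
  by (induction I rule: infinite_finite_induct) (simp_all add: sw_zero sw_add)

lemma sw_swap: "sw (\<lambda>a b. sw (\<lambda>c d. F a b c d) y) x = sw (\<lambda>c d. sw (\<lambda>a b. F a b c d) x) y"
proof -
  have "sw (\<lambda>a b. sw (\<lambda>c d. F a b c d) y) x =
      (\<Sum>c\<in>B. \<Sum>d\<in>B. sw (\<lambda>a b. comul H y (\<lambda>u v. db c u * db d v) * F a b c d) x)"
    by (simp only: sw_def[of _ y] sw_sum)
  then show ?thesis by (simp only: sw_def[of _ y] sw_mult_left)
qed

lemma sw_cong_basis: "(\<And>b c. b \<in> B \<Longrightarrow> c \<in> B \<Longrightarrow> F b c = G b c) \<Longrightarrow> sw F x = sw G x"
  by (simp add: sw_def cong: sum.cong)

lemma comul_apply: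
  assumes F: "bl F"
  shows "comul H x F = sw F x"
proof -
  have "comul H x F = (\<Sum>(b, c)\<in>B \<times> B. comul H x (\<lambda>u v. db b u * db c v) * tpure H H b c F)"
    using frame_apply[OF vspace_tensor frame_tensor[OF vspace_H vspace_H frame_H frame_H]
        lin_eval[where \<psi> = F] comul_in[of x]]
    by (simp add: case_prod_beta)
  then show ?thesis
    by (simp add: sw_def sum.cartesian_product tpure_apply[OF F])
qed

lemma lf_rules:
  shows "lf f \<Longrightarrow> lf (\<lambda>x. c * f x)" "lf f \<Longrightarrow> lf (\<lambda>x. f x * c)"
    and "(\<And>a b. lf (\<lambda>x. F x a b)) \<Longrightarrow> lf (\<lambda>x. sw (F x) y)"
    and "lf (sw G)" "le g \<Longrightarrow> lf (\<lambda>x. sw G (g x))"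
    and "lf eps" "le g \<Longrightarrow> lf (\<lambda>x. eps (g x))"
    and "lf (db d)" "le g \<Longrightarrow> lf (\<lambda>x. db d (g x))"
    and "le (\<lambda>x. x)" "le S" "le g \<Longrightarrow> le (\<lambda>x. S (g x))"
    and "le g \<Longrightarrow> le (\<lambda>x. g x * y)" "le g \<Longrightarrow> le (\<lambda>x. y * g x)"
    and "(\<And>i. i \<in> I \<Longrightarrow> lf (p i)) \<Longrightarrow> lf (\<lambda>x. \<Sum>i\<in>I. p i x)"
proof -
  show 1: "lf (sw G)" for G
    by (simp add: lf_iff sw_add_arg sw_scale_arg)
  show "le g \<Longrightarrow> lf (\<lambda>x. sw G (g x))" by (rule lf_comp[OF 1])
  show "(\<And>a b. lf (\<lambda>x. F x a b)) \<Longrightarrow> lf (\<lambda>x. sw (F x) y)"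
    by (simp add: sw_def lf_iff algebra_simps sum.distrib sum_distrib_left)
  show "(\<And>i. i \<in> I \<Longrightarrow> lf (p i)) \<Longrightarrow> lf (\<lambda>x. \<Sum>i\<in>I. p i x)"
    by (rule lin_sum_maps[OF vspace_base_field])
qed (auto simp: lf_iff le_iff algebra_simps lf_eps[unfolded lf_iff] lf_db[unfolded lf_iff]
    le_S[unfolded le_iff] scale_mult_left[symmetric] scale_mult_right[symmetric])

lemmas rules = lf_rules lf_comp[OF lf_eps] bl_iff

lemma comul_coassoc:
  assumes l: "lf i" "lf j" "lf k"
  shows "sw (\<lambda>a b. sw (\<lambda>c d. i c * j d) a * k b) x = sw (\<lambda>a b. i a * sw (\<lambda>c d. j c * k d) b) x"
proof -
  have "comul H x (\<lambda>a b. comul H a (\<lambda>c d. i c * j d) * k b) =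
      comul H x (\<lambda>a b. i a * comul H b (\<lambda>c d. j c * k d))"
    using coalgebra
    by (simp add: coalgebra_def flip: coassoc_left_apply[OF vspace_H lin_comul comul_in l]
        coassoc_right_apply[OF vspace_H lin_comul comul_in l])
  then show ?thesis using l by (simp add: comul_apply rules)
qed

lemma sw_basis: "sw F x = (\<Sum>b\<in>B. \<Sum>c\<in>B. sw (\<lambda>u v. db b u * db c v) x * F b c)"
  unfolding sw_def[of F] by (simp add: comul_apply rules)

lemma db_expand: "b \<in> B \<Longrightarrow> (\<Sum>c\<in>B. db c b * f c) = f b"
  by (simp add: db_basis if_distrib[of "\<lambda>t. t * _"] sum.delta[OF fin.finite_Basis] cong: if_cong)

text \<open>No linearity of \<open>F\<close> is needed, since \<open>sw\<close> only evaluates it at basis elements.\<close>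

lemma sw_assoc:
  "sw (\<lambda>a b. sw (\<lambda>c d. F c d b) a) x = sw (\<lambda>a b. sw (\<lambda>c d. F a c d) b) x"
proof -
  \<comment> \<open>The legs run over \<open>B\<close> only, so even the free leg \<open>b\<close>
    may be written through its coordinates. This separates the variables, and coassociativity on
    products of three coordinate forms applies.\<close>
  have "sw (\<lambda>a b. sw (\<lambda>c d. F c d b) a) x
      = sw (\<lambda>a b. \<Sum>c\<in>B. \<Sum>d\<in>B. sw (\<lambda>u v. db c u * db d v) a * (\<Sum>e\<in>B. db e b * F c d e)) x"
    by (rule sw_cong_basis) (simp add: sw_basis[of "\<lambda>c d. F c d _"] db_expand)
  also have "\<dots> = (\<Sum>c\<in>B. \<Sum>d\<in>B. \<Sum>e\<in>B.
      sw (\<lambda>a b. sw (\<lambda>u v. db c u * db d v) a * db e b) x * F c d e)"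
    by (simp add: sum_distrib_left sw_sum mult.assoc[symmetric] sw_mult_right)
  also have "\<dots> = (\<Sum>c\<in>B. \<Sum>d\<in>B. \<Sum>e\<in>B.
      sw (\<lambda>a b. db c a * sw (\<lambda>u v. db d u * db e v) b) x * F c d e)"
    by (simp add: comul_coassoc lf_db)
  also have "\<dots> = sw (\<lambda>a b. \<Sum>c\<in>B. db c a *
      (\<Sum>d\<in>B. \<Sum>e\<in>B. sw (\<lambda>u v. db d u * db e v) b * F c d e)) x"
    by (simp add: sum_distrib_left sw_sum mult.assoc[symmetric] sw_mult_right)
  also have "\<dots> = sw (\<lambda>a b. sw (\<lambda>c d. F a c d) b) x"
    by (rule sw_cong_basis)
       (simp add: sw_basis[of "\<lambda>c d. F _ c d"] db_expand[where f = "\<lambda>c. \<Sum>d\<in>B. \<Sum>e\<in>B. _ d e * F c d e"])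
  finally show ?thesis .
qed

lemma counit_left: assumes "lf f" shows "sw (\<lambda>a b. eps a * f b) x = f x"
proof -
  have b: "bilin H H H (\<lambda>a b. vscale H (eps a) b)"
    using lf_eps by (auto simp: bilin_def lin_def fin.scale_right_distrib fin.scale_left_distrib mult.commute)
  have "f (tlift H H H (\<lambda>a b. vscale H (eps a) b) (comul H x)) = sw (\<lambda>a b. eps a * f b) x"
    using lin_tlift[OF vspace_H b comul_in assms, of x] assms
    by (simp add: comul_apply rules lin_scale[OF assms])
  then show ?thesis using coalgebra by (simp add: coalgebra_def)
qed

lemma counit_right: assumes "lf f" shows "sw (\<lambda>a b. eps b * f a) x = f x"
proof -
  have b: "bilin H H H (\<lambda>a b. vscale H (eps b) a)"
    using lf_eps by (auto simp: bilin_def lin_def fin.scale_right_distrib fin.scale_left_distrib mult.commute)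
  have "f (tlift H H H (\<lambda>a b. vscale H (eps b) a) (comul H x)) = sw (\<lambda>a b. eps b * f a) x"
    using lin_tlift[OF vspace_H b comul_in assms, of x] assms
    by (simp add: comul_apply rules lin_scale[OF assms])
  then show ?thesis using coalgebra by (simp add: coalgebra_def)
qed

lemma bl_lf: "bl F \<Longrightarrow> le g \<Longrightarrow> lf (\<lambda>x. F (g x) y)" "bl F \<Longrightarrow> le g \<Longrightarrow> lf (\<lambda>x. F y (g x))"
  "bl F \<Longrightarrow> lf (\<lambda>x. F x y)" "bl F \<Longrightarrow> lf (F y)"
  by (auto simp: bl_iff lf_iff le_iff)

lemma sw_mult:
  assumes F: "bl F"
  shows "sw F (x * y) = sw (\<lambda>a b. sw (\<lambda>c d. F (a * c) (b * d)) y) x"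
proof -
  have 1: "bilin H H (tensor H H) (\<lambda>c d. tpure H H (a * c) (b * d))" for a b
    by (rule bilin_tpure_right) (simp_all add: rules)
  have 2: "bilin H H (tensor H H)
      (\<lambda>a b. tlift H H (tensor H H) (\<lambda>c d. tpure H H (a * c) (b * d)) t)"
    if "t \<in> vset (tensor H H)" for t
    by (rule bilinI; rule lin_tlift_param[OF vspace_tensor vspace_H 1])
       (simp_all add: that lin_comp[OF _ bilin_left[OF bilin_tpure]]
          lin_comp[OF _ bilin_right[OF bilin_tpure]] rules)
  have "sw F (x * y) = comul H (x * y) F"
    by (simp add: comul_apply F)
  also have "\<dots> = comul H x (\<lambda>a b. comul H y (\<lambda>c d. tpure H H (a * c) (b * d) F))"
    by (simp add: comul_mult tlift_tensor[OF 2[OF comul_in] comul_in] tlift_tensor[OF 1 comul_in])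
  also have "\<dots> = sw (\<lambda>a b. sw (\<lambda>c d. F (a * c) (b * d)) y) x"
    by (simp add: tpure_apply F comul_apply rules bl_lf[OF F])
  finally show ?thesis .
qed

lemma sw_one: "bl F \<Longrightarrow> sw F 1 = F 1 1"
  by (simp add: comul_apply[symmetric] comul_one tpure_apply)

lemma antipode_l: assumes f: "lf f" shows "sw (\<lambda>a b. f (S a * b)) x = eps x * f 1"
proof -
  have b: "bilin H H H (\<lambda>a b. S a * b)" by (rule bilinI) (simp_all add: rules)
  have "f (tlift H H H (\<lambda>a b. S a * b) (comul H x)) = sw (\<lambda>a b. f (S a * b)) x"
    using lin_tlift[OF vspace_H b comul_in f, of x] by (simp add: comul_apply rules lf_comp[OF f])
  then show ?thesis by (simp add: antipode_left lin_scale[OF f])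
qed

lemma antipode_r: assumes f: "lf f" shows "sw (\<lambda>a b. f (a * S b)) x = eps x * f 1"
proof -
  have b: "bilin H H H (\<lambda>a b. a * S b)" by (rule bilinI) (simp_all add: rules)
  have "f (tlift H H H (\<lambda>a b. a * S b) (comul H x)) = sw (\<lambda>a b. f (a * S b)) x"
    using lin_tlift[OF vspace_H b comul_in f, of x] by (simp add: comul_apply rules lf_comp[OF f])
  then show ?thesis by (simp add: antipode_right lin_scale[OF f])
qed

text \<open>One notion for \<open>S x1 * x2\<close>, \<open>x1 * S x2\<close>, their counterparts
  with the inverse antipode and their twists by automorphisms, so that the absorption lemmas below
  are proved once for all of them.\<close>

definition cancels :: "('h \<Rightarrow> 'h \<Rightarrow> 'h) \<Rightarrow> bool" where
  "cancels K \<longleftrightarrow> (\<forall>f x. lf f \<longrightarrow> sw (\<lambda>a b. f (K a b)) x = eps x * f 1)"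

lemma cancelsD: "cancels K \<Longrightarrow> lf f \<Longrightarrow> sw (\<lambda>a b. f (K a b)) x = eps x * f 1"
  by (auto simp: cancels_def)

text \<open>The cancelled pair leaves \<open>eps\<close> on one leg, and the counit law merges that
  leg into the third. The nesting makes the cancelled legs neighbours.\<close>

lemma cancel_left:
  assumes "cancels K" "\<And>c. lf (\<lambda>u. F u c)" "lf (F 1)"
  shows "sw (\<lambda>a r. sw (\<lambda>b c. F (K a b) c) r) x = F 1 x"
  using cancelsD[OF assms(1,2)] counit_left[OF assms(3)] by (simp add: sw_assoc[symmetric])

lemma cancel_right:
  assumes "cancels K" "\<And>a. lf (\<lambda>u. F a u)" "lf (\<lambda>a. F a 1)"
  shows "sw (\<lambda>a r. sw (\<lambda>b c. F a (K b c)) r) x = F x 1"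
  using cancelsD[OF assms(1,2)] counit_right[OF assms(3)] by simp

lemma cancels_S: "cancels (\<lambda>a b. S a * b)" "cancels (\<lambda>a b. a * S b)"
  by (simp_all add: cancels_def antipode_l antipode_r)

text \<open>A left and a right inverse of \<open>M\<close> in the convolution monoid coincide: the
  expression \<open>L x1 * M x2 * R x3\<close> is bracketed in two ways.\<close>

lemma conv_inverse_unique:
  assumes lin: "le L" "le R" and c: "cancels (\<lambda>a b. L a * M b)" "cancels (\<lambda>a b. M a * R b)"
  shows "L x = R x"
proof (rule eq_by_forms)
  fix f assume f: "lf f"
  note r = rules lf_comp[OF f] le_comp[OF lin(1)] le_comp[OF lin(2)] lin
  have "f (L x) = sw (\<lambda>a r. sw (\<lambda>b c. f (L a * (M b * R c))) r) x"
    using cancel_right[OF c(2), of "\<lambda>a u. f (L a * u)"] by (simp add: r)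
  also have "\<dots> = f (R x)"
    using cancel_left[OF c(1), of "\<lambda>u c. f (u * R c)"] by (simp add: r mult.assoc)
  finally show "f (L x) = f (R x)" .
qed

text \<open>The same argument for the opposite coproduct, with \<open>L x3 * M x2 * R x1\<close>. It
  serves the odd powers of \<open>S\<close>, which reverse products.\<close>

lemma cop_conv_inverse_unique:
  assumes lin: "le L" "le R" and c: "cancels (\<lambda>a b. L b * M a)" "cancels (\<lambda>a b. M b * R a)"
  shows "L x = R x"
proof (rule eq_by_forms)
  fix f assume f: "lf f"
  note r = rules lf_comp[OF f] le_comp[OF lin(1)] le_comp[OF lin(2)] lin
  have "f (R x) = sw (\<lambda>a r. sw (\<lambda>b c. f (L c * (M b * R a))) r) x"
    using cancel_right[OF c(1), of "\<lambda>a u. f (u * R a)"] by (simp add: r mult.assoc)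
  also have "\<dots> = f (L x)"
    using cancel_left[OF c(2), of "\<lambda>u c. f (L c * u)"] by (simp add: r)
  finally show "f (L x) = f (R x)" ..
qed


subsection \<open>Properties of the antipode\<close>

lemma S_one: "S 1 = 1"
proof (rule eq_by_forms)
  fix f assume f: "lf f"
  have "sw (\<lambda>a b. f (S a * b)) 1 = f (S 1 * 1)"
    by (rule sw_one) (simp add: rules lf_comp[OF f])
  then show "f (S 1) = f 1" by (simp add: antipode_l[OF f] counit_one)
qed

lemma eps_S: "eps (S x) = eps x"
  using antipode_l[OF lf_eps, of x] counit_right[of "\<lambda>a. eps (S a)" x]
  by (simp add: counit_mult counit_one rules mult.commute)

text \<open>Both sides are convolution inverses of the multiplication map. Concretely,
  \<open>S (x1 * y1) * x2 * y2 * S y3 * S x3\<close> is evaluated twice: cancelling from the right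
  leaves \<open>S (x * y)\<close>, cancelling from the left leaves \<open>S y * S x\<close>.\<close>

lemma S_mult: "S (x * y) = S y * S x"
proof (rule eq_by_forms)
  fix f assume f: "lf f"
  note r = rules lf_comp[OF f]
  let ?E = "\<lambda>x1 x2 x3 y1 y2 y3. f (S (x1 * y1) * (x2 * (y2 * (S y3 * S x3))))"
  have "sw (\<lambda>x1 r. sw (\<lambda>x2 x3. sw (\<lambda>y1 s. sw (\<lambda>y2 y3. ?E x1 x2 x3 y1 y2 y3) s) y) r) x
      = sw (\<lambda>x1 r. sw (\<lambda>x2 x3. f (S (x1 * y) * (x2 * S x3))) r) x"
    using cancel_right[OF cancels_S(2), of "\<lambda>a u. f (S (_ * a) * (_ * (u * S _)))"]
    by (simp add: r mult.assoc)
  also have "\<dots> = f (S (x * y))"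
    using cancel_right[OF cancels_S(2), of "\<lambda>a u. f (S (a * y) * u)"] by (simp add: r)
  finally have 1: "sw (\<lambda>x1 r. sw (\<lambda>x2 x3. sw (\<lambda>y1 s. sw (\<lambda>y2 y3. ?E x1 x2 x3 y1 y2 y3) s) y) r) x
     = f (S (x * y))" .
  have "sw (\<lambda>x1 r. sw (\<lambda>x2 x3. sw (\<lambda>y1 s. sw (\<lambda>y2 y3. ?E x1 x2 x3 y1 y2 y3) s) y) r) x
    = sw (\<lambda>r x3. sw (\<lambda>x1 x2. sw (\<lambda>s y3. sw (\<lambda>y1 y2. ?E x1 x2 x3 y1 y2 y3) s) y) r) x"
    by (simp add: sw_assoc)
  also have "\<dots> = sw (\<lambda>r x3. sw (\<lambda>s y3. sw (\<lambda>x1 x2. sw (\<lambda>y1 y2. ?E x1 x2 x3 y1 y2 y3) s) r) y) x"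
    by (subst sw_swap) (rule refl)
  \<comment> \<open>Multiplicativity of the coproduct, read backwards: the pairs
    \<open>x1, x2\<close> and \<open>y1, y2\<close> become the legs of \<open>r * s\<close>.\<close>
  also have "\<dots> = sw (\<lambda>r x3. sw (\<lambda>s y3. sw (\<lambda>a b. f (S a * b * (S y3 * S x3))) (r * s)) y) x"
    by (simp add: sw_mult r mult.assoc)
  also have "\<dots> = sw (\<lambda>r x3. sw (\<lambda>s y3. eps r * (eps s * f (S y3 * S x3))) y) x"
    using cancelsD[OF cancels_S(1), of "\<lambda>u. f (u * _)"]
    by (simp add: r counit_mult mult.assoc)
  also have "\<dots> = f (S y * S x)"
    by (simp add: sw_mult_left counit_left r)
  finally show "f (S (x * y)) = f (S y * S x)" using 1 by simp
qed

text \<open>Dual to \<open>S_mult\<close>: the product of \<open>\<Delta>(S x1)\<close>,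
  \<open>x2 \<otimes> x3\<close> and \<open>S x5 \<otimes> S x4\<close> is evaluated twice.
  Cancelling \<open>x3, x4\<close> and then \<open>x2, x5\<close> leaves
  \<open>\<Delta>(S x)\<close>; merging \<open>S x1\<close> with \<open>x2, x3\<close> under one
  coproduct cancels these and leaves the reversed legs.\<close>

lemma sw_S:
  assumes F: "bl F"
  shows "sw F (S x) = sw (\<lambda>a b. F (S b) (S a)) x"
proof -
  note r = rules bl_lf[OF F]
  let ?E = "\<lambda>x1 x2 x3 x4 x5. sw (\<lambda>u v. F (u * (x2 * S x5)) (v * (x3 * S x4))) (S x1)"
  let ?L = "sw (\<lambda>x1 r. sw (\<lambda>x2 r. sw (\<lambda>x3 r. sw (\<lambda>x4 x5. ?E x1 x2 x3 x4 x5) r) r) r) x"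
  have "?L = sw (\<lambda>x1 r. sw (\<lambda>x2 x5. sw (\<lambda>u v. F (u * (x2 * S x5)) v) (S x1)) r) x"
    using cancel_left[OF cancels_S(2),
        of "\<lambda>k x5. sw (\<lambda>u v. F (u * (_ * S x5)) (v * k)) (S _)"] by (simp add: r)
  also have "\<dots> = sw F (S x)"
    using cancel_right[OF cancels_S(2), of "\<lambda>x1 k. sw (\<lambda>u v. F (u * k) v) (S x1)"] by (simp add: r)
  finally have 1: "?L = sw F (S x)" .
  have "?L = sw (\<lambda>x1 r. sw (\<lambda>s t. sw (\<lambda>x2 x3. sw (\<lambda>x4 x5. ?E x1 x2 x3 x4 x5) t) s) r) x"
    by (simp add: sw_assoc)
  also have "\<dots> = sw (\<lambda>x1 r. sw (\<lambda>s t. sw (\<lambda>x4 x5. sw (\<lambda>x2 x3. ?E x1 x2 x3 x4 x5) s) t) r) x"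
    by (subst sw_swap) (rule refl)
  also have "\<dots> = sw (\<lambda>x1 r. sw (\<lambda>s t. sw (\<lambda>x4 x5.
      sw (\<lambda>u v. F (u * S x5) (v * S x4)) (S x1 * s)) t) r) x"
    by (simp add: sw_mult r mult.assoc sw_swap[where x = "S x" for x])
  also have "\<dots> = sw (\<lambda>x4 x5. sw (\<lambda>u v. F (u * S x5) (v * S x4)) 1) x"
    using cancel_left[OF cancels_S(1),
       of "\<lambda>k t. sw (\<lambda>x4 x5. sw (\<lambda>u v. F (u * S x5) (v * S x4)) k) t"]
    by (simp add: r)
  also have "\<dots> = sw (\<lambda>a b. F (S b) (S a)) x"
    by (simp add: sw_one r)
  finally show ?thesis using 1 by simp
qed


subsection \<open>Bijectivity of the antipode\<close>

lemma le_funpow: assumes f: "le f" shows "le (f ^^ n)"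
proof (induction n)
  case (Suc n)
  show ?case using le_comp[OF f Suc] by (simp add: o_def)
qed (simp add: lin_id)

lemma le_zero: "le f \<Longrightarrow> f 0 = 0"
  by (rule lin_zero[OF vspace_H])

lemma le_range:
  assumes f: "le f"
  shows "x \<in> range f \<Longrightarrow> y \<in> range f \<Longrightarrow> x + y \<in> range f"
    and "x \<in> range f \<Longrightarrow> vscale H c x \<in> range f"
proof -
  assume "x \<in> range f" "y \<in> range f"
  then obtain u v where "x = f u" "y = f v" by blast
  then have "x + y = f (u + v)" using f by (simp add: le_iff)
  then show "x + y \<in> range f" by blast
next
  assume "x \<in> range f"
  then obtain u where "x = f u" by blast
  then have "vscale H c x = f (vscale H c u)" using f by (simp add: le_iff)
  then show "vscale H c x \<in> range f" by blast
qed

text \<open>Fitting's argument: \<open>a\<close> realizes the least dimension of a range and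
  \<open>b\<close> the largest dimension of a kernel. Beyond these, inclusion together with equal
  dimension gives equality.\<close>

lemma funpow_fitting:
  assumes f: "le f"
  obtains m where "0 < m" "\<And>n. m \<le> n \<Longrightarrow> range (f ^^ n) = range (f ^^ m)"
    "\<And>n x. m \<le> n \<Longrightarrow> (f ^^ n) x = 0 \<Longrightarrow> (f ^^ m) x = 0"
proof -
  let ?R = "\<lambda>n. range (f ^^ n)" and ?K = "\<lambda>n. {x. (f ^^ n) x = 0}"
  note fn = le_funpow[OF f, unfolded le_iff]
  have subR: "fin.subspace (?R n)" for n
  proof (rule fin.subspaceI)
    show "0 \<in> ?R n" using le_zero[OF le_funpow[OF f], of n] by (metis rangeI)
  qed (use le_range[OF le_funpow[OF f]] in blast)+
  have subK: "fin.subspace (?K n)" for n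
    using fn[of n] le_zero[OF le_funpow[OF f], of n] by (auto intro!: fin.subspaceI)
  have R_anti: "?R (n + k) \<subseteq> ?R n" for n k
    by (auto simp: funpow_add)
  have K_mono: "?K n \<subseteq> ?K (k + n)" for n k
    using le_zero[OF le_funpow[OF f], of k] by (auto simp: funpow_add)
  obtain a where a: "\<And>n. fin.dim (?R a) \<le> fin.dim (?R n)"
    using ex_has_least_nat[of "\<lambda>_. True" 0 "\<lambda>n. fin.dim (?R n)"] by auto
  obtain b where b: "\<And>n. fin.dim (?K n) \<le> fin.dim (?K b)"
    using ex_has_greatest_nat[of "\<lambda>_. True" 0 "\<lambda>n. fin.dim (?K n)" "Suc fin.dimension"]
      fin.dim_subset_UNIV by (auto simp: less_Suc_eq_le)
  have R: "?R n = ?R a" if "a \<le> n" for n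
    using that R_anti[of a "n - a"] a[of n] subR by (intro fin.subspace_dim_equal) auto
  have K: "?K n = ?K b" if "b \<le> n" for n
    using that K_mono[of b "n - b"] b[of n] subK by (intro fin.subspace_dim_equal[symmetric]) auto
  show thesis
  \<comment> \<open>A threshold beyond both \<open>a\<close> and \<open>b\<close>. The
    \<open>Suc\<close> makes it positive, which \<open>bij_S\<close> uses to split a factor
    \<open>S\<close> off the power.\<close>
  proof (rule that[of "Suc (a + b)"])
    show "?R n = ?R (Suc (a + b))" if "Suc (a + b) \<le> n" for n
      using that R[of n] R[of "Suc (a + b)"] by simp
    show "(f ^^ Suc (a + b)) x = 0" if "Suc (a + b) \<le> n" "(f ^^ n) x = 0" for n x
      using that K[of n] K[of "Suc (a + b)"] by auto
  qed simp
qed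

text \<open>Coalgebra endomorphisms in scalar form; \<open>comap_iff_coalgebra_map\<close> shows the
  agreement with \<open>coalgebra_map H H\<close>.\<close>

definition comap :: "('h \<Rightarrow> 'h) \<Rightarrow> bool" where
  "comap f \<longleftrightarrow> le f \<and> (\<forall>F x. bl F \<longrightarrow> sw F (f x) = sw (\<lambda>a b. F (f a) (f b)) x) \<and>
    (\<forall>x. eps (f x) = eps x)"

lemma comapD:
  assumes "comap f"
  shows "le f" "bl F \<Longrightarrow> sw F (f x) = sw (\<lambda>a b. F (f a) (f b)) x" "eps (f x) = eps x"
  using assms by (auto simp: comap_def)

lemma comap_id: "comap (\<lambda>x. x)" "comap id"
  by (simp_all add: comap_def rules id_def)

lemma comap_comp:
  assumes f: "comap f" and g: "comap g"
  shows "comap (f \<circ> g)"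
  unfolding comap_def
proof (intro conjI allI impI)
  fix F x assume F: "bl F"
  note r = rules bl_lf[OF F] comapD(1)[OF f] comapD(1)[OF g]
  show "sw F ((f \<circ> g) x) = sw (\<lambda>a b. F ((f \<circ> g) a) ((f \<circ> g) b)) x"
    using comapD(2)[OF g, of "\<lambda>a b. F (f a) (f b)" x] by (simp add: comapD(2)[OF f F] r)
qed (use comapD(1)[OF f] comapD(1)[OF g] in \<open>simp_all add: o_def le_comp comapD(3)[OF f] comapD(3)[OF g]\<close>)

lemma comap_funpow: "comap f \<Longrightarrow> comap (f ^^ n)"
  by (induction n) (simp_all add: comap_id comap_comp)

text \<open>Each \<open>S\<close> reverses the two legs, so applying it twice restores their
  order.\<close>

lemma comap_S_S: "comap (S \<circ> S)"
  unfolding comap_def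
proof (intro conjI allI impI)
  fix F x assume F: "bl F"
  show "sw F ((S \<circ> S) x) = sw (\<lambda>a b. F ((S \<circ> S) a) ((S \<circ> S) b)) x"
    using sw_S[of "\<lambda>a b. F (S b) (S a)" x] by (simp add: sw_S F rules bl_lf[OF F])
qed (simp_all add: o_def rules eps_S)

text \<open>\<open>N\<close> is invertible on its range with inverse \<tau>, and \<pi> is
  \<open>N\<close> followed by \<tau>. One more application of \<tau> gives \<open>R\<close>, which
  satisfies \<open>N \<circ> R = R \<circ> N = \<pi>\<close> and so lets \<open>N\<close> be
  inserted and removed around coproducts.\<close>

lemma comap_projection:
  assumes N: "comap N" and bij: "bij_betw N (range N) (range N)"
  obtains \<pi> where "comap \<pi>" "\<And>x. N (\<pi> x) = N x" "\<And>x. \<pi> x \<in> range N"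
proof -
  define \<tau> where "\<tau> = inv_into (range N) N"
  define \<pi> R where "\<pi> = (\<lambda>x. \<tau> (N x))" and "R = (\<lambda>x. \<tau> (\<pi> x))"
  note leN = comapD(1)[OF N, unfolded le_iff]
  have \<tau>: "\<tau> y \<in> range N" "N (\<tau> y) = y" if "y \<in> range N" for y
    using that bij unfolding \<tau>_def
    by (auto simp: bij_betw_def intro: inv_into_into f_inv_into_f)
  have \<tau>_unique: "\<tau> y = k" if "k \<in> range N" "N k = y" for k y
    using that bij by (auto simp: \<tau>_def bij_betw_def inv_into_f_f)
  note sub = le_range[OF comapD(1)[OF N]]
  have \<tau>_lin: "x \<in> range N \<Longrightarrow> y \<in> range N \<Longrightarrow> \<tau> (x + y) = \<tau> x + \<tau> y"
    "x \<in> range N \<Longrightarrow> \<tau> (vscale H c x) = vscale H c (\<tau> x)" for x y c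
    using \<tau> sub leN by (simp_all add: \<tau>_unique)
  have le\<pi>: "le \<pi>"
    using leN \<tau>_lin by (auto simp: le_iff \<pi>_def)
  have \<pi>_in: "\<pi> x \<in> range N" for x
    using \<tau> by (auto simp: \<pi>_def)
  have leR: "le R"
    using le\<pi> \<tau>_lin \<pi>_in by (auto simp: le_iff R_def)
  have N\<pi>: "N (\<pi> x) = N x" for x
    using \<tau> by (simp add: \<pi>_def)
  have \<pi>N: "\<pi> (N x) = N x" for x
    by (simp add: \<pi>_def \<tau>_unique)
  have NR: "N (R x) = \<pi> x" for x
    using \<tau> \<pi>_in by (simp add: R_def)
  have RN: "R (N x) = \<pi> x" for x
    by (simp add: R_def \<pi>N) (simp add: \<pi>_def)
  have "sw F (\<pi> x) = sw (\<lambda>a b. F (\<pi> a) (\<pi> b)) x" if F: "bl F" for F x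
  proof -
    note r = rules bl_lf[OF F] le\<pi> leR
    \<comment> \<open>As \<open>\<pi> x = N (R x)\<close>, both legs of its coproduct come from
      \<open>range N\<close>, where \<pi> is the identity. Then \<pi> on the legs is written as
      \<open>R\<close> after \<open>N\<close>, and moving \<open>N\<close> through the coproduct
      replaces \<open>\<pi> x\<close> by \<open>x\<close>, because
      \<open>N (\<pi> x) = N x\<close>.\<close>
    have "sw F (\<pi> x) = sw (\<lambda>a b. F (N a) (N b)) (R x)"
      using comapD(2)[OF N F, of "R x"] by (simp add: NR)
    also have "\<dots> = sw (\<lambda>a b. F (\<pi> a) (\<pi> b)) (\<pi> x)"
      using comapD(2)[OF N, of "\<lambda>a b. F (\<pi> a) (\<pi> b)" "R x"] by (simp add: NR \<pi>N r)
    also have "\<dots> = sw (\<lambda>a b. F (R a) (R b)) (N x)"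
      using comapD(2)[OF N, of "\<lambda>a b. F (R a) (R b)" "\<pi> x"] by (simp add: RN N\<pi> r)
    also have "\<dots> = sw (\<lambda>a b. F (\<pi> a) (\<pi> b)) x"
      using comapD(2)[OF N, of "\<lambda>a b. F (R a) (R b)" x] by (simp add: RN r)
    finally show ?thesis .
  qed
  moreover have "eps (\<pi> x) = eps x" for x
    using comapD(3)[OF N] N\<pi> by metis
  ultimately have "comap \<pi>" using le\<pi> by (simp add: comap_def)
  then show thesis using N\<pi> \<pi>_in by (rule that)
qed

lemma funpow_S_mult:
  "(S ^^ n) (x * y) = (if even n then (S ^^ n) x * (S ^^ n) y else (S ^^ n) y * (S ^^ n) x)"
  by (induction n) (simp_all add: S_mult)

lemma funpow_S_one: "(S ^^ n) 1 = 1"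
  by (induction n) (simp_all add: S_one)

lemma cancels_comp:
  assumes K: "cancels K" and f: "le f" "f 1 = 1"
  shows "cancels (\<lambda>a b. f (K a b))"
  using cancelsD[OF K lf_comp[OF _ f(1)]] f(2) by (simp add: cancels_def)

lemma cancels_comap:
  assumes K: "cancels K" and f: "comap f" and b: "\<And>F. lf F \<Longrightarrow> bl (\<lambda>a b. F (K a b))"
  shows "cancels (\<lambda>a b. K (f a) (f b))"
  unfolding cancels_def
proof (intro allI impI)
  fix F x assume F: "lf F"
  show "sw (\<lambda>a b. F (K (f a) (f b))) x = eps x * F 1"
    using comapD(2)[OF f b[OF F], of x] cancelsD[OF K F, of "f x"] comapD(3)[OF f] by simp
qed

text \<open>\<open>S\<^sup>j\<close> has the convolution inverse \<open>S\<^sup>j\<^sup>+\<^sup>1\<close> (for the opposite coproduct when \<open>j\<close> is odd), so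
  \<open>S\<^sup>j\<^sup>+\<^sup>1\<pi> = S\<^sup>j\<^sup>+\<^sup>1\<close> implies \<open>S\<^sup>j\<pi> = S\<^sup>j\<close> for every coalgebra map \<open>\<pi>\<close>.\<close>

lemma comap_eq_id:
  assumes \<pi>: "comap \<pi>" and n: "\<And>x. (S ^^ n) (\<pi> x) = (S ^^ n) x"
  shows "\<pi> x = x"
proof -
  have "\<forall>x. (S ^^ n) (\<pi> x) = (S ^^ n) x \<Longrightarrow> \<pi> x = x" for n
  proof (induction n)
    case (Suc j)
    note leS = le_funpow[OF le_S]
    have leL: "le (\<lambda>x. (S ^^ j) (\<pi> x))"
      by (rule le_comp[OF leS comapD(1)[OF \<pi>]])
    have eq: "(S ^^ Suc j) x = (S ^^ Suc j) (\<pi> x)" for x using Suc.prems by simp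
    have b: "bl (\<lambda>a b. F ((S ^^ i) a * (S ^^ k) b))" "bl (\<lambda>a b. F ((S ^^ i) b * (S ^^ k) a))"
      if "lf F" for F i k
      by (simp_all add: rules lf_comp[OF that] leS del: funpow.simps)
    note c = cancels_comp[OF cancels_S(1) leS[of j] funpow_S_one]
      cancels_comp[OF cancels_S(2) leS[of j] funpow_S_one]
    have "(S ^^ j) (\<pi> x) = (S ^^ j) x" for x
    proof (cases "even j")
      case True
      then have c': "cancels (\<lambda>a b. (S ^^ Suc j) a * (S ^^ j) b)"
          "cancels (\<lambda>a b. (S ^^ j) a * (S ^^ Suc j) b)"
        using c by (simp_all add: funpow_S_mult funpow_swap1)
      show ?thesis
      proof (rule conv_inverse_unique[OF leL leS _ c'(1)])
        show "cancels (\<lambda>a b. (S ^^ j) (\<pi> a) * (S ^^ Suc j) b)"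
          using cancels_comap[OF c'(2) \<pi> b(1)] by (simp only: eq[symmetric])
      qed
    next
      case False
      then have c': "cancels (\<lambda>a b. (S ^^ j) b * (S ^^ Suc j) a)"
          "cancels (\<lambda>a b. (S ^^ Suc j) b * (S ^^ j) a)"
        using c by (simp_all add: funpow_S_mult funpow_swap1)
      show ?thesis
      proof (rule cop_conv_inverse_unique[OF leL leS _ c'(2)])
        show "cancels (\<lambda>a b. (S ^^ j) (\<pi> b) * (S ^^ Suc j) a)"
          using cancels_comap[OF c'(1) \<pi> b(2)] by (simp only: eq[symmetric])
      qed
    qed
    then show ?case by (intro Suc.IH) simp
  qed simp
  then show ?thesis using n by blast
qed

theorem bij_S: "bij S"
proof -
  obtain m where m: "0 < m" "\<And>n. m \<le> n \<Longrightarrow> range (S ^^ n) = range (S ^^ m)"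
    "\<And>n x. m \<le> n \<Longrightarrow> (S ^^ n) x = 0 \<Longrightarrow> (S ^^ m) x = 0"
    using funpow_fitting[OF le_S] by blast
  \<comment> \<open>An even power, so that \<open>N\<close> respects the coproduct, with exponent at
    least \<open>m\<close>, so that range and kernel are stable.\<close>
  define N where "N = S ^^ (2 * m)"
  have N: "comap N"
  proof -
    have "S \<circ> S = S ^^ 2" by (simp add: numeral_2_eq_2)
    then show ?thesis using comap_funpow[OF comap_S_S, of m] by (simp add: N_def funpow_mult)
  qed
  have le_N: "le N" by (rule comapD(1)[OF N])
  have NN: "N (N x) = (S ^^ (4 * m)) x" for x
    using funpow_add[of "2 * m" "2 * m" S] by (simp add: N_def)
  have "N ` range N = range N"
    using m(2)[of "4 * m"] m(2)[of "2 * m"] by (simp add: image_image NN) (simp add: N_def)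
  moreover have "inj_on N (range N)"
  proof (rule inj_onI)
    fix x y assume "x \<in> range N" "y \<in> range N" and e: "N x = N y"
    then obtain u v where uv: "x = N u" "y = N v" by blast
    have diff: "N (a - b) = N a - N b" for a b
      using le_N[unfolded le_iff] by (metis add_diff_cancel diff_add_cancel)
    have "N (N (u - v)) = 0" using e by (simp add: uv diff)
    \<comment> \<open>A kernel that no longer grows makes \<open>N\<close> injective on its
      range.\<close>
    then have "(S ^^ m) (u - v) = 0" using m(3)[of "4 * m"] by (simp add: NN)
    then have "N (u - v) = 0"
      using le_zero[OF le_funpow[OF le_S], of m] by (simp add: N_def mult_2 funpow_add)
    then show "x = y" by (simp add: uv diff)
  qed
  ultimately have bij: "bij_betw N (range N) (range N)" by (simp add: bij_betw_def)
  obtain \<pi> where \<pi>: "comap \<pi>" "\<And>x. N (\<pi> x) = N x" "\<And>x. \<pi> x \<in> range N"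
    using comap_projection[OF N bij] by blast
  have "\<pi> x = x" for x
    by (rule comap_eq_id[OF \<pi>(1), of "2 * m"]) (rule \<pi>(2)[unfolded N_def])
  then have "range N = UNIV" using \<pi>(3) by auto
  with bij have bN: "bij N" by (simp add: bij_def bij_betw_def)
  \<comment> \<open>Since \<open>m\<close> is positive, one \<open>S\<close> splits off on either
    side; injectivity and surjectivity of \<open>N\<close> then pass to \<open>S\<close>.\<close>
  have NS: "N = S ^^ (2 * m - 1) \<circ> S" "N = S \<circ> S ^^ (2 * m - 1)"
    using m(1) unfolding N_def
    by (metis Suc_diff_1 funpow_Suc_right nat_0_less_mult_iff zero_less_numeral)
       (metis Suc_diff_1 funpow.simps(2) m(1) nat_0_less_mult_iff zero_less_numeral)
  have "inj S" using bN NS(1) by (metis bij_is_inj inj_on_imageI2)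
  moreover have "surj S" using bN NS(2) by (metis bij_is_surj comp_surj fun.set_map image_comp surj_def comp_apply)
  ultimately show ?thesis by (simp add: bij_def)
qed


abbreviation Si :: "'h \<Rightarrow> 'h" where "Si \<equiv> inv_into UNIV S"

lemma S_Si [simp]: "S (Si x) = x" and Si_S [simp]: "Si (S x) = x"
  using bij_S by (simp_all add: bij_is_inj bij_is_surj surj_f_inv_f)

lemma Si_eqI: "S x = y \<Longrightarrow> Si y = x"
  by auto

lemma le_Si: "le Si"
  using le_S unfolding le_iff by (auto intro!: Si_eqI)

lemma Si_one: "Si 1 = 1"
  by (simp add: Si_eqI S_one)

lemma Si_mult: "Si (x * y) = Si y * Si x"
  by (simp add: Si_eqI S_mult)

lemma eps_Si: "eps (Si x) = eps x"
  using eps_S[of "Si x"] by simp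

text \<open>The inverse antipode is applied to the two antipode laws. Being antimultiplicative it
  exchanges the factors, which yields the antipode laws for the opposite coproduct.\<close>

lemma cancels_Si: "cancels (\<lambda>a b. Si b * a)" "cancels (\<lambda>a b. b * Si a)"
  using cancels_comp[OF cancels_S(1) le_Si Si_one] cancels_comp[OF cancels_S(2) le_Si Si_one]
  by (simp_all add: Si_mult)

lemma le_Si_comp: "le g \<Longrightarrow> le (\<lambda>x. Si (g x))"
  by (rule le_comp[OF le_Si])

lemma sw_Si:
  assumes F: "bl F"
  shows "sw F (Si x) = sw (\<lambda>a b. F (Si b) (Si a)) x"
  using sw_S[of "\<lambda>a b. F (Si b) (Si a)" "Si x"] bl_lf[OF F] le_Si
  by (simp add: rules le_Si_comp)


subsection \<open>Hopf automorphisms\<close>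

lemma comap_iff_coalgebra_map: "comap f \<longleftrightarrow> coalgebra_map H H f"
proof (cases "le f")
  case f: True
  have "(\<forall>F. bl F \<longrightarrow> sw F (f x) = sw (\<lambda>a b. F (f a) (f b)) x)
      \<longleftrightarrow> comul H (f x) = tmap H H H H f f (comul H x)" (is "?L \<longleftrightarrow> ?R") for x
  proof -
    have t: "tmap H H H H f f (comul H x) F = sw (\<lambda>a b. F (f a) (f b)) x" if "bl F" for F
      using that f by (simp add: tmap_apply comul_in comul_apply bl_lf[OF that] rules)
    show ?thesis
    proof
      assume L: ?L
      show ?R
      proof (rule frame_eqI[OF frame_tensor[OF vspace_H vspace_H frame_H frame_H] comul_in
            lin_in[OF lin_tmap[OF f f] comul_in]])
        fix i assume "i \<in> B \<times> B"
        have "bl (\<lambda>v w. db (fst i) v * db (snd i) w)" by (simp add: rules)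
        with L t show "(case i of (i, j) \<Rightarrow> \<lambda>t. t (\<lambda>v w. db i v * db j w)) (comul H (f x)) =
            (case i of (i, j) \<Rightarrow> \<lambda>t. t (\<lambda>v w. db i v * db j w)) (tmap H H H H f f (comul H x))"
          by (simp add: case_prod_beta comul_apply)
      qed
    next
      assume R: ?R
      show ?L using R t by (metis comul_apply)
    qed
  qed
  then show ?thesis using f by (auto simp: comap_def coalgebra_map_def)
qed (simp add: comap_def coalgebra_map_def)

lemma hopf_automorphism_iff: "hopf_automorphism H f \<longleftrightarrow>
    bij f \<and> comap f \<and> f 1 = 1 \<and> (\<forall>x y. f (x * y) = f x * f y)"
  by (simp add: hopf_automorphism_def comap_iff_coalgebra_map)

lemma autD:
  assumes "hopf_automorphism H f"
  shows aut_bij: "bij f" and aut_comap: "comap f" and aut_one: "f 1 = 1"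
    and aut_mult: "f (x * y) = f x * f y" and aut_le: "le f"
    and aut_eps: "eps (f x) = eps x"
    and aut_sw: "bl F \<Longrightarrow> sw F (f x) = sw (\<lambda>a b. F (f a) (f b)) x"
    and aut_le_comp: "le g \<Longrightarrow> le (\<lambda>x. f (g x))"
  using assms comapD[of f] le_comp[of f g] by (auto simp: hopf_automorphism_iff)

lemma aut_inv_simps:
  assumes "hopf_automorphism H f"
  shows "f (inv_into UNIV f x) = x" "inv_into UNIV f (f x) = x"
  using aut_bij[OF assms] by (simp_all add: bij_is_inj bij_is_surj surj_f_inv_f)

lemma aut_id: "hopf_automorphism H id"
  by (simp add: hopf_automorphism_iff comap_id)

lemma aut_comp: "hopf_automorphism H f \<Longrightarrow> hopf_automorphism H g \<Longrightarrow> hopf_automorphism H (f \<circ> g)"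
  by (simp add: hopf_automorphism_iff comap_comp bij_comp)

lemma aut_inv:
  assumes f: "hopf_automorphism H f"
  shows "hopf_automorphism H (inv_into UNIV f)"
proof -
  let ?g = "inv_into UNIV f"
  note fg = aut_inv_simps[OF f]
  have inj: "x = y" if "f x = f y" for x y
    using that fg(2) by metis
  have le: "le ?g"
    unfolding le_iff
    by (intro conjI allI; rule inj) (simp_all add: fg aut_le[OF f, unfolded le_iff])
  have "sw F (?g x) = sw (\<lambda>a b. F (?g a) (?g b)) x" if F: "bl F" for F x
    using aut_sw[OF f, of "\<lambda>a b. F (?g a) (?g b)" "?g x"] le
    by (simp add: fg rules bl_lf[OF F])
  moreover have "eps (?g x) = eps x" for x
    using aut_eps[OF f, of "?g x"] by (simp add: fg)
  ultimately have "comap ?g" using le by (simp add: comap_def)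
  moreover have "?g 1 = 1" "?g (x * y) = ?g x * ?g y" for x y
    by (rule inj, simp add: fg aut_one[OF f] aut_mult[OF f])+
  ultimately show ?thesis
    using aut_bij[OF f] by (simp add: hopf_automorphism_iff bij_imp_bij_inv)
qed

text \<open>\<open>f\<close> after \<open>S\<close> is a left and \<open>S\<close> after
  \<open>f\<close> a right convolution inverse of \<open>f\<close>.\<close>

lemma aut_S: assumes f: "hopf_automorphism H f" shows "f (S x) = S (f x)"
proof (rule conv_inverse_unique[where L = "\<lambda>x. f (S x)" and M = f and R = "\<lambda>x. S (f x)"])
  show "cancels (\<lambda>a b. f (S a) * f b)"
    using cancels_comp[OF cancels_S(1) aut_le[OF f] aut_one[OF f]] by (simp add: aut_mult[OF f])
  have "bl (\<lambda>a b. F (a * S b))" if "lf F" for F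
    by (simp add: rules lf_comp[OF that])
  then show "cancels (\<lambda>a b. f a * S (f b))"
    by (rule cancels_comap[OF cancels_S(2) aut_comap[OF f]])
qed (simp_all add: rules aut_le[OF f] aut_le_comp[OF f])

lemma aut_Si: "hopf_automorphism H f \<Longrightarrow> f (Si x) = Si (f x)"
  using aut_S[of f "Si x"] by (simp add: Si_eqI)

lemma Aut_pairs_carrier: "a \<in> carrier (Aut_pairs H) \<longleftrightarrow>
    hopf_automorphism H (fst a) \<and> hopf_automorphism H (snd a)"
  by (cases a) (simp add: Aut_pairs_def)

lemma Aut_pairs_mult: "(\<alpha>, \<beta>) \<otimes>\<^bsub>Aut_pairs H\<^esub> (\<gamma>, \<delta>) = (\<delta> \<circ> \<alpha> \<circ> inv_into UNIV \<delta> \<circ> \<gamma>, \<delta> \<circ> \<beta>)"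
  and Aut_pairs_one: "\<one>\<^bsub>Aut_pairs H\<^esub> = (id, id)"
  by (simp_all add: Aut_pairs_def)

lemma Aut_pairs_inv_aux:
  assumes \<alpha>: "hopf_automorphism H \<alpha>" and \<beta>: "hopf_automorphism H \<beta>"
  defines "b \<equiv> (inv_into UNIV \<beta> \<circ> inv_into UNIV \<alpha> \<circ> \<beta>, inv_into UNIV \<beta>)"
  shows "b \<in> carrier (Aut_pairs H)" "b \<otimes>\<^bsub>Aut_pairs H\<^esub> (\<alpha>, \<beta>) = \<one>\<^bsub>Aut_pairs H\<^esub>"
  using assms
  by (simp_all add: Aut_pairs_carrier Aut_pairs_mult Aut_pairs_one aut_comp aut_inv
      aut_inv_simps fun_eq_iff)

lemma group_Aut_pairs: "group (Aut_pairs H)"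
proof (rule groupI)
  show "\<one>\<^bsub>Aut_pairs H\<^esub> \<in> carrier (Aut_pairs H)"
    by (simp add: Aut_pairs_carrier Aut_pairs_one aut_id)
  fix x assume x: "x \<in> carrier (Aut_pairs H)"
  obtain \<alpha> \<beta> where [simp]: "x = (\<alpha>, \<beta>)" by (cases x)
  have ab: "hopf_automorphism H \<alpha>" "hopf_automorphism H \<beta>"
    using x by (simp_all add: Aut_pairs_carrier)
  show "\<one>\<^bsub>Aut_pairs H\<^esub> \<otimes>\<^bsub>Aut_pairs H\<^esub> x = x"
    using ab by (simp add: Aut_pairs_mult Aut_pairs_one fun_eq_iff aut_inv_simps)
  show "\<exists>y\<in>carrier (Aut_pairs H). y \<otimes>\<^bsub>Aut_pairs H\<^esub> x = \<one>\<^bsub>Aut_pairs H\<^esub>"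
    using Aut_pairs_inv_aux[OF ab] by auto
  fix y assume y: "y \<in> carrier (Aut_pairs H)"
  obtain \<gamma> \<delta> where [simp]: "y = (\<gamma>, \<delta>)" by (cases y)
  have cd: "hopf_automorphism H \<gamma>" "hopf_automorphism H \<delta>"
    using y by (simp_all add: Aut_pairs_carrier)
  show "x \<otimes>\<^bsub>Aut_pairs H\<^esub> y \<in> carrier (Aut_pairs H)"
    using ab cd by (simp add: Aut_pairs_carrier Aut_pairs_mult aut_comp aut_inv)
  fix z assume z: "z \<in> carrier (Aut_pairs H)"
  obtain \<zeta> \<theta> where [simp]: "z = (\<zeta>, \<theta>)" by (cases z)
  have "bij \<delta>" "bij \<theta>"
    using cd z aut_bij by (simp_all add: Aut_pairs_carrier)
  then have "inv_into UNIV (\<theta> \<circ> \<delta>) = inv_into UNIV \<delta> \<circ> inv_into UNIV \<theta>"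
    by (simp add: o_inv_distrib)
  then show "x \<otimes>\<^bsub>Aut_pairs H\<^esub> y \<otimes>\<^bsub>Aut_pairs H\<^esub> z = x \<otimes>\<^bsub>Aut_pairs H\<^esub> (y \<otimes>\<^bsub>Aut_pairs H\<^esub> z)"
    using cd z by (simp add: Aut_pairs_mult Aut_pairs_carrier fun_eq_iff aut_inv_simps)
qed

lemma Aut_pairs_inv:
  assumes "(\<alpha>, \<beta>) \<in> carrier (Aut_pairs H)"
  shows "inv\<^bsub>Aut_pairs H\<^esub> (\<alpha>, \<beta>) = (inv_into UNIV \<beta> \<circ> inv_into UNIV \<alpha> \<circ> \<beta>, inv_into UNIV \<beta>)"
  using assms Aut_pairs_inv_aux[of \<alpha> \<beta>]
  by (intro group.inv_equality[OF group_Aut_pairs]) (auto simp: Aut_pairs_carrier)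

end


text \<open>\<open>lin\<close>, \<open>tensor\<close> etc. only depend on the underlying vector spaces of their arguments, so the
  fibres of \<open>CT\<close> can be replaced by \<open>H\<^sup>* \<otimes> H\<close> in them.\<close>

definition vsp_of :: "('k, 'v, 'z) vsp_scheme \<Rightarrow> ('k, 'v) vsp" where
  "vsp_of V = \<lparr>vscale = vscale V, vset = vset V\<rparr>"

lemma vsp_of_simps: "vscale (vsp_of V) = vscale V" "vset (vsp_of V) = vset V"
  by (simp_all add: vsp_of_def)

lemma vspace_vsp_of: "vspace V = vspace (vsp_of V)"
  by (simp add: vspace_def vsp_of_simps)

lemma lin_vsp_of: "lin V W = lin (vsp_of V) W" "lin V W = lin V (vsp_of W)"
  by (simp_all add: lin_def vsp_of_simps fun_eq_iff)

lemma bilin_vsp_of: "bilin V W U = bilin (vsp_of V) W U" "bilin V W U = bilin V (vsp_of W) U"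
  by (simp_all add: bilin_def vsp_of_simps lin_vsp_of(1)[symmetric] fun_eq_iff)

lemma tpure_vsp_of: "tpure V W = tpure (vsp_of V) W" "tpure V W = tpure V (vsp_of W)"
  by (simp_all add: tpure_def bilin_vsp_of[symmetric] fun_eq_iff)

lemma tensor_vsp_of: "tensor V W = tensor (vsp_of V) W" "tensor V W = tensor V (vsp_of W)"
  by (simp_all add: tensor_def tpure_vsp_of[symmetric] vsp_of_simps)

lemma tlift_vsp_of: "tlift V W U = tlift (vsp_of V) W U" "tlift V W U = tlift V (vsp_of W) U"
  "tlift V W U = tlift V W (vsp_of U)"
  by (simp_all add: tlift_def tpure_vsp_of[symmetric] tensor_vsp_of[symmetric] vsp_of_simps
      lin_vsp_of(2)[symmetric] fun_eq_iff)

lemma tmap_vsp_of: "tmap V W V' W' = tmap (vsp_of V) W V' W'" "tmap V W V' W' = tmap V (vsp_of W) V' W'"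
  "tmap V W V' W' = tmap V W (vsp_of V') W'" "tmap V W V' W' = tmap V W V' (vsp_of W')"
  by (simp_all add: tmap_def tpure_vsp_of[symmetric] tensor_vsp_of[symmetric]
      tlift_vsp_of[symmetric] fun_eq_iff)

lemma tassoc_vsp_of: "tassoc U V W = tassoc (vsp_of U) V W" "tassoc U V W = tassoc U (vsp_of V) W"
  "tassoc U V W = tassoc U V (vsp_of W)"
  by (simp_all add: tassoc_def tpure_vsp_of[symmetric] tensor_vsp_of[symmetric]
      tlift_vsp_of[symmetric] fun_eq_iff)

lemma tmiddle_vsp_of: "tmiddle A B C D = tmiddle (vsp_of A) B C D"
  "tmiddle A B C D = tmiddle A (vsp_of B) C D" "tmiddle A B C D = tmiddle A B (vsp_of C) D"
  "tmiddle A B C D = tmiddle A B C (vsp_of D)"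
  by (simp_all add: tmiddle_def tpure_vsp_of[symmetric] tensor_vsp_of[symmetric]
      tlift_vsp_of[symmetric] fun_eq_iff)

lemma vsp_of_base_coalgebra: "vsp_of base_coalgebra = base_field"
  by (simp add: vsp_of_def base_coalgebra_def base_field_def)

lemma vsp_of_tensor_coalgebra: "vsp_of (tensor_coalgebra C D) = tensor C D"
  by (simp add: vsp_of_def tensor_coalgebra_def)

lemma vsp_of_CT: "vsp_of (CT H S B a) = tensor (dual H) H"
  by (cases a) (simp add: vsp_of_def CT_def Let_def)

text \<open>Both sides are linear forms that agree on pure tensors. In the antipode axiom this
  writes \<open>CT_mult\<close> as an evaluation, so that \<open>tmap_apply\<close> can be used on
  its argument.\<close>

lemma lin_apply_tensor:
  assumes "lin (tensor V W) base_field L" "t \<in> vset (tensor V W)"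
  shows "L t = t (\<lambda>v w. L (tpure V W v w))"
proof (rule tensor_lin_unique[OF assms(1) lin_eval _ assms(2)])
  fix v w assume "v \<in> vset V" "w \<in> vset W"
  show "L (tpure V W v w) = tpure V W v w (\<lambda>v w. L (tpure V W v w))"
    by (rule tpure_apply[symmetric, OF bilin_comp[OF bilin_tpure assms(1)]])
qed


section \<open>The dual space and the spaces \<open>H\<^sup>* \<otimes> H\<close>\<close>

context fd_hopf_algebra
begin

abbreviation X :: "('k, ('k, 'h \<Rightarrow> 'k, 'h) tensor) vsp" where "X \<equiv> tensor (dual H) H"
abbreviation XX where "XX \<equiv> tensor X X"

lemma dual_simps [simp]: "vscale (dual H) = fscale" "p \<in> vset (dual H) \<longleftrightarrow> lf p"
  by (simp_all add: dual_def)

lemma vspace_dual: "vspace (dual H)"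
  unfolding vspace_def dual_simps(1)
proof
  interpret module "fscale :: 'k \<Rightarrow> ('h \<Rightarrow> 'k) \<Rightarrow> 'h \<Rightarrow> 'k" by (rule module_fscale)
  show "subspace (vset (dual H))"
    by (rule subspaceI) (auto simp: lf_iff algebra_simps)
qed (simp add: vector_space_fscale)

lemma lin_dual_eval: "lin (dual H) base_field (\<lambda>p. p x)"
  by (rule linI) simp_all

lemma frame_dual: "frame (dual H) B db (\<lambda>b p. p b)"
  by (auto simp: frame_def lf_db lin_dual_eval fun_eq_iff sum_apply lf_expand mult.commute[of _ "db _ _"])

lemma lf_conv: "lf p \<Longrightarrow> lf q \<Longrightarrow> conv H p q = sw (\<lambda>a b. p a * q b)"
  by (simp add: conv_def fun_eq_iff tlift_base_field comul_in comul_apply rules)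

lemma conv_in [simp]: "lf p \<Longrightarrow> lf q \<Longrightarrow> lf (conv H p q)"
  by (simp add: lf_conv rules)

lemma conv_assoc:
  "lf p \<Longrightarrow> lf q \<Longrightarrow> lf r \<Longrightarrow> conv H (conv H p q) r = conv H p (conv H q r)"
  by (simp add: lf_conv rules sw_mult_right[symmetric] sw_mult_left[symmetric] sw_assoc mult.assoc
      fun_eq_iff)

lemma conv_eps: "lf p \<Longrightarrow> conv H eps p = p" "lf p \<Longrightarrow> conv H p eps = p"
  by (simp_all add: lf_conv lf_eps fun_eq_iff counit_left counit_right mult.commute[of "_ _" "eps _"])

lemma lin_conv:
  assumes q: "lf q"
  shows "lin (dual H) (dual H) (conv H q)" "lin (dual H) (dual H) (\<lambda>p. conv H p q)"
proof -
  have s: "lf (p + p')" "lf (fscale c p)" if "lf p" "lf p'" for p p' c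
    using that vspace_add[OF vspace_dual] vspace_scale[OF vspace_dual] by simp_all
  show "lin (dual H) (dual H) (conv H q)" "lin (dual H) (dual H) (\<lambda>p. conv H p q)"
    using q by (auto intro!: linI ext simp: lf_conv s algebra_simps sw_add sw_mult_left sw_add_arg sw_scale_arg)
qed

lemma lf_shift: "lf p \<Longrightarrow> lf (\<lambda>x. p (x * c))"
  by (simp add: lf_iff algebra_simps scale_mult_left[symmetric])

text \<open>The sum is the coordinate expansion of \<open>p (h * h')\<close> in the second argument
  \<open>h'\<close>. It is the only candidate, because the frame of the dual consists of evaluations
  at basis elements, so evaluations at pairs separate tensors.\<close>

lemma dual_comul_eq:
  assumes p: "lf p"
  shows "dual_comul H p = (\<Sum>c\<in>B. tpure (dual H) (dual H) (\<lambda>x. p (x * c)) (db c))" (is "_ = ?t")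
  unfolding dual_comul_def
proof (rule the_equality)
  let ?F = "\<lambda>h h' q r. q h * r h'"
  have bF: "bilin (dual H) (dual H) base_field (?F h h')" for h h'
    by (rule bilin_product[OF lin_dual_eval lin_dual_eval])
  have t_in: "?t \<in> vset (tensor (dual H) (dual H))"
    using p by (intro vspace_sum[OF vspace_tensor] tpure_in_tensor) (simp_all add: lf_shift lf_db)
  have t_eval: "?t (?F h h') = p (h * h')" for h h'
    using lf_expand[of "\<lambda>c. p (h * c)" h'] lf_comp[OF p, of "\<lambda>c. h * c"]
    by (simp add: sum_apply tpure_apply[OF bF] rules mult.commute)
  show "?t \<in> vset (tensor (dual H) (dual H)) \<and> (\<forall>h h'. p (h * h') =
      tlift (dual H) (dual H) base_field (\<lambda>q r. q h * r h') ?t)"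
    using t_in t_eval by (simp add: tlift_base_field[OF bF t_in])
  fix t assume "t \<in> vset (tensor (dual H) (dual H)) \<and> (\<forall>h h'. p (h * h') =
      tlift (dual H) (dual H) base_field (\<lambda>q r. q h * r h') t)"
  then have t: "t \<in> vset (tensor (dual H) (dual H))"
    "p (h * h') = tlift (dual H) (dual H) base_field (?F h h') t" for h h' by auto
  have "t (?F h h') = ?t (?F h h')" for h h'
    using t(2)[of h h'] by (simp only: t_eval tlift_base_field[OF bF t(1)])
  then show "t = ?t"
    by (intro frame_eqI[OF frame_tensor[OF vspace_dual vspace_dual frame_dual frame_dual] t(1) t_in])
       auto
qed

lemma lin_dual_comul: "lin (dual H) (tensor (dual H) (dual H)) (dual_comul H)"
proof -
  let ?D = "\<lambda>p. \<Sum>c\<in>B. tpure (dual H) (dual H) (\<lambda>x. p (x * c)) (db c)"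
  have "lin (dual H) (dual H) (\<lambda>p x. p (x * c))" for c
    by (rule linI) (auto simp: lf_shift)
  then have "lin (dual H) (tensor (dual H) (dual H)) ?D"
    by (intro lin_sum_maps[OF vspace_tensor] lin_comp[OF _ bilin_left[OF bilin_tpure]])
       (simp_all add: lf_db)
  then show ?thesis by (rule lin_cong[OF vspace_dual]) (simp add: dual_comul_eq)
qed

lemma dual_comul_in: "lf p \<Longrightarrow> dual_comul H p \<in> vset (tensor (dual H) (dual H))"
  using lin_in[OF lin_dual_comul] by simp

lemma dual_comul_apply:
  "lf p \<Longrightarrow> bilin (dual H) (dual H) base_field \<phi> \<Longrightarrow>
    dual_comul H p \<phi> = (\<Sum>c\<in>B. \<phi> (\<lambda>x. p (x * c)) (db c))"
  by (simp add: dual_comul_eq sum_apply tpure_apply)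

abbreviation bt :: "('h \<Rightarrow> 'k) \<Rightarrow> 'h \<Rightarrow> ('k, 'h \<Rightarrow> 'k, 'h) tensor" where
  "bt \<equiv> bowtie H"

text \<open>Under the reading of tensors as maps, this form sends a map \<open>u\<close> to
  \<open>f (u x)\<close>.\<close>

abbreviation (input) tst :: "'h \<Rightarrow> ('h \<Rightarrow> 'k) \<Rightarrow> ('h \<Rightarrow> 'k) \<Rightarrow> 'h \<Rightarrow> 'k" where
  "tst x f \<equiv> (\<lambda>p h. p x * f h)"

lemma lin_bt: "lf p \<Longrightarrow> lin H X (bt p)" "lin (dual H) X (\<lambda>p. bt p h)"
  using bilin_tpure[of "dual H" H] by (simp_all add: bilin_def)

lemma bt_in: "lf p \<Longrightarrow> bt p h \<in> vset X"
  by (simp add: tpure_in_tensor)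

lemma bilin_tst: "lf f \<Longrightarrow> bilin (dual H) H base_field (tst x f)"
  by (rule bilin_product[OF lin_dual_eval])

lemma bt_tst [simp]: "lf f \<Longrightarrow> bt p h (tst x f) = p x * f h"
  by (simp add: tpure_apply[OF bilin_tst])

lemma bilin_tst2: "bilin X X base_field (\<lambda>s r. s (tst x f) * r (tst y g))"
  by (rule bilin_product[OF lin_eval lin_eval])

lemmas frame_X = frame_tensor[OF vspace_dual vspace_H frame_dual frame_H]
lemmas frame_XX = frame_tensor[OF vspace_tensor vspace_tensor frame_X frame_X]
lemmas frame_XXX = frame_tensor[OF vspace_tensor vspace_tensor frame_X frame_XX]

lemma eq_X:
  assumes "s \<in> vset X" "t \<in> vset X" "\<And>x f. lf f \<Longrightarrow> s (tst x f) = t (tst x f)"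
  shows "s = t"
  by (rule frame_eqI[OF frame_X assms(1,2)]) (auto simp: assms(3) lf_db)

lemma eq_XX:
  assumes "s \<in> vset XX" "t \<in> vset XX"
    "\<And>x f y g. lf f \<Longrightarrow> lf g \<Longrightarrow>
      s (\<lambda>a b. a (tst x f) * b (tst y g)) = t (\<lambda>a b. a (tst x f) * b (tst y g))"
  shows "s = t"
  by (rule frame_eqI[OF frame_XX assms(1,2)]) (auto simp: assms(3) lf_db)

lemma eq_XXX:
  assumes "s \<in> vset (tensor X XX)" "t \<in> vset (tensor X XX)"
    "\<And>x f y g z k. lf f \<Longrightarrow> lf g \<Longrightarrow> lf k \<Longrightarrow>
      s (\<lambda>a w. a (tst x f) * w (\<lambda>b c. b (tst y g) * c (tst z k))) =
      t (\<lambda>a w. a (tst x f) * w (\<lambda>b c. b (tst y g) * c (tst z k)))"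
  shows "s = t"
  by (rule frame_eqI[OF frame_XXX assms(1,2)]) (auto simp: assms(3) lf_db)

lemma lin_X_eqI:
  assumes "lin X U L" "lin X U L'" "\<And>p h. lf p \<Longrightarrow> L (bt p h) = L' (bt p h)" "t \<in> vset X"
  shows "L t = L' t"
  by (rule tensor_lin_unique[OF assms(1,2) _ assms(4)]) (simp add: assms(3))

lemma lin_tensor_X_eqI:
  assumes "lin (tensor V X) U L" "lin (tensor V X) U L'"
    "\<And>s p h. s \<in> vset V \<Longrightarrow> lf p \<Longrightarrow> L (tpure V X s (bt p h)) = L' (tpure V X s (bt p h))"
    "t \<in> vset (tensor V X)"
  shows "L t = L' t"
proof (rule tensor_lin_unique[OF assms(1,2) _ assms(4)])
  fix s r assume s: "s \<in> vset V" and r: "r \<in> vset X"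
  show "L (tpure V X s r) = L' (tpure V X s r)"
    by (rule lin_X_eqI[OF lin_comp[OF bilin_right[OF bilin_tpure s] assms(1)]
          lin_comp[OF bilin_right[OF bilin_tpure s] assms(2)] _ r]) (simp add: assms(3) s)
qed

lemma lin_XX_eqI:
  assumes L: "lin XX U L" "lin XX U L'" and e: "\<And>p h q h'. lf p \<Longrightarrow> lf q \<Longrightarrow>
      L (tpure X X (bt p h) (bt q h')) = L' (tpure X X (bt p h) (bt q h'))" and t: "t \<in> vset XX"
  shows "L t = L' t"
proof (rule lin_tensor_X_eqI[OF L _ t])
  fix s q h' assume s: "s \<in> vset X" and q: "lf q"
  show "L (tpure X X s (bt q h')) = L' (tpure X X s (bt q h'))"
    by (rule lin_X_eqI[OF lin_comp[OF bilin_left[OF bilin_tpure bt_in[OF q]] L(1)]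
          lin_comp[OF bilin_left[OF bilin_tpure bt_in[OF q]] L(2)] _ s]) (simp add: e q)
qed

lemma lin_XX_X_eqI:
  assumes L: "lin (tensor XX X) U L" "lin (tensor XX X) U L'"
    and e: "\<And>p h q h' r h''. lf p \<Longrightarrow> lf q \<Longrightarrow> lf r \<Longrightarrow>
      L (tpure XX X (tpure X X (bt p h) (bt q h')) (bt r h'')) =
      L' (tpure XX X (tpure X X (bt p h) (bt q h')) (bt r h''))"
    and t: "t \<in> vset (tensor XX X)"
  shows "L t = L' t"
proof (rule lin_tensor_X_eqI[OF L _ t])
  fix s q h' assume s: "s \<in> vset XX" and q: "lf q"
  show "L (tpure XX X s (bt q h')) = L' (tpure XX X s (bt q h'))"
    by (rule lin_XX_eqI[OF lin_comp[OF bilin_left[OF bilin_tpure bt_in[OF q]] L(1)]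
          lin_comp[OF bilin_left[OF bilin_tpure bt_in[OF q]] L(2)] _ s]) (simp add: e q)
qed


subsection \<open>The multiplication\<close>

lemma
  assumes a: "le \<alpha>" and d: "le \<delta>" "le (inv_into UNIV \<delta>)"
  shows lin_CT_mult: "lin XX X (CT_mult H (\<alpha>, \<beta>) (\<gamma>, \<delta>))"
    and CT_mult_bt: "lf p \<Longrightarrow> lf q \<Longrightarrow>
      CT_mult H (\<alpha>, \<beta>) (\<gamma>, \<delta>) (tpure X X (bt p h) (bt q h')) =
      bt (conv H q p) (\<delta> h * \<delta> (\<alpha> (inv_into UNIV \<delta> h')))"
proof -
  let ?F = "\<lambda>p h q h'. bt (conv H q p) (\<delta> h * \<delta> (\<alpha> (inv_into UNIV \<delta> h')))"
  note r = rules le_comp[OF a] le_comp[OF d(1)] le_comp[OF d(2)] a d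
  have 1: "bilin (dual H) H X (?F p h)" if "lf p" for p h
    by (rule bilin_comp2[OF bilin_tpure]) (simp_all add: lin_conv that r)
  have inner: "bilin (dual H) H X (\<lambda>p h. ?F p h q h')" if "lf q" for q h'
    by (rule bilin_comp2[OF bilin_tpure]) (simp_all add: lin_conv that r)
  have 2: "bilin (dual H) H X (\<lambda>p h. tlift (dual H) H X (?F p h) t)" if t: "t \<in> vset X" for t
    by (intro bilinI lin_tlift_param[OF vspace_tensor _ _ _ t])
      (simp_all add: vspace_H vspace_dual 1 bilin_right[OF inner, simplified]
         bilin_left[OF inner, simplified] bilin_right[OF 1, simplified] bilin_left[OF 1, simplified])
  have 3: "bilin X X X (\<lambda>s t. tlift (dual H) H X (\<lambda>p h. tlift (dual H) H X (?F p h) t) s)"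
    by (rule bilin_tlift_outer(2)[OF vspace_tensor vspace_dual vspace_H vspace_tensor 2])
       (auto intro!: tlift_universal(1)[OF vspace_tensor 1])
  show "lin XX X (CT_mult H (\<alpha>, \<beta>) (\<gamma>, \<delta>))"
    unfolding CT_mult_def Let_def split by (rule tlift_universal(1)[OF vspace_tensor 3])
  show "CT_mult H (\<alpha>, \<beta>) (\<gamma>, \<delta>) (tpure X X (bt p h) (bt q h')) = ?F p h q h'" if "lf p" "lf q"
    unfolding CT_mult_def Let_def split using that
    by (simp add: tlift_universal(2)[OF vspace_tensor 3] tlift_universal(2)[OF vspace_tensor 2]
        tlift_universal(2)[OF vspace_tensor 1] bt_in)
qed

lemma lin_CT_mult_eval: "le \<alpha> \<Longrightarrow> le \<delta> \<Longrightarrow> le (inv_into UNIV \<delta>) \<Longrightarrow>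
    lin XX base_field (\<lambda>t. CT_mult H (\<alpha>, \<beta>) (\<gamma>, \<delta>) t \<psi>)"
  by (rule lin_comp[OF lin_CT_mult lin_eval])


subsection \<open>The comultiplication\<close>

definition sw3 :: "('h \<Rightarrow> 'h \<Rightarrow> 'h \<Rightarrow> 'k) \<Rightarrow> 'h \<Rightarrow> 'k" where
  "sw3 F = sw (\<lambda>a. sw (F a))"

text \<open>Unapplied forms of the laws for \<open>sw\<close>. In a nest the inner \<open>sw\<close>
  is a function still waiting for its argument, and only such equations let the simplifier rewrite
  it there.\<close>

lemma sw_swap_fun:
  "sw (\<lambda>a b. sw (F a b) y) = (\<lambda>x. sw (\<lambda>c d. sw (\<lambda>a b. F a b c d) x) y)"
  by (rule ext) (rule sw_swap)

lemma sw_mult_left_fun: "sw (\<lambda>a b. c * F a b) = (\<lambda>x. c * sw F x)"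
  and sw_mult_right_fun: "sw (\<lambda>a b. F a b * c) = (\<lambda>x. sw F x * c)"
  and sw_sum_fun: "sw (\<lambda>a b. \<Sum>i\<in>I. G i a b) = (\<lambda>x. \<Sum>i\<in>I. sw (G i) x)"
  by (simp_all add: fun_eq_iff sw_mult_left sw_mult_right sw_sum)

lemma sw_assoc_fun: "sw (\<lambda>a b. sw (\<lambda>c d. F c d b) a) = sw (\<lambda>a. sw (F a))"
  by (rule ext) (rule sw_assoc)

lemma sw3_mult_left: "sw3 (\<lambda>a b d. c * F a b d) x = c * sw3 F x"
  and sw3_mult_right: "sw3 (\<lambda>a b d. F a b d * c) x = sw3 F x * c"
  and sw3_sum: "sw3 (\<lambda>a b c. \<Sum>i\<in>I. G i a b c) x = (\<Sum>i\<in>I. sw3 (G i) x)"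
  by (simp_all add: sw3_def sw_mult_left_fun sw_mult_right_fun sw_sum_fun)

lemma sw3_sw_swap:
  "sw3 (\<lambda>a b c. sw (\<lambda>d e. F a b c d e) y) x = sw (\<lambda>d e. sw3 (\<lambda>a b c. F a b c d e) x) y"
  unfolding sw3_def by (simp only: sw_swap_fun[where y = y])

lemma sw3_swap:
  "sw3 (\<lambda>a b c. sw3 (\<lambda>d e f. F a b c d e f) y) x
    = sw3 (\<lambda>d e f. sw3 (\<lambda>a b c. F a b c d e f) x) y"
proof -
  have "sw3 (\<lambda>a b c. sw3 (\<lambda>d e f. F a b c d e f) y) x =
      sw (\<lambda>d r. sw3 (\<lambda>a b c. sw (\<lambda>e f. F a b c d e f) r) x) y"
    by (simp add: sw3_def[of "F _ _ _"] flip: sw3_sw_swap)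
  then show ?thesis
    by (simp add: sw3_sw_swap) (simp only: sw3_def[of "\<lambda>d e f. sw3 (\<lambda>a b c. F a b c d e f) x"])
qed

lemma lf_sw3: "lf (sw3 F)"
  by (simp add: sw3_def[abs_def] rules)

text \<open>The step by which a dual basis sum disappears: \<open>db d z\<close> is the coordinate
  of \<open>z\<close> at \<open>d\<close>, and \<open>sw3 F\<close> is linear.\<close>

lemma collapse: "(\<Sum>d\<in>B. db d z * sw3 F d) = sw3 F z"
  by (rule lf_expand[OF lf_sw3])

lemma conv_conv:
  assumes "lf p" "lf q" "lf r"
  shows "conv H (conv H p q) r = sw3 (\<lambda>a b c. p a * q b * r c)"
  using assms by (simp add: fun_eq_iff lf_conv rules sw3_def sw_mult_right[symmetric] sw_assoc)

lemma sum_sw: "(\<Sum>i\<in>I. sw (F i) x) = sw (\<lambda>a b. \<Sum>i\<in>I. F i a b) x"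
  by (rule sw_sum[symmetric])

lemma sum_sum_swap3:
  "(\<Sum>d\<in>D. \<Sum>a\<in>A. \<Sum>b\<in>A'. \<Sum>c\<in>A''. f d a b c) = (\<Sum>a\<in>A. \<Sum>b\<in>A'. \<Sum>c\<in>A''. \<Sum>d\<in>D. f d a b c)"
  by (simp only: sum.swap[where A = D])

lemma expand3:
  assumes "\<And>b c. lf (\<lambda>a. T a b c)" "\<And>a c. lf (\<lambda>b. T a b c)" "\<And>a b. lf (\<lambda>c. T a b c)"
  shows "(\<Sum>j\<in>B. \<Sum>i\<in>B. \<Sum>l\<in>B. db i a * db j b * db l c * T i j l) = T a b c"
proof -
  have "(\<Sum>j\<in>B. \<Sum>i\<in>B. \<Sum>l\<in>B. db i a * db j b * db l c * T i j l)
      = (\<Sum>j\<in>B. db j b * (\<Sum>i\<in>B. db i a * (\<Sum>l\<in>B. db l c * T i j l)))"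
    by (simp add: sum_distrib_left mult_ac)
  then show ?thesis
    using lf_expand[OF assms(1)] lf_expand[OF assms(2)] lf_expand[OF assms(3)] by simp
qed

lemma lin_shift: "lf p \<Longrightarrow> lin H (dual H) (\<lambda>b x. p (x * b))"
  by (rule linI) (auto simp: lf_iff algebra_simps scale_mult_left[symmetric] scale_mult_right[symmetric])

context
  fixes \<alpha> \<beta> :: "'h \<Rightarrow> 'h"
  assumes le: "le \<alpha>" "le \<beta>"
begin

private abbreviation (input) "G \<equiv> \<lambda>p1 p2 h1 h2. \<Sum>i\<in>B. \<Sum>j\<in>B.
  tpure X X (bt p1 (\<beta> j * h1 * Si (\<alpha> i))) (bt (conv H (conv H (db i) p2) (db j)) h2)"

private lemma r: "le \<alpha>" "le \<beta>" "le g \<Longrightarrow> le (\<lambda>x. \<alpha> (g x))" "le g \<Longrightarrow> le (\<lambda>x. \<beta> (g x))"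
  "le Si" "le g \<Longrightarrow> le (\<lambda>x. Si (g x))"
  by (auto intro: le_comp le le_Si)

private lemma G1: "lf p1 \<Longrightarrow> lf p2 \<Longrightarrow> bilin H H XX (G p1 p2)"
  by (intro bilin_sum_maps vspace_tensor bilin_tpure_right lin_comp[OF _ lin_bt(1)] conv_in lf_db)
     (simp_all add: rules)

private lemma G2: "bilin (dual H) (dual H) XX (\<lambda>p1 p2. G p1 p2 h1 h2)"
  by (intro bilin_sum_maps vspace_tensor bilin_tpure_right lin_bt lin_comp[OF lin_conv(1) lin_comp[OF lin_conv(2)]] lf_db)

private lemma T2: "t \<in> vset (tensor H H) \<Longrightarrow>
    bilin (dual H) (dual H) XX (\<lambda>p1 p2. tlift H H XX (G p1 p2) t)"
  by (intro bilinI lin_tlift_param[OF vspace_tensor vspace_dual])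
     (simp_all add: G1 bilin_right[OF G2, simplified] bilin_left[OF G2, simplified]
       bilin_right[OF G1, simplified] bilin_left[OF G1, simplified])

private lemma T3: "bilin (dual H) H XX
    (\<lambda>p h. tlift (dual H) (dual H) XX (\<lambda>p1 p2. tlift H H XX (G p1 p2) (comul H h)) (dual_comul H p))"
  by (intro bilinI lin_tlift_param[OF vspace_tensor vspace_H]
        lin_comp[OF lin_dual_comul tlift_universal(1)[OF vspace_tensor]] T2 comul_in
        lin_comp[OF lin_comul tlift_universal(1)[OF vspace_tensor]] G1)
     (simp_all add: dual_comul_in)

lemma lin_CT_comul: "lin X XX (comul (CT H S B (\<alpha>, \<beta>)))"
  unfolding CT_def split Let_def coalg.simps by (rule tlift_universal(1)[OF vspace_tensor T3])

text \<open>The sums over the dual bases are carried out, and the second tensor factor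
  is expanded in the dual basis instead.\<close>

theorem CT_comul_apply:
  assumes p: "lf p" and \<Phi>: "bilin X X base_field \<Phi>"
  shows "comul (CT H S B (\<alpha>, \<beta>)) (bt p h) \<Phi> = (\<Sum>d\<in>B. sw3 (\<lambda>d1 d2 d3. sw (\<lambda>h1 h2.
    \<Phi> (bt (\<lambda>x. p (x * d2)) (\<beta> d3 * h1 * Si (\<alpha> d1))) (bt (db d) h2)) h) d)"
proof -
  let ?T = "\<lambda>p1 p2. tlift H H XX (G p1 p2) (comul H h)"
  let ?W = "\<lambda>d h1 h2 i c j. \<Phi> (bt (\<lambda>x. p (x * c)) (\<beta> j * h1 * Si (\<alpha> i))) (bt (db d) h2)"
  note V = vspace_tensor
  have lin_\<Phi>: "lin X base_field (\<lambda>s. \<Phi> s (bt q u))" if "lf q" for q u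
    by (rule bilin_left[OF \<Phi> bt_in[OF that]])
  have W_lf: "lf (\<lambda>i. ?W d h1 h2 i c j)" "lf (\<lambda>j. ?W d h1 h2 i c j)" "lf (\<lambda>c. ?W d h1 h2 i c j)"
    for d h1 h2 i c j
  proof -
    show "lf (\<lambda>i. ?W d h1 h2 i c j)" "lf (\<lambda>j. ?W d h1 h2 i c j)"
      by (rule lin_comp[OF _ lin_comp[OF lin_bt(1) lin_\<Phi>]]; simp add: rules r p lf_shift lf_db)+
    show "lf (\<lambda>c. ?W d h1 h2 i c j)"
      by (rule lin_comp[OF lin_shift[OF p] lin_comp[OF lin_bt(2) lin_\<Phi>]]) (simp add: lf_db)
  qed
  have conv3: "conv H (conv H (db i) (db c)) (db j) = sw3 (\<lambda>a b e. db i a * db c b * db j e)" for i c j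
    by (simp only: conv_conv lf_db)
  \<comment> \<open>The coordinate of a convolution product along \<open>db d\<close> is its value
    at \<open>d\<close>. This moves the three dual basis elements onto the legs of
    \<open>d\<close>.\<close>
  have \<Phi>_expand: "\<Phi> (bt (\<lambda>x. p (x * c)) u) (bt (conv H (conv H (db i) (db c)) (db j)) v) =
      (\<Sum>d\<in>B. sw3 (\<lambda>a b e. db i a * db c b * db j e) d * \<Phi> (bt (\<lambda>x. p (x * c)) u) (bt (db d) v))"
    for c u i j v
    unfolding conv3
    by (rule frame_apply[OF vspace_dual frame_dual lin_comp[OF lin_bt(2)
          bilin_right[OF \<Phi> bt_in[OF lf_shift[OF p]]]], symmetric]) (simp add: lf_sw3)
  have "comul (CT H S B (\<alpha>, \<beta>)) (bt p h) \<Phi> = tlift (dual H) (dual H) XX ?T (dual_comul H p) \<Phi>"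
    unfolding CT_def split Let_def coalg.simps
    using p by (simp add: tlift_universal(2)[OF V T3])
  also have "\<dots> = dual_comul H p (\<lambda>p1 p2. ?T p1 p2 \<Phi>)"
    by (rule tlift_tensor[OF T2[OF comul_in] dual_comul_in[OF p]])
  also have "\<dots> = (\<Sum>c\<in>B. ?T (\<lambda>x. p (x * c)) (db c) \<Phi>)"
    by (rule dual_comul_apply[OF p bilin_comp[OF T2[OF comul_in] lin_eval]])
  also have "\<dots> = (\<Sum>c\<in>B. sw (\<lambda>h1 h2. G (\<lambda>x. p (x * c)) (db c) h1 h2 \<Phi>) h)"
  proof (rule sum.cong[OF refl])
    fix c
    have G: "bilin H H XX (G (\<lambda>x. p (x * c)) (db c))" by (rule G1[OF lf_shift[OF p] lf_db])
    show "?T (\<lambda>x. p (x * c)) (db c) \<Phi> = sw (\<lambda>h1 h2. G (\<lambda>x. p (x * c)) (db c) h1 h2 \<Phi>) h"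
      by (simp only: tlift_tensor[OF G comul_in] comul_apply[OF bilin_comp[OF G lin_eval]])
  qed
  also have "\<dots> = (\<Sum>c\<in>B. sw (\<lambda>h1 h2. \<Sum>i\<in>B. \<Sum>j\<in>B. \<Sum>d\<in>B.
      sw3 (\<lambda>a b e. db i a * db c b * db j e) d * ?W d h1 h2 i c j) h)"
    by (simp only: sum_apply tpure_apply[OF \<Phi>] \<Phi>_expand)
  also have "\<dots> = (\<Sum>d\<in>B. \<Sum>c\<in>B. \<Sum>i\<in>B. \<Sum>j\<in>B.
      sw3 (\<lambda>a b e. db i a * db c b * db j e) d * sw (\<lambda>h1 h2. ?W d h1 h2 i c j) h)"
    by (subst sum_sum_swap3) (simp only: sw_sum sw_mult_left)
  also have "\<dots> = (\<Sum>d\<in>B. sw3 (\<lambda>a b e. \<Sum>c\<in>B. \<Sum>i\<in>B. \<Sum>j\<in>B.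
      db i a * db c b * db j e * sw (\<lambda>h1 h2. ?W d h1 h2 i c j) h) d)"
    by (simp only: sw3_sum sw3_mult_right)
  \<comment> \<open>The sums over \<open>i\<close>, \<open>c\<close> and \<open>j\<close> are now
    the coordinate expansions of the legs \<open>a\<close>, \<open>b\<close> and \<open>e\<close> of
    \<open>d\<close>.\<close>
  also have "\<dots> = (\<Sum>d\<in>B. sw3 (\<lambda>a b e. sw (\<lambda>h1 h2. ?W d h1 h2 a b e) h) d)"
    by (subst expand3) (rule lf_rules(3) W_lf refl)+
  finally show ?thesis .
qed

text \<open>This is the overview's formula for \<open>\<Delta>(u)(x, y)\<close> on generators:
  testing the second factor at \<open>y\<close> produces \<open>db d y\<close>, and
  \<open>collapse\<close> replaces \<open>d\<close> by \<open>y\<close>.\<close>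

lemma CT_comul_tst:
  assumes p: "lf p" and f: "lf f" and g: "lf g"
  shows "comul (CT H S B (\<alpha>, \<beta>)) (bt p h) (\<lambda>s r. s (tst x f) * r (tst y g)) =
    sw (\<lambda>h1 h2. sw (\<lambda>y1 r. sw (\<lambda>y2 y3. p (x * y2) * (f (\<beta> y3 * (h1 * Si (\<alpha> y1))) * g h2)) r) y) h"
proof -
  have "comul (CT H S B (\<alpha>, \<beta>)) (bt p h) (\<lambda>s r. s (tst x f) * r (tst y g)) =
    (\<Sum>d\<in>B. sw3 (\<lambda>d1 d2 d3. sw (\<lambda>h1 h2. db d y *
      (p (x * d2) * (f (\<beta> d3 * (h1 * Si (\<alpha> d1))) * g h2))) h) d)"
    by (simp add: CT_comul_apply p bilin_tst2 f g mult_ac)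
  also have "\<dots> = sw (\<lambda>h1 h2. sw3 (\<lambda>y1 y2 y3. p (x * y2) * (f (\<beta> y3 * (h1 * Si (\<alpha> y1))) * g h2)) y) h"
    by (simp only: sw3_sw_swap sw3_mult_left sum_sw collapse)
  finally show ?thesis by (simp only: sw3_def)
qed

end


subsection \<open>Counit, unit and antipode\<close>

lemma CT_counit:
  "t \<in> vset X \<Longrightarrow> counit (CT H S B a) t = t (tst 1 eps)"
  by (cases a) (simp add: CT_def Let_def tlift_base_field bilin_tst lf_eps)

lemma CT_counit_bt: "lf p \<Longrightarrow> counit (CT H S B a) (bt p h) = p 1 * eps h"
  by (simp add: CT_counit bt_in lf_eps)

lemma lin_CT_counit: "lin X base_field (counit (CT H S B a))"
  by (rule lin_cong[OF vspace_tensor lin_eval]) (rule CT_counit)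

lemma lin_CT_unit: "lin base_field X (CT_unit H)"
proof (rule linI)
  have "bt eps 1 \<in> vset X" by (rule bt_in[OF lf_eps])
  then show "CT_unit H c \<in> vset X" for c
    using vspace_scale[OF vspace_tensor[of "dual H" H]] by (simp add: CT_unit_def)
qed (auto simp: CT_unit_def algebra_simps)

context
  fixes \<alpha> \<beta> :: "'h \<Rightarrow> 'h"
  assumes aut: "hopf_automorphism H \<alpha>" "hopf_automorphism H \<beta>"
begin

private abbreviation (input) "\<alpha>' \<equiv> inv_into UNIV \<alpha>"
private abbreviation (input) "\<beta>' \<equiv> inv_into UNIV \<beta>"
private abbreviation (input) "A \<equiv> \<lambda>p h. \<Sum>i\<in>B. \<Sum>j\<in>B. bt
  (conv H (conv H (db i) (p \<circ> Si)) (db j \<circ> Si)) (\<beta>' j * \<beta>' (\<alpha>' (S h)) * \<beta>' (\<alpha>' (\<beta> i)))"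

private lemma auts: "hopf_automorphism H \<alpha>'" "hopf_automorphism H \<beta>'"
  using aut by (simp_all add: aut_inv)

private lemmas antipode_rules = rules aut_le[OF auts(1)] aut_le[OF auts(2)] aut_le[OF aut(1)] aut_le[OF aut(2)]
  aut_le_comp[OF auts(1)] aut_le_comp[OF auts(2)] aut_le_comp[OF aut(1)] aut_le_comp[OF aut(2)]
  le_Si le_Si_comp

private lemma lf_Si: "lf p \<Longrightarrow> lf (p \<circ> Si)"
  using lf_comp[OF _ le_Si, of p] by (simp add: o_def)

private lemma bilin_A: "bilin (dual H) H X A"
proof -
  have "lin (dual H) (dual H) (\<lambda>p. p \<circ> Si)"
    by (rule linI) (auto simp: lf_Si)
  from lin_comp[OF lin_comp[OF this lin_conv(1)[OF lf_db]] lin_conv(2)[OF lf_Si[OF lf_db]]]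
  show ?thesis
    by (intro bilin_sum_maps vspace_tensor bilin_comp2[OF bilin_tpure]) (simp_all add: antipode_rules)
qed

lemma lin_CT_antipode: "lin X X (CT_antipode H S B (\<alpha>, \<beta>))"
  unfolding CT_antipode_def split Let_def by (rule tlift_universal(1)[OF vspace_tensor bilin_A])

text \<open>On maps \<open>u\<close> the antipode is the map taking \<open>w\<close> to the product
  of \<open>\<beta>' (Si w3)\<close>, \<open>\<beta>' (\<alpha>' (S (u (Si w2))))\<close> and
  \<open>\<beta>' (\<alpha>' (\<beta> w1))\<close>. The two dual basis sums are the coordinate
  expansions of \<open>w1\<close> and \<open>Si w3\<close>.\<close>

lemma CT_antipode_tst:
  assumes p: "lf p" and g: "lf g"
  shows "CT_antipode H S B (\<alpha>, \<beta>) (bt p h) (tst w g) =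
    sw (\<lambda>w1 r. sw (\<lambda>w2 w3. p (Si w2) *
      g (\<beta>' (Si w3) * (\<beta>' (\<alpha>' (S h)) * \<beta>' (\<alpha>' (\<beta> w1))))) r) w"
proof -
  have "CT_antipode H S B (\<alpha>, \<beta>) (bt p h) (tst w g) = A p h (tst w g)"
    unfolding CT_antipode_def split Let_def
    using p by (simp add: tlift_universal(2)[OF vspace_tensor bilin_A])
  also have "\<dots> = (\<Sum>i\<in>B. \<Sum>j\<in>B. sw3 (\<lambda>w1 w2 w3. db i w1 * p (Si w2) * db j (Si w3)) w *
      g (\<beta>' j * (\<beta>' (\<alpha>' (S h)) * \<beta>' (\<alpha>' (\<beta> i)))))"
    by (simp add: sum_apply g conv_conv lf_Si p lf_db mult.assoc[where 'a = 'h])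
  also have "\<dots> = sw3 (\<lambda>w1 w2 w3. \<Sum>i\<in>B. \<Sum>j\<in>B. db i w1 * p (Si w2) * db j (Si w3) *
      g (\<beta>' j * (\<beta>' (\<alpha>' (S h)) * \<beta>' (\<alpha>' (\<beta> i))))) w"
    by (simp only: sw3_sum sw3_mult_right)
  also have "\<dots> = sw3 (\<lambda>w1 w2 w3. p (Si w2) * (\<Sum>i\<in>B. db i w1 * (\<Sum>j\<in>B. db j (Si w3) *
      g (\<beta>' j * (\<beta>' (\<alpha>' (S h)) * \<beta>' (\<alpha>' (\<beta> i))))))) w"
    by (simp add: sum_distrib_left mult_ac)
  also have "\<dots> = sw3 (\<lambda>w1 w2 w3. p (Si w2) *
      g (\<beta>' (Si w3) * (\<beta>' (\<alpha>' (S h)) * \<beta>' (\<alpha>' (\<beta> w1))))) w"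
    by (simp add: lf_expand[where f = "\<lambda>j. g (\<beta>' j * _)"] lf_expand[where f = "\<lambda>i. g (_ * (_ * \<beta>' (\<alpha>' (\<beta> i))))"]
        antipode_rules lf_comp[OF g])
  finally show ?thesis by (simp only: sw3_def)
qed

end


section \<open>Coassociativity and the counit laws on generators\<close>

lemma sw3_mult:
  assumes F: "\<And>b c. lf (\<lambda>a. F a b c)" "\<And>a c. lf (\<lambda>b. F a b c)" "\<And>a b. lf (\<lambda>c. F a b c)"
  shows "sw3 F (x * y) = sw3 (\<lambda>b1 b2 b3. sw3 (\<lambda>a1 a2 a3. F (a1 * b1) (a2 * b2) (a3 * b3)) x) y"
proof -
  have F': "le g \<Longrightarrow> lf (\<lambda>a. F (g a) b c)" "le g \<Longrightarrow> lf (\<lambda>b. F a (g b) c)"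
    "le g \<Longrightarrow> lf (\<lambda>c. F a b (g c))" for g a b c
    by (auto intro: lf_comp[OF F(1)] lf_comp[OF F(2)] lf_comp[OF F(3)])
  have "sw3 F (x * y) = sw (\<lambda>a1 r. sw (\<lambda>b1 s. sw (\<lambda>a2 a3. sw (\<lambda>b2 b3.
      F (a1 * b1) (a2 * b2) (a3 * b3)) s) r) y) x"
    by (simp add: sw3_def sw_mult rules F F')
  also have "\<dots> = sw (\<lambda>b1 s. sw3 (\<lambda>a1 a2 a3. sw (\<lambda>b2 b3. F (a1 * b1) (a2 * b2) (a3 * b3)) s) x) y"
    by (subst sw_swap) (simp only: sw3_def)
  also have "\<dots> = sw3 (\<lambda>b1 b2 b3. sw3 (\<lambda>a1 a2 a3. F (a1 * b1) (a2 * b2) (a3 * b3)) x) y"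
    by (simp only: sw3_sw_swap) (simp only: sw3_def[of "\<lambda>b1 b2 b3. sw3 (\<lambda>a1 a2 a3. F (a1 * b1) (a2 * b2) (a3 * b3)) x"])
  finally show ?thesis .
qed

text \<open>The inverse antipode reverses legs, which is why \<open>a2\<close> enters the first
  factor and \<open>a1\<close> the second. The element is the one that the coproduct of
  \<open>CT\<close> places in its first factor.\<close>

lemma sw_twisted:
  assumes F: "bl F" and aut: "hopf_automorphism H \<alpha>" "hopf_automorphism H \<beta>"
  shows "sw F (\<beta> b * (h * Si (\<alpha> a))) = sw (\<lambda>h1 h2. sw (\<lambda>b1 b2. sw (\<lambda>a1 a2.
    F (\<beta> b1 * (h1 * Si (\<alpha> a2))) (\<beta> b2 * (h2 * Si (\<alpha> a1)))) a) b) h"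
proof -
  note r = rules bl_lf[OF F] le_Si le_Si_comp aut_le[OF aut(1)] aut_le[OF aut(2)]
    aut_le_comp[OF aut(1)] aut_le_comp[OF aut(2)]
  have "sw F (\<beta> b * (h * Si (\<alpha> a))) = sw (\<lambda>b1 b2. sw (\<lambda>h1 h2. sw (\<lambda>a1 a2.
    F (\<beta> b1 * (h1 * Si (\<alpha> a2))) (\<beta> b2 * (h2 * Si (\<alpha> a1)))) a) h) b"
    by (simp add: sw_mult sw_Si aut_sw[OF aut(1)] aut_sw[OF aut(2)] r)
  then show ?thesis by (subst sw_swap)
qed

text \<open>Splitting the first and last of three legs leaves five consecutive ones,
  \<open>a1, a2, z2, c1, c2\<close>: the shape in which the two sides of coassociativity are
  compared.\<close>

lemma sw3_sw_sw:
  "sw3 (\<lambda>z1 z2 z3. sw (\<lambda>c1 c2. sw (\<lambda>a1 a2. F a1 a2 z2 c1 c2) z1) z3)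
    = sw (\<lambda>a1. sw (\<lambda>a2. sw (\<lambda>z2. sw (F a1 a2 z2))))"
proof -
  have "sw (\<lambda>z2 z3. sw (\<lambda>c1 c2. sw (\<lambda>a1 a2. F a1 a2 z2 c1 c2) z1) z3) =
      (\<lambda>r. sw (\<lambda>a1 a2. sw (\<lambda>z2 z3. sw (F a1 a2 z2) z3) r) z1)" for z1
    by (simp only: sw_swap_fun[where y = z1])
  then show ?thesis by (simp only: sw3_def sw_assoc_fun)
qed

context
  fixes \<alpha> \<beta> :: "'h \<Rightarrow> 'h"
  assumes aut: "hopf_automorphism H \<alpha>" "hopf_automorphism H \<beta>"
begin

private lemmas comul_rules = rules le_Si le_Si_comp aut_le[OF aut(1)] aut_le[OF aut(2)]
  aut_le_comp[OF aut(1)] aut_le_comp[OF aut(2)]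

private abbreviation (input) "\<Delta> \<equiv> comul (CT H S B (\<alpha>, \<beta>))"

private lemmas lin_\<Delta> = lin_CT_comul[OF aut_le[OF aut(1)] aut_le[OF aut(2)]]
private lemmas \<Delta>_apply = CT_comul_apply[OF aut_le[OF aut(1)] aut_le[OF aut(2)]]
private lemmas \<Delta>_tst = CT_comul_tst[OF aut_le[OF aut(1)] aut_le[OF aut(2)]]

text \<open>Both sides reduce to \<open>?E\<close> over three legs of \<open>h\<close>, three of
  \<open>y\<close> and five of \<open>z\<close>. On the left the two extra legs of \<open>z\<close>
  come from the coproduct of the twisted element, on the right from that of a product
  \<open>y * z2\<close>.\<close>

lemma CT_coassoc_bt:
  assumes p: "lf p" and f: "lf f" and g: "lf g" and k: "lf k"
  shows "\<Delta> (bt p h) (\<lambda>s r. \<Delta> s (\<lambda>u v. u (tst x f) * v (tst y g)) * r (tst z k)) =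
    \<Delta> (bt p h) (\<lambda>s r. s (tst x f) * \<Delta> r (\<lambda>u v. u (tst y g) * v (tst z k)))"
proof -
  note rr = comul_rules lf_comp[OF p] lf_comp[OF f] lf_comp[OF g] lf_comp[OF k] p f g k
  let ?E = "\<lambda>h1 h2 h3 a1 a2 z2 c1 c2 y1 y2 y3. p (x * (y2 * z2)) *
    (f (\<beta> y3 * (\<beta> c1 * (h1 * (Si (\<alpha> a2) * Si (\<alpha> y1))))) * (g (\<beta> c2 * (h2 * Si (\<alpha> a1))) * k h3))"
  have "\<Delta> (bt p h) (\<lambda>s r. \<Delta> s (\<lambda>u v. u (tst x f) * v (tst y g)) * r (tst z k)) =
    (\<Sum>d\<in>B. sw3 (\<lambda>d1 d2 d3. sw (\<lambda>h1 h2. db d z * (sw (\<lambda>u1 u2. sw (\<lambda>y1 r. sw (\<lambda>y2 y3.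
      p (x * (y2 * d2)) * (f (\<beta> y3 * (u1 * Si (\<alpha> y1))) * g u2)) r) y)
      (\<beta> d3 * (h1 * Si (\<alpha> d1))) * k h2)) h) d)"
    by (simp add: \<Delta>_apply[OF p bilin_product[OF lin_comp[OF lin_\<Delta> lin_eval] lin_eval]]
        \<Delta>_tst lf_shift p f g k mult.assoc mult.left_commute[of _ "db _ _"])
  also have "\<dots> = sw (\<lambda>h1 h2. sw3 (\<lambda>z1 z2 z3. sw (\<lambda>u1 u2. sw (\<lambda>y1 r. sw (\<lambda>y2 y3.
      p (x * (y2 * z2)) * (f (\<beta> y3 * (u1 * Si (\<alpha> y1))) * g u2)) r) y)
      (\<beta> z3 * (h1 * Si (\<alpha> z1))) * k h2) z) h"
    by (simp only: sw3_sw_swap sw3_mult_left sum_sw collapse)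
  also have "\<dots> = sw (\<lambda>h1 h2. sw3 (\<lambda>z1 z2 z3. sw (\<lambda>e1 e2. sw (\<lambda>c1 c2. sw (\<lambda>a1 a2.
      sw (\<lambda>y1 r. sw (\<lambda>y2 y3. ?E e1 e2 h2 a1 a2 z2 c1 c2 y1 y2 y3) r) y) z1) z3) h1) z) h"
    by (simp add: sw_twisted[OF _ aut] rr mult.assoc flip: sw_mult_right)
  also have "\<dots> = sw (\<lambda>h1. sw (\<lambda>h2 h3. sw (\<lambda>a1. sw (\<lambda>a2. sw (\<lambda>z2. sw (\<lambda>c1 c2.
      sw (\<lambda>y1. sw (\<lambda>y2 y3. ?E h1 h2 h3 a1 a2 z2 c1 c2 y1 y2 y3)) y)))) z)) h"
    by (simp only: sw3_sw_swap sw3_sw_sw sw_assoc_fun)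
  finally have left: "\<Delta> (bt p h) (\<lambda>s r. \<Delta> s (\<lambda>u v. u (tst x f) * v (tst y g)) * r (tst z k)) = \<dots>" .
  have "\<Delta> (bt p h) (\<lambda>s r. s (tst x f) * \<Delta> r (\<lambda>u v. u (tst y g) * v (tst z k))) =
    (\<Sum>d\<in>B. sw3 (\<lambda>d1 d2 d3. sw (\<lambda>h1 h2. p (x * d2) * (f (\<beta> d3 * (h1 * Si (\<alpha> d1))) *
      sw (\<lambda>e1 e2. sw (\<lambda>z1 r. sw (\<lambda>z2 z3.
        db d (y * z2) * (g (\<beta> z3 * (e1 * Si (\<alpha> z1))) * k e2)) r) z) h2)) h) d)"
    by (simp add: \<Delta>_apply[OF p bilin_product[OF lin_eval lin_comp[OF lin_\<Delta> lin_eval]]]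
        \<Delta>_tst lf_shift lf_db p f g k mult.assoc)
  also have "\<dots> = (\<Sum>d\<in>B. sw3 (\<lambda>d1 d2 d3. sw (\<lambda>h1 h2. sw (\<lambda>e1 e2. sw (\<lambda>z1 r. sw (\<lambda>z2 z3.
      db d (y * z2) * (p (x * d2) * (f (\<beta> d3 * (h1 * Si (\<alpha> d1))) *
        (g (\<beta> z3 * (e1 * Si (\<alpha> z1))) * k e2)))) r) z) h2) h) d)"
    by (simp add: mult.left_commute[of _ "db _ _"] flip: sw_mult_left)
  \<comment> \<open>The second coproduct acts on \<open>db d\<close>, which is thereby evaluated at
    \<open>y * z2\<close>; so \<open>d\<close> collapses to that product.\<close>
  also have "\<dots> = sw (\<lambda>h1 h2. sw (\<lambda>e1 e2. sw (\<lambda>z1 r. sw (\<lambda>z2 z3. sw3 (\<lambda>d1 d2 d3.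
      p (x * d2) * (f (\<beta> d3 * (h1 * Si (\<alpha> d1))) *
        (g (\<beta> z3 * (e1 * Si (\<alpha> z1))) * k e2))) (y * z2)) r) z) h2) h"
    by (simp only: sw3_sw_swap sw3_mult_left sum_sw collapse)
  also have "\<dots> = sw (\<lambda>h1 h2. sw (\<lambda>e1 e2. sw (\<lambda>z1 r. sw (\<lambda>z2 z3. sw3 (\<lambda>b1 b2 b3.
      sw3 (\<lambda>a1 a2 a3. ?E h1 e1 e2 z1 b1 b2 b3 z3 a1 a2 a3) y) z2) r) z) h2) h"
    by (simp add: sw3_mult rr Si_mult aut_mult[OF aut(1)] aut_mult[OF aut(2)] mult.assoc)
  also have "\<dots> = sw (\<lambda>h1. sw (\<lambda>h2 h3. sw (\<lambda>a1. sw (\<lambda>a2. sw (\<lambda>z2. sw (\<lambda>c1 c2.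
      sw (\<lambda>y1. sw (\<lambda>y2 y3. ?E h1 h2 h3 a1 a2 z2 c1 c2 y1 y2 y3)) y)))) z)) h"
    by (simp only: sw3_def sw_assoc_fun)
  finally show ?thesis using left by simp
qed

text \<open>The test form \<open>eps\<close> is multiplicative and invariant under automorphisms and
  \<open>Si\<close>, so the twist contributes only counits on the outer legs of
  \<open>y\<close>.\<close>

lemma CT_counit_left_bt:
  assumes p: "lf p" and g: "lf g"
  shows "\<Delta> (bt p h) (\<lambda>s r. s (tst 1 eps) * r (tst y g)) = p y * g h"
proof -
  have "\<Delta> (bt p h) (\<lambda>s r. s (tst 1 eps) * r (tst y g)) = sw (\<lambda>h1 h2. sw (\<lambda>y1. sw (\<lambda>y2 y3.
      eps y1 * (eps y3 * p y2) * (eps h1 * g h2))) y) h"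
    unfolding \<Delta>_tst[OF p lf_eps g]
    by (simp add: counit_mult aut_eps[OF aut(1)] aut_eps[OF aut(2)] eps_Si mult_ac)
  also have "\<dots> = p y * g h"
    by (simp add: sw_mult_right_fun sw_mult_left_fun sw_mult_right sw_mult_left counit_left counit_right p g)
  finally show ?thesis .
qed

text \<open>Testing the second factor at 1 turns all three legs of \<open>y\<close> into 1, and the
  twist disappears.\<close>

lemma CT_counit_right_bt:
  assumes p: "lf p" and f: "lf f"
  shows "\<Delta> (bt p h) (\<lambda>s r. s (tst x f) * r (tst 1 eps)) = p x * f h"
proof -
  note rr = comul_rules lf_comp[OF p] lf_comp[OF f]
  have "\<Delta> (bt p h) (\<lambda>s r. s (tst x f) * r (tst 1 eps)) = sw (\<lambda>h1 h2. p x * (eps h2 * f h1)) h"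
    unfolding \<Delta>_tst[OF p f lf_eps]
    by (simp add: sw_one lf_eps rr aut_one[OF aut(1)] aut_one[OF aut(2)] Si_one
        mult.commute[of _ "eps _"])
  then show ?thesis by (simp add: sw_mult_left counit_right f)
qed

end


section \<open>The multiplication respects the comultiplication, on generators\<close>

lemma cancel_left_fun:
  assumes "cancels K" "\<And>c. lf (\<lambda>u. F u c)" "lf (F 1)"
  shows "sw (\<lambda>a. sw (\<lambda>b. F (K a b))) = F 1"
  using cancel_left[OF assms] by (simp add: fun_eq_iff)

lemma cancel_right_fun:
  assumes "cancels K" "\<And>a. lf (\<lambda>u. F a u)" "lf (\<lambda>a. F a 1)"
  shows "sw (\<lambda>a. sw (\<lambda>b c. F a (K b c))) = (\<lambda>x. F x 1)"
  using cancel_right[OF assms] by (simp add: fun_eq_iff)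

lemma cancel_chain:
  assumes "cancels K" "\<And>c d. lf (\<lambda>u. G u c d)"
  shows "sw (\<lambda>a. sw (\<lambda>b. sw (G (K a b)))) = sw (G 1)"
  using assms by (intro cancel_left_fun) (simp_all add: rules)

lemma collapse_mult: "(\<Sum>d\<in>B. db d z * (c * sw3 F d)) = c * sw3 F z"
  by (simp add: mult.left_commute[of _ c] collapse flip: sum_distrib_left)

lemma sw_prod: "sw P x * c * (sw Q y * c') =
    sw (\<lambda>x1 x2. sw (\<lambda>y1 y2. Q y1 y2 * (P x1 x2 * (c * c'))) y) x"
  by (simp only: sw_mult_left sw_mult_right) (simp only: mult_ac)

lemma sw3_Si:
  assumes F: "\<And>b c. lf (\<lambda>a. F a b c)" "\<And>a c. lf (\<lambda>b. F a b c)" "\<And>a b. lf (\<lambda>c. F a b c)"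
  shows "sw3 F (Si x) = sw3 (\<lambda>a b c. F (Si c) (Si b) (Si a)) x"
proof -
  note r = rules lf_comp[OF F(1)] lf_comp[OF F(2)] lf_comp[OF F(3)] le_Si le_Si_comp F
  have "sw3 F (Si x) = sw (\<lambda>a b. sw (\<lambda>c d. F (Si b) (Si d) (Si c)) a) x"
    by (simp add: sw3_def sw_Si r)
  then show ?thesis by (simp only: sw3_def sw_assoc_fun)
qed

lemma sw_sw_sw3: "sw (\<lambda>d. sw (\<lambda>e f. sw3 (\<lambda>a b c. F a b c d e f) y)) =
    (\<lambda>x. sw3 (\<lambda>a b c. sw3 (\<lambda>d e f. F a b c d e f) x) y)"
proof
  fix x
  show "sw (\<lambda>d. sw (\<lambda>e f. sw3 (\<lambda>a b c. F a b c d e f) y)) x =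
    sw3 (\<lambda>a b c. sw3 (\<lambda>d e f. F a b c d e f) x) y"
    using sw3_swap[of "\<lambda>d e f a b c. F a b c d e f" y x]
    by (simp only: sw3_def[of "\<lambda>d e f. sw3 (\<lambda>a b c. F a b c d e f) y"])
qed

text \<open>The coproduct of \<open>x * y2\<close> splits both arguments, so \<open>y\<close> ends
  up with four legs: the outer two for \<open>G\<close>, the middle two shared by \<open>q\<close>
  and \<open>p\<close>.\<close>

lemma sw_conv_shift:
  assumes p: "lf p" and q: "lf q"
  shows "sw (\<lambda>y1. sw (\<lambda>y2 y3. conv H q p (x * y2) * G y1 y3)) y = sw (\<lambda>x1 x2.
    sw (\<lambda>e1. sw (\<lambda>e2. sw (\<lambda>d2 d3. q (x1 * e2) * p (x2 * d2) * G e1 d3))) y) x"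
proof -
  have "sw (\<lambda>y1. sw (\<lambda>y2 y3. conv H q p (x * y2) * G y1 y3)) y =
      sw (\<lambda>y1. sw (\<lambda>y2 y3. sw (\<lambda>x1 x2. sw (\<lambda>e2 d2. q (x1 * e2) * p (x2 * d2) * G y1 y3) y2) x)) y"
    by (simp add: lf_conv p q sw_mult rules lf_comp[OF p] lf_comp[OF q] sw_mult_right)
  then show ?thesis by (simp only: sw_swap_fun[where y = x] sw_assoc_fun)
qed

lemma CT_mult_bilin:
  assumes "hopf_automorphism H \<alpha>" "hopf_automorphism H \<delta>"
  shows "s \<in> vset X \<Longrightarrow> lin X base_field (\<lambda>r. CT_mult H (\<alpha>, \<beta>) (\<gamma>, \<delta>) (tpure X X s r) \<psi>)"
    and "r \<in> vset X \<Longrightarrow> lin X base_field (\<lambda>s. CT_mult H (\<alpha>, \<beta>) (\<gamma>, \<delta>) (tpure X X s r) \<psi>)"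
  using bilin_comp[OF bilin_tpure lin_CT_mult_eval[OF aut_le[OF assms(1)] aut_le[OF assms(2)]
    aut_le[OF aut_inv[OF assms(2)]], of \<beta> \<gamma> \<psi>]] by (simp_all add: bilin_def)

lemmas CT_mult_bt' = CT_mult_bt[OF aut_le aut_le aut_le[OF aut_inv]]

text \<open>On the left, \<open>y\<close> has four legs by \<open>sw_conv_shift\<close>. On the
  right, two dual basis elements are multiplied, so \<open>y\<close> is divided between the two
  coproducts and has six legs. The middle two, \<open>e3\<close> and \<open>d1\<close>, cancel, and
  the expressions agree.\<close>

lemma CT_mult_comul_bt:
  assumes ab: "hopf_automorphism H \<alpha>" "hopf_automorphism H \<beta>"
    and cd: "hopf_automorphism H \<gamma>" "hopf_automorphism H \<delta>"
    and lf: "lf p" "lf q" "lf f" "lf g"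
  defines "m \<equiv> CT_mult H (\<alpha>, \<beta>) (\<gamma>, \<delta>)"
  shows "comul (CT H S B (\<delta> \<circ> \<alpha> \<circ> inv_into UNIV \<delta> \<circ> \<gamma>, \<delta> \<circ> \<beta>)) (m (tpure X X (bt p h) (bt q k)))
      (\<lambda>s r. s (tst x f) * r (tst y g)) =
    comul (CT H S B (\<alpha>, \<beta>)) (bt p h) (\<lambda>a b. comul (CT H S B (\<gamma>, \<delta>)) (bt q k)
      (\<lambda>c d. m (tpure X X a c) (tst x f) * m (tpure X X b d) (tst y g)))"
proof -
  \<comment> \<open>The map that the product applies to its second factor.\<close>
  define \<theta> where "\<theta> = \<delta> \<circ> \<alpha> \<circ> inv_into UNIV \<delta>"
  have th: "hopf_automorphism H \<theta>"
    unfolding \<theta>_def by (intro aut_comp aut_inv ab cd)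
  have \<theta>\<delta>: "\<theta> (\<delta> u) = \<delta> (\<alpha> u)" for u
    by (simp add: \<theta>_def aut_inv_simps cd)
  have m_bt: "m (tpure X X (bt p h) (bt q k)) = bt (conv H q p) (\<delta> h * \<theta> k)"
    if "lf p" "lf q" for p q h k
    using that by (simp add: m_def \<theta>_def CT_mult_bt' ab cd)
  note l = aut_le[OF ab(1)] aut_le[OF ab(2)] aut_le[OF cd(1)] aut_le[OF cd(2)] aut_le[OF th]
    aut_le_comp[OF ab(1)] aut_le_comp[OF ab(2)] aut_le_comp[OF cd(1)] aut_le_comp[OF cd(2)]
    aut_le_comp[OF th]
  note rr = rules le_Si le_Si_comp l lf lf_comp[OF lf(1)] lf_comp[OF lf(2)] lf_comp[OF lf(3)]
    lf_comp[OF lf(4)]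
  note am = aut_mult[OF ab(1)] aut_mult[OF ab(2)] aut_mult[OF cd(1)] aut_mult[OF cd(2)] aut_mult[OF th]
  let ?R = "\<lambda>x1 x2 h1 h2 k1 k2. sw (\<lambda>e1. sw (\<lambda>e2. sw (\<lambda>d2 d3. q (x1 * e2) * p (x2 * d2) *
    (f (\<delta> (\<beta> d3) * (\<delta> h1 * (\<theta> k1 * Si (\<theta> (\<gamma> e1))))) * g (\<delta> h2 * \<theta> k2))))) y"
  have "comul (CT H S B (\<theta> \<circ> \<gamma>, \<delta> \<circ> \<beta>)) (m (tpure X X (bt p h) (bt q k)))
      (\<lambda>s r. s (tst x f) * r (tst y g)) = sw (\<lambda>u1 u2. sw (\<lambda>y1. sw (\<lambda>y2 y3. conv H q p (x * y2) *
        (f (\<delta> (\<beta> y3) * (u1 * Si (\<theta> (\<gamma> y1)))) * g u2))) y) (\<delta> h * \<theta> k)"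
    by (simp only: m_bt lf) (subst CT_comul_tst, simp_all add: l lf o_def)
  also have "\<dots> = sw (\<lambda>h1 h2. sw (\<lambda>k1 k2. sw (\<lambda>y1. sw (\<lambda>y2 y3. conv H q p (x * y2) *
        (f (\<delta> (\<beta> y3) * (\<delta> h1 * (\<theta> k1 * Si (\<theta> (\<gamma> y1))))) * g (\<delta> h2 * \<theta> k2)))) y) k) h"
    by (simp add: sw_mult aut_sw[OF cd(2)] aut_sw[OF th] rr mult.assoc)
  also have "\<dots> = sw (\<lambda>h1 h2. sw (\<lambda>k1 k2. sw (\<lambda>x1 x2. ?R x1 x2 h1 h2 k1 k2) x) k) h"
    by (simp only: sw_conv_shift lf)
  finally have left: "comul (CT H S B (\<theta> \<circ> \<gamma>, \<delta> \<circ> \<beta>)) (m (tpure X X (bt p h) (bt q k)))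
      (\<lambda>s r. s (tst x f) * r (tst y g)) = \<dots>" .
  let ?W = "\<lambda>d1 d3 e1 e3 h1 k1. f (\<delta> (\<beta> d3 * h1 * Si (\<alpha> d1)) * \<theta> (\<delta> e3 * k1 * Si (\<gamma> e1)))"
  note m_lin = CT_mult_bilin[OF ab(1) cd(2), of _ \<beta> \<gamma>, folded m_def]
  have bl1: "bilin X X base_field (\<lambda>c d. m (tpure X X a c) (tst x f) * m (tpure X X b d) (tst y g))"
    if "a \<in> vset X" "b \<in> vset X" for a b
    by (rule bilin_product[OF m_lin(1)[OF that(1)] m_lin(1)[OF that(2)]])
  have bl2: "bilin X X base_field (\<lambda>a b. comul (CT H S B (\<gamma>, \<delta>)) (bt q k)
      (\<lambda>c d. m (tpure X X a c) (tst x f) * m (tpure X X b d) (tst y g)))"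
  proof (rule bilinI)
    note T = lin_in[OF lin_CT_comul[OF l(3,4)] bt_in[OF lf(2)]]
    show "lin X base_field (\<lambda>b. comul (CT H S B (\<gamma>, \<delta>)) (bt q k)
        (\<lambda>c d. m (tpure X X a c) (tst x f) * m (tpure X X b d) (tst y g)))" if a: "a \<in> vset X" for a
      by (rule lin_app_param[OF vspace_tensor bl1[OF a] lin_scale_const(2)[OF m_lin(2)] T])
    show "lin X base_field (\<lambda>a. comul (CT H S B (\<gamma>, \<delta>)) (bt q k)
        (\<lambda>c d. m (tpure X X a c) (tst x f) * m (tpure X X b d) (tst y g)))" if b: "b \<in> vset X" for b
      by (rule lin_app_param[OF vspace_tensor bl1[OF _ b] lin_scale_const(1)[OF m_lin(2)] T])
  qed
  have "comul (CT H S B (\<alpha>, \<beta>)) (bt p h) (\<lambda>a b. comul (CT H S B (\<gamma>, \<delta>)) (bt q k)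
      (\<lambda>c d. m (tpure X X a c) (tst x f) * m (tpure X X b d) (tst y g))) =
    (\<Sum>d\<in>B. sw3 (\<lambda>d1 d2 d3. sw (\<lambda>h1 h2. \<Sum>e\<in>B. sw3 (\<lambda>e1 e2 e3. sw (\<lambda>k1 k2.
      sw (\<lambda>x1 x2. q (x1 * e2) * p (x2 * d2)) x * ?W d1 d3 e1 e3 h1 k1 *
      (sw (\<lambda>y1 y2. db e y1 * db d y2) y * g (\<delta> h2 * \<theta> k2))) k) e) h) d)"
    by (simp add: CT_comul_apply[OF l(1,2) lf(1) bl2] CT_comul_apply[OF l(3,4) lf(2) bl1]
        bt_in lf_shift lf m_bt lf_db lf_conv)
  also have "\<dots> = (\<Sum>d\<in>B. sw3 (\<lambda>d1 d2 d3. sw (\<lambda>h1 h2. \<Sum>e\<in>B. sw3 (\<lambda>e1 e2 e3. sw (\<lambda>k1 k2.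
      sw (\<lambda>x1 x2. sw (\<lambda>y1 y2. db e y1 * (db d y2 * (q (x1 * e2) * p (x2 * d2) *
        (?W d1 d3 e1 e3 h1 k1 * g (\<delta> h2 * \<theta> k2))))) y) x) k) e) h) d)"
    by (simp only: sw_prod) (simp only: mult.assoc[where 'a = 'k])
  also have "\<dots> = sw (\<lambda>h1 h2. sw (\<lambda>k1 k2. sw (\<lambda>x1 x2. sw (\<lambda>y1 y2.
      sw3 (\<lambda>d1 d2 d3. sw3 (\<lambda>e1 e2 e3. q (x1 * e2) * p (x2 * d2) *
        (?W d1 d3 e1 e3 h1 k1 * g (\<delta> h2 * \<theta> k2))) y1) y2) y) x) k) h"
    by (simp only: sw3_sw_swap sw3_mult_left sum_sw collapse collapse_mult)
  also have "\<dots> = sw (\<lambda>h1 h2. sw (\<lambda>k1 k2. sw (\<lambda>x1 x2. ?R x1 x2 h1 h2 k1 k2) x) k) h"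
  proof -
    \<comment> \<open>At the seam of the two factors \<open>?W\<close> contains
      \<open>\<delta> (Si (\<alpha> d1)) * \<theta> (\<delta> e3)\<close>; the relation
      \<open>\<theta>\<delta>\<close> puts both under \<delta> after \<alpha>, where they
      cancel.\<close>
    have K: "cancels (\<lambda>a b. \<delta> (\<alpha> (Si b)) * \<delta> (\<alpha> a))"
      using cancels_comp[OF cancels_Si(1), of "\<lambda>u. \<delta> (\<alpha> u)"]
      by (simp add: l am aut_one[OF ab(1)] aut_one[OF cd(2)])
    have "sw (\<lambda>e3. sw (\<lambda>d1. sw (\<lambda>d2 d3. q (x1 * e2) * p (x2 * d2) *
          (?W d1 d3 e1 e3 h1 k1 * g (\<delta> h2 * \<theta> k2))))) =
        sw (\<lambda>d2 d3. q (x1 * e2) * p (x2 * d2) *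
          (f (\<delta> (\<beta> d3) * (\<delta> h1 * (\<theta> k1 * Si (\<theta> (\<gamma> e1))))) * g (\<delta> h2 * \<theta> k2)))"
      for e1 e2 x1 x2 h1 h2 k1 k2
      using cancel_chain[OF K, of "\<lambda>u d2 d3. q (x1 * e2) * p (x2 * d2) *
        (f (\<delta> (\<beta> d3) * (\<delta> h1 * (u * (\<theta> k1 * Si (\<theta> (\<gamma> e1)))))) * g (\<delta> h2 * \<theta> k2))"]
      by (simp add: rr am \<theta>\<delta> aut_Si[OF th] aut_Si[OF ab(1), symmetric] mult.assoc[where 'a = 'h])
    then show ?thesis
      by (subst sw3_swap) (simp only: sw3_def sw_assoc_fun)
  qed
  finally show ?thesis using left by (simp add: \<theta>_def)
qed

text \<open>In the antipode axiom the second factor is an image under the antipode, a sum of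
  generators known through its test values only. Hence an arbitrary \<open>r\<close> is allowed
  here; by linearity the formula is checked on generators.\<close>

lemma CT_mult_right_eval:
  assumes "hopf_automorphism H \<alpha>" "hopf_automorphism H \<delta>" and p: "lf p" and f: "lf f"
    and r: "r \<in> vset X"
  shows "CT_mult H (\<alpha>, \<beta>) (\<gamma>, \<delta>) (tpure X X (bt p u) r) (tst x f) =
    sw (\<lambda>x1 x2. p x2 * r (tst x1 (\<lambda>v. f (\<delta> u * \<delta> (\<alpha> (inv_into UNIV \<delta> v)))))) x"
  using CT_mult_bilin(1)[OF assms(1,2) bt_in[OF p]] _ _ r
proof (rule lin_X_eqI)
  show "lin X base_field (\<lambda>r. sw (\<lambda>x1 x2. p x2 * r (tst x1
      (\<lambda>v. f (\<delta> u * \<delta> (\<alpha> (inv_into UNIV \<delta> v)))))) x)"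
    by (rule linI) (simp_all add: algebra_simps sw_add sw_mult_left[symmetric])
  fix q v assume q: "lf q"
  have "lf (\<lambda>v. f (\<delta> u * \<delta> (\<alpha> (inv_into UNIV \<delta> v))))"
    by (simp add: rules lf_comp[OF f] aut_le_comp[OF assms(1)] aut_le_comp[OF assms(2)]
        aut_le_comp[OF aut_inv[OF assms(2)]] aut_le[OF aut_inv[OF assms(2)]])
  then show "CT_mult H (\<alpha>, \<beta>) (\<gamma>, \<delta>) (tpure X X (bt p u) (bt q v)) (tst x f) = sw (\<lambda>x1 x2. p x2 *
      bt q v (tst x1 (\<lambda>v. f (\<delta> u * \<delta> (\<alpha> (inv_into UNIV \<delta> v)))))) x"
    by (simp add: CT_mult_bt' assms q lf_conv flip: sw_mult_right) (simp only: mult_ac)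
qed

lemma CT_mult_left_eval:
  assumes "hopf_automorphism H \<alpha>" "hopf_automorphism H \<delta>" and q: "lf q" and f: "lf f"
    and s: "s \<in> vset X"
  shows "CT_mult H (\<alpha>, \<beta>) (\<gamma>, \<delta>) (tpure X X s (bt q v)) (tst x f) =
    sw (\<lambda>x1 x2. q x1 * s (tst x2 (\<lambda>u. f (\<delta> u * \<delta> (\<alpha> (inv_into UNIV \<delta> v)))))) x"
  using CT_mult_bilin(2)[OF assms(1,2) bt_in[OF q]] _ _ s
proof (rule lin_X_eqI)
  show "lin X base_field (\<lambda>s. sw (\<lambda>x1 x2. q x1 * s (tst x2
      (\<lambda>u. f (\<delta> u * \<delta> (\<alpha> (inv_into UNIV \<delta> v)))))) x)"
    by (rule linI) (simp_all add: algebra_simps sw_add sw_mult_left[symmetric])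
  fix p u assume p: "lf p"
  have "lf (\<lambda>u. f (\<delta> u * \<delta> (\<alpha> (inv_into UNIV \<delta> v))))"
    by (simp add: rules lf_comp[OF f] aut_le[OF assms(2)])
  then show "CT_mult H (\<alpha>, \<beta>) (\<gamma>, \<delta>) (tpure X X (bt p u) (bt q v)) (tst x f) = sw (\<lambda>x1 x2. q x1 *
      bt p u (tst x2 (\<lambda>u. f (\<delta> u * \<delta> (\<alpha> (inv_into UNIV \<delta> v)))))) x"
    by (simp add: CT_mult_bt' assms p lf_conv flip: sw_mult_right) (simp only: mult_ac)
qed

section \<open>The antipode axiom on generators\<close>

lemma aut_inv_inv: "hopf_automorphism H f \<Longrightarrow> inv_into UNIV (inv_into UNIV f) = f"
  by (simp add: inv_inv_eq aut_bij)

context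
  fixes \<alpha> \<beta> :: "'h \<Rightarrow> 'h"
  assumes aut: "hopf_automorphism H \<alpha>" "hopf_automorphism H \<beta>"
begin

private abbreviation (input) "\<alpha>i \<equiv> inv_into UNIV \<alpha>"
private abbreviation (input) "\<beta>i \<equiv> inv_into UNIV \<beta>"

private lemma inv_auts: "hopf_automorphism H \<alpha>i" "hopf_automorphism H \<beta>i"
    "hopf_automorphism H (\<beta>i \<circ> \<alpha>i \<circ> \<beta>)"
  using aut by (simp_all add: aut_inv aut_comp)

private lemmas mults = aut_mult[OF aut(1)] aut_mult[OF aut(2)] aut_mult[OF inv_auts(1)]
  aut_mult[OF inv_auts(2)]
private lemmas ones = aut_one[OF aut(1)] aut_one[OF aut(2)] aut_one[OF inv_auts(1)] aut_one[OF inv_auts(2)]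
private lemmas les = rules aut_le[OF inv_auts(1)] aut_le[OF inv_auts(2)] aut_le[OF aut(1)] aut_le[OF aut(2)]
  aut_le_comp[OF inv_auts(1)] aut_le_comp[OF inv_auts(2)] aut_le_comp[OF aut(1)] aut_le_comp[OF aut(2)]
  le_Si le_Si_comp
private lemmas invs = aut_inv_simps[OF aut(1)] aut_inv_simps[OF aut(2)] aut_inv_inv[OF aut(2)]

text \<open>After regrouping, \<open>x\<close> has the legs \<open>w1, e1, e2, e3, w3, x2\<close>.
  The pair \<open>e3, w3\<close> cancels first, which makes \<open>e2\<close> and \<open>x2\<close>
  neighbours; they cancel inside \<open>p\<close>. Then the legs of \<open>h\<close> cancel, and
  finally \<open>w1\<close> and \<open>e1\<close>.\<close>

lemma CT_antipode_right_bt: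
  assumes p: "lf p" and f: "lf f"
  shows "comul (CT H S B (\<alpha>, \<beta>)) (bt p h) (\<lambda>s r. CT_mult H (\<alpha>, \<beta>) (\<beta>i \<circ> \<alpha>i \<circ> \<beta>, \<beta>i)
      (tpure X X s (CT_antipode H S B (\<alpha>, \<beta>) r)) (tst x f)) = p 1 * eps h * (eps x * f 1)"
proof -
  note rr = les lf_comp[OF p] lf_comp[OF f] p f
  let ?f = "\<lambda>d1 d3 h1 h2 w1 w3. f (d3 * (\<beta>i h1 * (\<beta>i (Si (\<alpha> d1)) * (\<beta>i (\<alpha> (Si w3)) * (\<beta>i (S h2) * w1)))))"
  have "bilin X X base_field (\<lambda>s r. CT_mult H (\<alpha>, \<beta>) (\<beta>i \<circ> \<alpha>i \<circ> \<beta>, \<beta>i)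
      (tpure X X s (CT_antipode H S B (\<alpha>, \<beta>) r)) (tst x f))"
    by (intro bilinI lin_comp[OF lin_CT_antipode[OF aut] CT_mult_bilin(1)]
        CT_mult_bilin(2) lin_in[OF lin_CT_antipode[OF aut]] aut inv_auts)
  from CT_comul_apply[OF aut_le[OF aut(1)] aut_le[OF aut(2)] p this]
  have "comul (CT H S B (\<alpha>, \<beta>)) (bt p h) (\<lambda>s r. CT_mult H (\<alpha>, \<beta>) (\<beta>i \<circ> \<alpha>i \<circ> \<beta>, \<beta>i)
      (tpure X X s (CT_antipode H S B (\<alpha>, \<beta>) r)) (tst x f)) =
    (\<Sum>d\<in>B. sw3 (\<lambda>d1 d2 d3. sw (\<lambda>h1 h2. sw (\<lambda>x1 x2. p (x2 * d2) * sw (\<lambda>w1 r. sw (\<lambda>w2 w3.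
      db d (Si w2) * ?f d1 d3 h1 h2 w1 w3) r) x1) x) h) d)"
    by (simp add: CT_mult_right_eval lf_shift p f aut inv_auts lin_in[OF lin_CT_antipode[OF aut]] bt_in lf_db
        CT_antipode_tst[OF aut] rr invs mults mult.assoc[where 'a = 'h])
  also have "\<dots> = (\<Sum>d\<in>B. sw3 (\<lambda>d1 d2 d3. sw (\<lambda>h1 h2. sw (\<lambda>x1 x2. sw (\<lambda>w1 r. sw (\<lambda>w2 w3.
      db d (Si w2) * (p (x2 * d2) * ?f d1 d3 h1 h2 w1 w3)) r) x1) x) h) d)"
    by (simp add: mult.left_commute[of _ "db _ _"] flip: sw_mult_left)
  also have "\<dots> = sw (\<lambda>h1 h2. sw (\<lambda>x1 x2. sw (\<lambda>w1 r. sw (\<lambda>w2 w3. sw3 (\<lambda>d1 d2 d3.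
      p (x2 * d2) * ?f d1 d3 h1 h2 w1 w3) (Si w2)) r) x1) x) h"
    by (simp only: sw3_sw_swap sw3_mult_left sum_sw collapse)
  \<comment> \<open>The antipode evaluates \<open>db d\<close> at \<open>Si w2\<close>, so
    \<open>d\<close> becomes \<open>Si w2\<close>; its legs are those of \<open>w2\<close> in
    reverse order.\<close>
  also have "\<dots> = sw (\<lambda>h1 h2. sw (\<lambda>w1. sw (\<lambda>e1. sw (\<lambda>e2. sw (\<lambda>e3. sw (\<lambda>w3 x2.
      p (x2 * Si e2) * ?f (Si e3) (Si e1) h1 h2 w1 w3))))) x) h"
    by (simp add: sw3_Si rr) (simp only: sw3_def sw_assoc_fun)
  also have "\<dots> = sw (\<lambda>h1 h2. sw (\<lambda>w1 e1. p 1 * f (Si e1 * (\<beta>i h1 * (\<beta>i (S h2) * w1)))) x) h"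
  proof -
    have K: "cancels (\<lambda>a b. \<beta>i (Si (\<alpha> (Si a))) * \<beta>i (\<alpha> (Si b)))"
      using cancels_comp[OF cancels_Si(2), of "\<lambda>u. \<beta>i (\<alpha> (Si u))"]
      by (simp add: les mults ones Si_mult Si_one aut_Si[OF aut(1)])
    have 1: "sw (\<lambda>e3. sw (\<lambda>w3 x2. p (x2 * Si e2) * ?f (Si e3) (Si e1) h1 h2 w1 w3)) =
        (\<lambda>x2. p (x2 * Si e2) * f (Si e1 * (\<beta>i h1 * (\<beta>i (S h2) * w1))))" for e1 e2 h1 h2 w1
      using cancel_left_fun[OF K, of "\<lambda>u x2. p (x2 * Si e2) * f (Si e1 * (\<beta>i h1 * (u * (\<beta>i (S h2) * w1))))"]
      by (simp add: rr mult.assoc)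
    have 2: "sw (\<lambda>e1. sw (\<lambda>e2 x2. p (x2 * Si e2) * f (Si e1 * (\<beta>i h1 * (\<beta>i (S h2) * w1))))) =
        (\<lambda>e1. p 1 * f (Si e1 * (\<beta>i h1 * (\<beta>i (S h2) * w1))))" for h1 h2 w1
      using cancel_right_fun[OF cancels_Si(2), of "\<lambda>e1 u. p u * f (Si e1 * (\<beta>i h1 * (\<beta>i (S h2) * w1)))"]
      by (simp add: rr)
    show ?thesis by (simp only: 1 2)
  qed
  also have "\<dots> = sw (\<lambda>w1 e1. sw (\<lambda>h1 h2. p 1 * f (Si e1 * (\<beta>i h1 * (\<beta>i (S h2) * w1)))) h) x"
    by (rule sw_swap)
  also have "\<dots> = sw (\<lambda>w1 e1. eps h * (p 1 * f (Si e1 * w1))) x"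
  proof -
    have K: "cancels (\<lambda>a b. \<beta>i a * \<beta>i (S b))"
      using cancels_comp[OF cancels_S(2), of \<beta>i] by (simp add: les mults ones)
    have "sw (\<lambda>h1 h2. p 1 * f (Si e1 * (\<beta>i h1 * (\<beta>i (S h2) * w1)))) h = eps h * (p 1 * f (Si e1 * w1))"
      for e1 w1
      using cancelsD[OF K, of "\<lambda>u. p 1 * f (Si e1 * (u * w1))" h] by (simp add: rr mult.assoc)
    then show ?thesis by simp
  qed
  also have "\<dots> = p 1 * eps h * (eps x * f 1)"
    using cancelsD[OF cancels_Si(1) f, of x] by (simp add: sw_mult_left)
  finally show ?thesis .
qed

text \<open>Here the legs of \<open>x\<close> are \<open>d1, d2, d3, w1, w2, w3\<close>, cancelled
  from the middle outwards: \<open>d3, w1\<close> through \<open>S\<close>, then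
  \<open>d2, w2\<close> inside \<open>p\<close> through \<open>Si\<close>. The legs of
  \<open>h\<close> cancel next, and \<open>d1, w3\<close> remain for the last use of
  \<open>Si\<close>.\<close>

lemma CT_antipode_left_bt:
  assumes p: "lf p" and f: "lf f"
  shows "comul (CT H S B (\<alpha>, \<beta>)) (bt p h) (\<lambda>s r. CT_mult H (\<beta>i \<circ> \<alpha>i \<circ> \<beta>, \<beta>i) (\<alpha>, \<beta>)
      (tpure X X (CT_antipode H S B (\<alpha>, \<beta>) s) r) (tst x f)) = p 1 * eps h * (eps x * f 1)"
proof -
  note rr = les lf_comp[OF p] lf_comp[OF f] p f
  let ?f = "\<lambda>d1 d3 h1 h2 w1 w3. f (Si w3 * (d1 * (\<alpha>i (S h1) * (\<alpha>i (S (\<beta> d3)) * (\<alpha>i (\<beta> w1) * \<alpha>i h2)))))"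
  have "bilin X X base_field (\<lambda>s r. CT_mult H (\<beta>i \<circ> \<alpha>i \<circ> \<beta>, \<beta>i) (\<alpha>, \<beta>)
      (tpure X X (CT_antipode H S B (\<alpha>, \<beta>) s) r) (tst x f))"
    by (intro bilinI lin_comp[OF lin_CT_antipode[OF aut] CT_mult_bilin(2)]
        CT_mult_bilin(1) lin_in[OF lin_CT_antipode[OF aut]] aut inv_auts)
  from CT_comul_apply[OF aut_le[OF aut(1)] aut_le[OF aut(2)] p this]
  have "comul (CT H S B (\<alpha>, \<beta>)) (bt p h) (\<lambda>s r. CT_mult H (\<beta>i \<circ> \<alpha>i \<circ> \<beta>, \<beta>i) (\<alpha>, \<beta>)
      (tpure X X (CT_antipode H S B (\<alpha>, \<beta>) s) r) (tst x f)) =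
    (\<Sum>d\<in>B. sw3 (\<lambda>d1 d2 d3. sw (\<lambda>h1 h2. sw (\<lambda>x1 x2. db d x1 * sw (\<lambda>w1 r. sw (\<lambda>w2 w3.
      p (Si w2 * d2) * ?f d1 d3 h1 h2 w1 w3) r) x2) x) h) d)"
    by (simp add: CT_mult_left_eval lf_shift p f aut inv_auts lin_in[OF lin_CT_antipode[OF aut]] bt_in lf_db
        CT_antipode_tst[OF aut] rr invs mults S_mult mult.assoc[where 'a = 'h])
  also have "\<dots> = sw (\<lambda>h1 h2. sw (\<lambda>x1 x2. sw (\<lambda>w1. sw (\<lambda>w2 w3. sw3 (\<lambda>d1 d2 d3.
      p (Si w2 * d2) * ?f d1 d3 h1 h2 w1 w3) x1)) x2) x) h"
    by (simp only: sw_mult_left[symmetric], simp only: sw3_sw_swap sw3_mult_left sum_sw collapse)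
  also have "\<dots> = sw (\<lambda>h1 h2. sw (\<lambda>d1. sw (\<lambda>d2. sw (\<lambda>d3. sw (\<lambda>w1. sw (\<lambda>w2 w3.
      p (Si w2 * d2) * ?f d1 d3 h1 h2 w1 w3))))) x) h"
    by (simp only: sw_sw_sw3) (simp only: sw3_def sw_assoc_fun)
  also have "\<dots> = sw (\<lambda>h1 h2. sw (\<lambda>d1 w3. p 1 * f (Si w3 * (d1 * (\<alpha>i (S h1) * \<alpha>i h2)))) x) h"
  proof -
    have K: "cancels (\<lambda>a b. \<alpha>i (S (\<beta> a)) * \<alpha>i (\<beta> b))"
      using cancels_comp[OF cancels_S(1), of "\<lambda>u. \<alpha>i (\<beta> u)"]
      by (simp add: les mults ones aut_S[OF aut(2)])
    have 1: "sw (\<lambda>d3. sw (\<lambda>w1. sw (\<lambda>w2 w3. p (Si w2 * d2) * ?f d1 d3 h1 h2 w1 w3))) =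
        sw (\<lambda>w2 w3. p (Si w2 * d2) * f (Si w3 * (d1 * (\<alpha>i (S h1) * \<alpha>i h2))))" for d1 d2 h1 h2
      using cancel_chain[OF K, of "\<lambda>u w2 w3. p (Si w2 * d2) * f (Si w3 * (d1 * (\<alpha>i (S h1) * (u * \<alpha>i h2))))"]
      by (simp add: rr mult.assoc)
    have 2: "sw (\<lambda>d2. sw (\<lambda>w2 w3. p (Si w2 * d2) * f (Si w3 * (d1 * (\<alpha>i (S h1) * \<alpha>i h2))))) =
        (\<lambda>w3. p 1 * f (Si w3 * (d1 * (\<alpha>i (S h1) * \<alpha>i h2))))" for d1 h1 h2
      using cancel_left_fun[OF cancels_Si(1), of "\<lambda>u w3. p u * f (Si w3 * (d1 * (\<alpha>i (S h1) * \<alpha>i h2)))"]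
      by (simp add: rr)
    show ?thesis by (simp only: 1 2)
  qed
  also have "\<dots> = sw (\<lambda>d1 w3. sw (\<lambda>h1 h2. p 1 * f (Si w3 * (d1 * (\<alpha>i (S h1) * \<alpha>i h2)))) h) x"
    by (rule sw_swap)
  also have "\<dots> = sw (\<lambda>d1 w3. eps h * (p 1 * f (Si w3 * d1))) x"
  proof -
    have K: "cancels (\<lambda>a b. \<alpha>i (S a) * \<alpha>i b)"
      using cancels_comp[OF cancels_S(1), of \<alpha>i] by (simp add: les mults ones)
    have "sw (\<lambda>h1 h2. p 1 * f (Si w3 * (d1 * (\<alpha>i (S h1) * \<alpha>i h2)))) h = eps h * (p 1 * f (Si w3 * d1))"
      for d1 w3
      using cancelsD[OF K, of "\<lambda>u. p 1 * f (Si w3 * (d1 * u))" h] by (simp add: rr)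
    then show ?thesis by simp
  qed
  also have "\<dots> = p 1 * eps h * (eps x * f 1)"
    using cancelsD[OF cancels_Si(1) f, of x] by (simp add: sw_mult_left)
  finally show ?thesis .
qed

end


section \<open>From generators to the axioms of a Turaev algebra\<close>

lemma CT_vsp [simp]: "vscale (CT H S B a) = fscale" "vset (CT H S B a) = vset X"
  using vsp_of_CT[of H S B a] by (simp_all add: vsp_of_def tensor_def)

lemmas CT_simps =
  vspace_vsp_of[of "CT H S B a" for a, unfolded vsp_of_CT]
  lin_vsp_of(1)[where V = "CT H S B a" for a, unfolded vsp_of_CT]
  lin_vsp_of(2)[where W = "CT H S B a" for a, unfolded vsp_of_CT]
  tpure_vsp_of(1)[where V = "CT H S B a" for a, unfolded vsp_of_CT]
  tpure_vsp_of(2)[where W = "CT H S B a" for a, unfolded vsp_of_CT]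
  tensor_vsp_of(1)[where V = "CT H S B a" for a, unfolded vsp_of_CT]
  tensor_vsp_of(2)[where W = "CT H S B a" for a, unfolded vsp_of_CT]
  tlift_vsp_of(1)[where V = "CT H S B a" for a, unfolded vsp_of_CT]
  tlift_vsp_of(2)[where W = "CT H S B a" for a, unfolded vsp_of_CT]
  tlift_vsp_of(3)[where U = "CT H S B a" for a, unfolded vsp_of_CT]
  tmap_vsp_of(1)[where V = "CT H S B a" for a, unfolded vsp_of_CT]
  tmap_vsp_of(2)[where W = "CT H S B a" for a, unfolded vsp_of_CT]
  tmap_vsp_of(3)[where V' = "CT H S B a" for a, unfolded vsp_of_CT]
  tmap_vsp_of(4)[where W' = "CT H S B a" for a, unfolded vsp_of_CT]
  tassoc_vsp_of(1)[where U = "CT H S B a" for a, unfolded vsp_of_CT]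
  tassoc_vsp_of(2)[where V = "CT H S B a" for a, unfolded vsp_of_CT]
  tassoc_vsp_of(3)[where W = "CT H S B a" for a, unfolded vsp_of_CT]
  tmiddle_vsp_of(1)[where A = "CT H S B a" for a, unfolded vsp_of_CT]
  tmiddle_vsp_of(2)[where B = "CT H S B a" for a, unfolded vsp_of_CT]
  tmiddle_vsp_of(3)[where C = "CT H S B a" for a, unfolded vsp_of_CT]
  tmiddle_vsp_of(4)[where D = "CT H S B a" for a, unfolded vsp_of_CT]
  lin_vsp_of(1)[where V = "tensor_coalgebra C D" for C D, unfolded vsp_of_tensor_coalgebra]
  tmap_vsp_of(1)[where V = "tensor_coalgebra C D" for C D, unfolded vsp_of_tensor_coalgebra]
  tmap_vsp_of(2)[where W = "tensor_coalgebra C D" for C D, unfolded vsp_of_tensor_coalgebra]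
  lin_vsp_of(1)[where V = base_coalgebra, unfolded vsp_of_base_coalgebra]
  tmap_vsp_of(1)[where V = base_coalgebra, unfolded vsp_of_base_coalgebra]
  tmap_vsp_of(2)[where W = base_coalgebra, unfolded vsp_of_base_coalgebra]

theorem coalgebra_CT:
  assumes aut: "hopf_automorphism H \<alpha>" "hopf_automorphism H \<beta>"
  shows "coalgebra (CT H S B (\<alpha>, \<beta>))"
proof -
  let ?C = "CT H S B (\<alpha>, \<beta>)"
  let ?\<Delta> = "comul ?C" and ?\<epsilon> = "counit ?C"
  interpret fs: module "fscale :: 'k \<Rightarrow> ('k, 'h \<Rightarrow> 'k, 'h) tensor \<Rightarrow> ('k, 'h \<Rightarrow> 'k, 'h) tensor"
    by (rule module_fscale)
  note V = vspace_tensor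
  have \<Delta>: "lin X XX ?\<Delta>" by (rule lin_CT_comul[OF aut_le[OF aut(1)] aut_le[OF aut(2)]])
  note \<epsilon> = lin_CT_counit
  have coassoc: "tassoc X X X (tmap X X XX X ?\<Delta> id (?\<Delta> t)) = tmap X X X XX id ?\<Delta> (?\<Delta> t)"
    if t: "t \<in> vset X" for t
  proof (rule lin_X_eqI[where L = "\<lambda>t. tassoc X X X (tmap X X XX X ?\<Delta> id (?\<Delta> t))"
        and L' = "\<lambda>t. tmap X X X XX id ?\<Delta> (?\<Delta> t)", OF _ _ _ t])
    show L: "lin X (tensor X XX) (\<lambda>t. tassoc X X X (tmap X X XX X ?\<Delta> id (?\<Delta> t)))"
      by (rule lin_comp[OF \<Delta> lin_comp[OF lin_tmap[OF \<Delta> lin_id(1)] lin_tassoc[OF V V V]]])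
    show R: "lin X (tensor X XX) (\<lambda>t. tmap X X X XX id ?\<Delta> (?\<Delta> t))"
      by (rule lin_comp[OF \<Delta> lin_tmap[OF lin_id(1) \<Delta>]])
    fix p h assume p: "lf p"
    show "tassoc X X X (tmap X X XX X ?\<Delta> id (?\<Delta> (bt p h))) = tmap X X X XX id ?\<Delta> (?\<Delta> (bt p h))"
      by (rule eq_XXX[OF lin_in[OF L bt_in[OF p]] lin_in[OF R bt_in[OF p]]])
        (simp only: coassoc_left_apply[OF V \<Delta> lin_in[OF \<Delta> bt_in[OF p]] lin_eval lin_eval lin_eval]
          coassoc_right_apply[OF V \<Delta> lin_in[OF \<Delta> bt_in[OF p]] lin_eval lin_eval lin_eval]
          CT_coassoc_bt[OF aut p])
  qed
  have b: "bilin X X X (\<lambda>a b. fscale (?\<epsilon> a) b)" "bilin X X X (\<lambda>a b. fscale (?\<epsilon> b) a)"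
    using \<epsilon>[of "(\<alpha>, \<beta>)"] vspace_scale[OF V[of "dual H" H]]
    by (auto simp: bilin_def lin_def algebra_simps)
  have left: "tlift X X X (\<lambda>a b. fscale (?\<epsilon> a) b) (?\<Delta> t) = t" if t: "t \<in> vset X" for t
  proof (rule lin_X_eqI[where L = "\<lambda>t. tlift X X X (\<lambda>a b. fscale (?\<epsilon> a) b) (?\<Delta> t)", OF _ lin_id(2) _ t])
    show L: "lin X X (\<lambda>t. tlift X X X (\<lambda>a b. fscale (?\<epsilon> a) b) (?\<Delta> t))"
      by (rule lin_comp[OF \<Delta> tlift_universal(1)[OF V b(1)]])
    fix p h assume p: "lf p"
    show "tlift X X X (\<lambda>a b. fscale (?\<epsilon> a) b) (?\<Delta> (bt p h)) = bt p h"
    proof (rule eq_X[OF lin_in[OF L bt_in[OF p]] bt_in[OF p]])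
      fix y g assume g: "lf g"
      have "?\<Delta> (bt p h) (\<lambda>s r. fscale (?\<epsilon> s) r (tst y g)) =
          ?\<Delta> (bt p h) (\<lambda>s r. s (tst 1 eps) * r (tst y g))"
        by (rule tensor_app_cong[OF lin_in[OF \<Delta> bt_in[OF p]] _ V V]) (simp add: CT_counit)
      then show "tlift X X X (\<lambda>a b. fscale (?\<epsilon> a) b) (?\<Delta> (bt p h)) (tst y g) = bt p h (tst y g)"
        by (simp only: tlift_tensor[OF b(1) lin_in[OF \<Delta> bt_in[OF p]]]
          CT_counit_left_bt[OF aut p g] bt_tst[OF g])
    qed
  qed
  have right: "tlift X X X (\<lambda>a b. fscale (?\<epsilon> b) a) (?\<Delta> t) = t" if t: "t \<in> vset X" for t
  proof (rule lin_X_eqI[where L = "\<lambda>t. tlift X X X (\<lambda>a b. fscale (?\<epsilon> b) a) (?\<Delta> t)", OF _ lin_id(2) _ t])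
    show L: "lin X X (\<lambda>t. tlift X X X (\<lambda>a b. fscale (?\<epsilon> b) a) (?\<Delta> t))"
      by (rule lin_comp[OF \<Delta> tlift_universal(1)[OF V b(2)]])
    fix p h assume p: "lf p"
    show "tlift X X X (\<lambda>a b. fscale (?\<epsilon> b) a) (?\<Delta> (bt p h)) = bt p h"
    proof (rule eq_X[OF lin_in[OF L bt_in[OF p]] bt_in[OF p]])
      fix y g assume g: "lf g"
      have "?\<Delta> (bt p h) (\<lambda>s r. fscale (?\<epsilon> r) s (tst y g)) =
          ?\<Delta> (bt p h) (\<lambda>s r. s (tst y g) * r (tst 1 eps))"
        by (rule tensor_app_cong[OF lin_in[OF \<Delta> bt_in[OF p]] _ V V]) (simp add: CT_counit mult.commute)
      then show "tlift X X X (\<lambda>a b. fscale (?\<epsilon> b) a) (?\<Delta> (bt p h)) (tst y g) = bt p h (tst y g)"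
        by (simp only: tlift_tensor[OF b(2) lin_in[OF \<Delta> bt_in[OF p]]]
          CT_counit_right_bt[OF aut p g] bt_tst[OF g])
    qed
  qed
  show ?thesis
    unfolding coalgebra_def CT_simps CT_vsp using V \<Delta> \<epsilon> coassoc left right by blast
qed

context
  fixes \<alpha> \<beta> \<gamma> \<delta> :: "'h \<Rightarrow> 'h"
  assumes aut: "hopf_automorphism H \<alpha>" "hopf_automorphism H \<beta>"
    "hopf_automorphism H \<gamma>" "hopf_automorphism H \<delta>"
begin

lemma lin_CT_mult': "lin XX X (CT_mult H (\<alpha>, \<beta>) (\<gamma>, \<delta>))"
  by (intro lin_CT_mult aut_le aut aut_inv)

theorem coalgebra_map_CT_mult:
  "coalgebra_map (tensor_coalgebra (CT H S B (\<alpha>, \<beta>)) (CT H S B (\<gamma>, \<delta>)))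
    (CT H S B ((\<alpha>, \<beta>) \<otimes>\<^bsub>Aut_pairs H\<^esub> (\<gamma>, \<delta>))) (CT_mult H (\<alpha>, \<beta>) (\<gamma>, \<delta>))"
proof -
  let ?C = "CT H S B (\<alpha>, \<beta>)" and ?D = "CT H S B (\<gamma>, \<delta>)"
    and ?E = "CT H S B (\<delta> \<circ> \<alpha> \<circ> inv_into UNIV \<delta> \<circ> \<gamma>, \<delta> \<circ> \<beta>)" and ?m = "CT_mult H (\<alpha>, \<beta>) (\<gamma>, \<delta>)"
  note V = vspace_tensor
  have C: "lin X XX (comul ?C)" and D: "lin X XX (comul ?D)" and E: "lin X XX (comul ?E)"
    by (intro lin_CT_comul aut_le aut aut_comp aut_inv)+
  let ?T = "\<lambda>t. tmiddle X X X X (tmap X X XX XX (comul ?C) (comul ?D) t)"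
  have T: "lin XX (tensor XX XX) ?T"
    by (rule lin_comp[OF lin_tmap[OF C D] lin_tmiddle[OF V V V V]])
  have comul: "comul ?E (?m t) = tmap XX XX X X ?m ?m (?T t)" if t: "t \<in> vset XX" for t
  proof (rule lin_XX_eqI[where L = "\<lambda>t. comul ?E (?m t)" and L' = "\<lambda>t. tmap XX XX X X ?m ?m (?T t)",
        OF _ _ _ t])
    show L: "lin XX XX (\<lambda>t. comul ?E (?m t))" by (rule lin_comp[OF lin_CT_mult' E])
    show R: "lin XX XX (\<lambda>t. tmap XX XX X X ?m ?m (?T t))"
      by (rule lin_comp[OF T lin_tmap[OF lin_CT_mult' lin_CT_mult']])
    fix p h q k assume pq: "lf p" "lf q"
    let ?t = "tpure X X (bt p h) (bt q k)"
    have in_XX: "?t \<in> vset XX" by (intro tpure_in_tensor bt_in pq)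
    show "comul ?E (?m ?t) = tmap XX XX X X ?m ?m (?T ?t)"
    proof (rule eq_XX[OF lin_in[OF L in_XX] lin_in[OF R in_XX]])
      fix x f y g assume fg: "lf f" "lf g"
      let ?\<psi> = "\<lambda>a b. a (tst x f) * b (tst y g)"
      have "tmap XX XX X X ?m ?m (?T ?t) ?\<psi> = ?T ?t (\<lambda>a b. ?m a (tst x f) * ?m b (tst y g))"
        by (rule tmap_apply[OF lin_CT_mult' lin_CT_mult' lin_in[OF T in_XX] bilin_tst2])
      also have "\<dots> = comul ?C (bt p h) (\<lambda>a b. comul ?D (bt q k)
          (\<lambda>c d. ?m (tpure X X a c) (tst x f) * ?m (tpure X X b d) (tst y g)))"
        unfolding tmap_tpure[OF C D bt_in[OF pq(1)] bt_in[OF pq(2)]]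
        by (rule tmiddle_tpure_apply[OF V V V V lin_in[OF C bt_in[OF pq(1)]]
              lin_in[OF D bt_in[OF pq(2)]]
              bilin_product[OF lin_comp[OF lin_CT_mult' lin_eval] lin_comp[OF lin_CT_mult' lin_eval]]])
      finally show "comul ?E (?m ?t) ?\<psi> = tmap XX XX X X ?m ?m (?T ?t) ?\<psi>"
        using CT_mult_comul_bt[OF aut pq fg] by simp
    qed
  qed
  let ?c = "\<lambda>c d. counit ?C c * counit ?D d"
  have bc: "bilin X X base_field ?c"
    by (rule bilin_product[OF lin_CT_counit lin_CT_counit])
  have counit: "counit ?E (?m t) = tlift X X base_field ?c t" if t: "t \<in> vset XX" for t
  proof (rule lin_XX_eqI[where L = "\<lambda>t. counit ?E (?m t)" and L' = "tlift X X base_field ?c",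
        OF _ _ _ t])
    show "lin XX base_field (\<lambda>t. counit ?E (?m t))"
      by (rule lin_comp[OF lin_CT_mult' lin_CT_counit])
    show "lin XX base_field (tlift X X base_field ?c)"
      by (rule tlift_universal(1)[OF vspace_base_field bc])
    fix p h q k assume pq: "lf p" "lf q"
    have "conv H q p 1 = q 1 * p 1"
      using pq by (simp add: lf_conv sw_one rules)
    with pq show "counit ?E (?m (tpure X X (bt p h) (bt q k))) =
        tlift X X base_field ?c (tpure X X (bt p h) (bt q k))"
      by (simp add: tlift_universal(2)[OF vspace_base_field bc] bt_in CT_mult_bt' aut CT_counit_bt
          counit_mult aut_eps[OF aut(1)] aut_eps[OF aut(4)] aut_eps[OF aut_inv[OF aut(4)]] mult_ac)
  qed
  show ?thesis
    unfolding coalgebra_map_def Aut_pairs_mult CT_simps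
    using lin_CT_mult' comul counit
    by (simp add: tensor_coalgebra_def CT_simps)
qed

theorem CT_mult_assoc:
  assumes e: "hopf_automorphism H \<kappa>" "hopf_automorphism H \<zeta>" and t: "t \<in> vset (tensor XX X)"
  shows "CT_mult H ((\<alpha>, \<beta>) \<otimes>\<^bsub>Aut_pairs H\<^esub> (\<gamma>, \<delta>)) (\<kappa>, \<zeta>)
      (tmap XX X X X (CT_mult H (\<alpha>, \<beta>) (\<gamma>, \<delta>)) id t) =
    CT_mult H (\<alpha>, \<beta>) ((\<gamma>, \<delta>) \<otimes>\<^bsub>Aut_pairs H\<^esub> (\<kappa>, \<zeta>))
      (tmap X XX X X id (CT_mult H (\<gamma>, \<delta>) (\<kappa>, \<zeta>)) (tassoc X X X t))"
proof -
  let ?L = "\<lambda>t. CT_mult H ((\<alpha>, \<beta>) \<otimes>\<^bsub>Aut_pairs H\<^esub> (\<gamma>, \<delta>)) (\<kappa>, \<zeta>)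
      (tmap XX X X X (CT_mult H (\<alpha>, \<beta>) (\<gamma>, \<delta>)) id t)"
  let ?R = "\<lambda>t. CT_mult H (\<alpha>, \<beta>) ((\<gamma>, \<delta>) \<otimes>\<^bsub>Aut_pairs H\<^esub> (\<kappa>, \<zeta>))
      (tmap X XX X X id (CT_mult H (\<gamma>, \<delta>) (\<kappa>, \<zeta>)) (tassoc X X X t))"
  note auts = aut e aut_comp aut_inv
  note V = vspace_tensor
  have m: "lin XX X (CT_mult H (\<gamma>, \<delta>) (\<kappa>, \<zeta>))" by (intro lin_CT_mult aut_le auts)
  have L: "lin (tensor XX X) X ?L" unfolding Aut_pairs_mult
    by (rule lin_comp[OF lin_tmap[OF lin_CT_mult' lin_id(1)]]) (intro lin_CT_mult aut_le auts)
  have R: "lin (tensor XX X) X ?R" unfolding Aut_pairs_mult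
    by (rule lin_comp[OF lin_tassoc[OF V V V] lin_comp[OF lin_tmap[OF lin_id(1) m]]])
       (intro lin_CT_mult aut_le auts)
  \<comment> \<open>The right-hand bracketing conjugates by \<open>\<zeta> \<circ> \<delta>\<close>;
    its inverse is split to compare with the successive twists on the left.\<close>
  have inv: "inv_into UNIV (\<zeta> \<circ> \<delta>) = inv_into UNIV \<delta> \<circ> inv_into UNIV \<zeta>"
    by (rule o_inv_distrib[OF aut_bij[OF e(2)] aut_bij[OF aut(4)]])
  have "?L (tpure XX X (tpure X X (bt p h) (bt q h')) (bt r h'')) =
      ?R (tpure XX X (tpure X X (bt p h) (bt q h')) (bt r h''))"
    if "lf p" "lf q" "lf r" for p h q h' r h''
    using that unfolding Aut_pairs_mult
    by (simp add: tmap_tpure lin_CT_mult' m lin_id tassoc_tpure V tpure_in_tensor bt_in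
        CT_mult_bt' auts conv_assoc inv aut_inv_simps aut_mult[OF e(2)] aut_mult[OF aut(1)]
        aut_mult[OF aut(4)] aut_mult[OF aut_inv[OF e(2)]] aut_mult[OF aut_inv[OF aut(4)]] mult.assoc)
  then show ?thesis by (rule lin_XX_X_eqI[OF L R _ t])
qed

end

theorem CT_mult_unit:
  assumes aut: "hopf_automorphism H \<alpha>" "hopf_automorphism H \<beta>" and t: "t \<in> vset X"
  shows "CT_mult H (\<alpha>, \<beta>) (id, id) (tmap X base_field X X id (CT_unit H) (tpure X base_field t 1)) = t"
    and "CT_mult H (id, id) (\<alpha>, \<beta>) (tmap base_field X X X (CT_unit H) id (tpure base_field X 1 t)) = t"
proof -
  have u: "CT_unit H 1 = bt eps 1" by (simp add: CT_unit_def fun_eq_iff)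
  have e: "bt eps 1 \<in> vset X" by (rule bt_in[OF lf_eps])
  have "CT_mult H (\<alpha>, \<beta>) (id, id) (tpure X X t (bt eps 1)) = t"
  proof (rule lin_X_eqI[OF lin_comp[OF bilin_left[OF bilin_tpure e]] lin_id(2) _ t])
    show "lin XX X (CT_mult H (\<alpha>, \<beta>) (id, id))" by (rule lin_CT_mult'[OF aut aut_id aut_id])
  qed (simp only: CT_mult_bt'[OF aut(1) aut_id aut_id] lf_eps, simp add: conv_eps aut_one[OF aut(1)])
  then show "CT_mult H (\<alpha>, \<beta>) (id, id) (tmap X base_field X X id (CT_unit H) (tpure X base_field t 1)) = t"
    by (simp add: tmap_tpure lin_id lin_CT_unit t u)
  have "CT_mult H (id, id) (\<alpha>, \<beta>) (tpure X X (bt eps 1) t) = t"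
  proof (rule lin_X_eqI[OF lin_comp[OF bilin_right[OF bilin_tpure e]] lin_id(2) _ t])
    show "lin XX X (CT_mult H (id, id) (\<alpha>, \<beta>))" by (rule lin_CT_mult'[OF aut_id aut_id aut])
  qed (simp only: CT_mult_bt'[OF aut_id aut(2) aut(2)] lf_eps,
      simp add: conv_eps aut_one[OF aut(2)] aut_inv_simps[OF aut(2)])
  then show "CT_mult H (id, id) (\<alpha>, \<beta>) (tmap base_field X X X (CT_unit H) id (tpure base_field X 1 t)) = t"
    by (simp add: tmap_tpure lin_id lin_CT_unit t u)
qed

lemma CT_unit_tst: "lf f \<Longrightarrow> CT_unit H c (tst x f) = c * (eps x * f 1)"
  by (simp add: CT_unit_def)

text \<open>Everything rests on \<open>bt eps 1\<close> being grouplike. Both automorphisms are the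
  identity here, so once \<open>eps\<close> has absorbed the middle leg of \<open>y\<close>, the
  twist is \<open>y2 * Si y1\<close> and cancels.\<close>

theorem coalgebra_map_CT_unit: "coalgebra_map base_coalgebra (CT H S B (id, id)) (CT_unit H)"
proof -
  let ?\<Delta> = "comul (CT H S B (id, id))"
  have \<Delta>: "lin X XX ?\<Delta>" by (intro lin_CT_comul aut_le aut_id)
  have e: "bt eps 1 \<in> vset X" by (rule bt_in[OF lf_eps])
  note \<eta> = lin_CT_unit
  have u: "CT_unit H 1 = bt eps 1" by (simp add: CT_unit_def fun_eq_iff)
  have "?\<Delta> (bt eps 1) = tpure X X (bt eps 1) (bt eps 1)"
  proof (rule eq_XX[OF lin_in[OF \<Delta> e] tpure_in_tensor[OF e e]])
    fix x f y g assume fg: "lf f" "lf g"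
    have "?\<Delta> (bt eps 1) (\<lambda>s r. s (tst x f) * r (tst y g)) =
        sw (\<lambda>y1. sw (\<lambda>y2 y3. eps (x * y2) * (f (y3 * Si y1) * g 1))) y"
      by (subst CT_comul_tst[OF aut_le[OF aut_id] aut_le[OF aut_id] lf_eps fg])
         (simp add: sw_one rules lf_comp[OF fg(1)] fg)
    also have "\<dots> = sw (\<lambda>y1. sw (\<lambda>y2 y3. eps y2 * f (y3 * Si y1))) y * (eps x * g 1)"
      by (simp add: counit_mult flip: sw_mult_right) (simp only: mult_ac)
    also have "\<dots> = eps x * f 1 * (eps y * g 1)"
    proof -
      have "sw (\<lambda>y2 y3. eps y2 * f (y3 * Si y1)) = (\<lambda>r. f (r * Si y1))" for y1
        by (simp add: fun_eq_iff counit_left rules lf_comp[OF fg(1)])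
      then show ?thesis using cancelsD[OF cancels_Si(2) fg(1), of y] by simp
    qed
    finally show "?\<Delta> (bt eps 1) (\<lambda>s r. s (tst x f) * r (tst y g)) =
        tpure X X (bt eps 1) (bt eps 1) (\<lambda>s r. s (tst x f) * r (tst y g))"
      by (simp add: tpure_apply[OF bilin_tst2] fg)
  qed
  then have \<Delta>1: "?\<Delta> (CT_unit H 1) = tpure X X (CT_unit H 1) (CT_unit H 1)" by (simp only: u)
  have "?\<Delta> (CT_unit H c) = tmap base_field base_field X X (CT_unit H) (CT_unit H)
      (fscale c (tpure base_field base_field 1 1))" for c
  proof -
    let ?t = "tpure base_field base_field 1 1 :: ('k, 'k, 'k) tensor"
    have t: "?t \<in> vset (tensor base_field base_field)" by (simp add: tpure_in_tensor)
    have "CT_unit H c = fscale c (CT_unit H 1)" unfolding u by (simp only: CT_unit_def)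
    then have "?\<Delta> (CT_unit H c) = fscale c (?\<Delta> (CT_unit H 1))"
      using lin_scale[OF \<Delta> e, of c] by (simp only: u vscale_tensor)
    also have "\<dots> = fscale c (tmap base_field base_field X X (CT_unit H) (CT_unit H) ?t)"
      by (simp only: \<Delta>1 tmap_tpure[OF \<eta> \<eta>] base_field_simps UNIV_I)
    also have "\<dots> = tmap base_field base_field X X (CT_unit H) (CT_unit H) (fscale c ?t)"
      using lin_scale[OF lin_tmap[OF \<eta> \<eta>] t, of c] by (simp only: vscale_tensor)
    finally show ?thesis .
  qed
  moreover have "counit (CT H S B (id, id)) (CT_unit H c) = c" for c
    using lin_in[OF \<eta>, of c] by (simp add: CT_counit CT_unit_tst lf_eps counit_one)
  ultimately show ?thesis
    unfolding coalgebra_map_def CT_simps using \<eta> by (simp add: base_coalgebra_def)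
qed

theorem CT_antipode_axiom:
  assumes aut: "hopf_automorphism H \<alpha>" "hopf_automorphism H \<beta>" and t: "t \<in> vset X"
  defines "a' \<equiv> (inv_into UNIV \<beta> \<circ> inv_into UNIV \<alpha> \<circ> \<beta>, inv_into UNIV \<beta>)"
  shows "CT_mult H (\<alpha>, \<beta>) a' (tmap X X X X id (CT_antipode H S B (\<alpha>, \<beta>))
      (comul (CT H S B (\<alpha>, \<beta>)) t)) = CT_unit H (counit (CT H S B (\<alpha>, \<beta>)) t)"
    and "CT_mult H a' (\<alpha>, \<beta>) (tmap X X X X (CT_antipode H S B (\<alpha>, \<beta>)) id
      (comul (CT H S B (\<alpha>, \<beta>)) t)) = CT_unit H (counit (CT H S B (\<alpha>, \<beta>)) t)"
proof -
  let ?L = "\<lambda>t. CT_mult H (\<alpha>, \<beta>) a' (tmap X X X X id (CT_antipode H S B (\<alpha>, \<beta>))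
      (comul (CT H S B (\<alpha>, \<beta>)) t))"
  let ?R = "\<lambda>t. CT_mult H a' (\<alpha>, \<beta>) (tmap X X X X (CT_antipode H S B (\<alpha>, \<beta>)) id
      (comul (CT H S B (\<alpha>, \<beta>)) t))"
  let ?u = "\<lambda>t. CT_unit H (counit (CT H S B (\<alpha>, \<beta>)) t)"
  let ?\<Delta> = "comul (CT H S B (\<alpha>, \<beta>))" and ?S = "CT_antipode H S B (\<alpha>, \<beta>)"
  have \<Delta>: "lin X XX ?\<Delta>" by (intro lin_CT_comul aut_le aut)
  note S = lin_CT_antipode[OF aut]
  have m: "lin XX X (CT_mult H (\<alpha>, \<beta>) a')" "lin XX X (CT_mult H a' (\<alpha>, \<beta>))"
    unfolding a'_def by (intro lin_CT_mult aut_le aut aut_inv aut_comp)+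
  note mm = lin_comp[OF m(1) lin_eval] lin_comp[OF m(2) lin_eval]
  have u: "lin X X ?u" by (rule lin_comp[OF lin_CT_counit lin_CT_unit])
  have L: "lin X X ?L" by (rule lin_comp[OF \<Delta> lin_comp[OF lin_tmap[OF lin_id(1) S] m(1)]])
  have R: "lin X X ?R" by (rule lin_comp[OF \<Delta> lin_comp[OF lin_tmap[OF S lin_id(1)] m(2)]])
  show "?L t = ?u t"
  proof (rule lin_X_eqI[OF L u _ t], rule eq_X)
    fix p h x f assume p: "lf p" and f: "lf f"
    note D = lin_in[OF \<Delta> bt_in[OF p]]
    have "?L (bt p h) (tst x f) = ?\<Delta> (bt p h)
        (\<lambda>v w. CT_mult H (\<alpha>, \<beta>) a' (tpure X X (id v) (?S w)) (tst x f))"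
      by (subst lin_apply_tensor[OF mm(1) lin_in[OF lin_tmap[OF lin_id(1) S] D]])
         (rule tmap_apply[OF lin_id(1) S D bilin_comp[OF bilin_tpure mm(1)]])
    then show "?L (bt p h) (tst x f) = ?u (bt p h) (tst x f)"
      using CT_antipode_right_bt[OF aut p f] p f by (simp add: a'_def CT_unit_tst CT_counit_bt)
  qed (auto intro: lin_in[OF L] lin_in[OF u] bt_in)
  show "?R t = ?u t"
  proof (rule lin_X_eqI[OF R u _ t], rule eq_X)
    fix p h x f assume p: "lf p" and f: "lf f"
    note D = lin_in[OF \<Delta> bt_in[OF p]]
    have "?R (bt p h) (tst x f) = ?\<Delta> (bt p h)
        (\<lambda>v w. CT_mult H a' (\<alpha>, \<beta>) (tpure X X (?S v) (id w)) (tst x f))"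
      by (subst lin_apply_tensor[OF mm(2) lin_in[OF lin_tmap[OF S lin_id(1)] D]])
         (rule tmap_apply[OF S lin_id(1) D bilin_comp[OF bilin_tpure mm(2)]])
    then show "?R (bt p h) (tst x f) = ?u (bt p h) (tst x f)"
      using CT_antipode_left_bt[OF aut p f] p f by (simp add: a'_def CT_unit_tst CT_counit_bt)
  qed (auto intro: lin_in[OF R] lin_in[OF u] bt_in)
qed

theorem turaev_algebra_CT:
  "turaev_algebra (Aut_pairs H) (CT H S B) (CT_mult H) (CT_unit H) (CT_antipode H S B)"
  unfolding turaev_algebra_def CT_simps CT_vsp
proof (intro conjI ballI)
  show "group (Aut_pairs H)" by (rule group_Aut_pairs)
  show "coalgebra_map base_coalgebra (CT H S B \<one>\<^bsub>Aut_pairs H\<^esub>) (CT_unit H)"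
    unfolding Aut_pairs_one by (rule coalgebra_map_CT_unit)
  fix a assume "a \<in> carrier (Aut_pairs H)"
  then obtain \<alpha> \<beta> where a: "a = (\<alpha>, \<beta>)" "hopf_automorphism H \<alpha>" "hopf_automorphism H \<beta>"
    by (cases a) (auto simp: Aut_pairs_carrier)
  then have inv_a: "inv\<^bsub>Aut_pairs H\<^esub> a = (inv_into UNIV \<beta> \<circ> inv_into UNIV \<alpha> \<circ> \<beta>, inv_into UNIV \<beta>)"
    by (simp add: Aut_pairs_inv Aut_pairs_carrier)
  show "coalgebra (CT H S B a)" using a by (simp add: coalgebra_CT)
  show "lin X X (CT_antipode H S B a)" using a by (simp add: lin_CT_antipode)
  show "CT_mult H a \<one>\<^bsub>Aut_pairs H\<^esub> (tmap X base_field X X id (CT_unit H) (tpure X base_field t 1)) = t"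
    "CT_mult H \<one>\<^bsub>Aut_pairs H\<^esub> a (tmap base_field X X X (CT_unit H) id (tpure base_field X 1 t)) = t"
    "CT_mult H a (inv\<^bsub>Aut_pairs H\<^esub> a) (tmap X X X X id (CT_antipode H S B a)
      (comul (CT H S B a) t)) = CT_unit H (counit (CT H S B a) t)"
    "CT_mult H (inv\<^bsub>Aut_pairs H\<^esub> a) a (tmap X X X X (CT_antipode H S B a) id
      (comul (CT H S B a) t)) = CT_unit H (counit (CT H S B a) t)"
    if "t \<in> vset X" for t
    unfolding inv_a Aut_pairs_one
    using that a CT_mult_unit CT_antipode_axiom by simp_all
  fix b assume "b \<in> carrier (Aut_pairs H)"
  then obtain \<gamma> \<delta> where b: "b = (\<gamma>, \<delta>)" "hopf_automorphism H \<gamma>" "hopf_automorphism H \<delta>"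
    by (cases b) (auto simp: Aut_pairs_carrier)
  show "coalgebra_map (tensor_coalgebra (CT H S B a) (CT H S B b))
      (CT H S B (a \<otimes>\<^bsub>Aut_pairs H\<^esub> b)) (CT_mult H a b)"
    unfolding a(1) b(1) by (rule coalgebra_map_CT_mult[OF a(2,3) b(2,3)])
  fix c t assume "c \<in> carrier (Aut_pairs H)" and t: "t \<in> vset (tensor XX X)"
  then obtain \<kappa> \<zeta> where c: "c = (\<kappa>, \<zeta>)" "hopf_automorphism H \<kappa>" "hopf_automorphism H \<zeta>"
    by (cases c) (auto simp: Aut_pairs_carrier)
  show "CT_mult H (a \<otimes>\<^bsub>Aut_pairs H\<^esub> b) c (tmap XX X X X (CT_mult H a b) id t) =
    CT_mult H a (b \<otimes>\<^bsub>Aut_pairs H\<^esub> c) (tmap X XX X X id (CT_mult H b c) (tassoc X X X t))"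
    unfolding a(1) b(1) c(1) by (rule CT_mult_assoc[OF a(2,3) b(2,3) c(2,3) t])
qed

end

theorem proposition3p10:
  fixes H :: "('k::field, 'h::ring_1) coalg"
    and S :: "'h \<Rightarrow> 'h"
    and B :: "'h set"
  assumes "hopf_algebra H S"
    and "finite_dimensional_vector_space (vscale H) B"
  shows "turaev_algebra (Aut_pairs H) (CT H S B) (CT_mult H) (CT_unit H) (CT_antipode H S B)"
proof -
  interpret fd_hopf_algebra H S B
    using assms by (simp add: fd_hopf_algebra_def)
  show ?thesis by (rule turaev_algebra_CT)
qed

end
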